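(* Let $A$ be a formula of the language of $\mathrm{HA}^\omega_*$ with free variables $\underline{a}$, and let $T_{\not\exists}$ be a set of $\exists$-free formulas. If $$\mathrm{HA}^{\omega}_*+\mathrm{AC}^{\omega}_*+\mathrm{IP}^*_{\not\exists}+T_{\not\exists}\vdash A(\underline{a}),$$ then there exist closed terms $\underline{t}$ such that $$\mathrm{HA}^{\omega}_*+T_{\not\exists}\vdash A_{HR}(\underline{a},\underline{t}\underline{a}),$$ where $A^{HR}\equiv\exists\underline{x}\,A_{HR}(\underline{a},\underline{x})$.
   Context: Types are generated from the ground type $N$ by $\sigma\to\tau$ and $\sigma^*$. Constants: $0:N$, $S:N\to N$, $R_\sigma:N\to\sigma\to(\sigma\to N\to\sigma)\to\sigma$; $\Pi_{\sigma,\tau}:\sigma\to\tau\to\sigma$; $\Sigma_{\rho,\sigma,\tau}:(\rho\to\sigma\to\tau)\to(\rho\to\sigma)\to\rho\to\tau$; $\mathfrak{s}_\sigma:\sigma\to\sigma^*$; $\cup_\sigma:\sigma^*\to\sigma^*\to\sigma^*$; $\bigcup_{\sigma,\tau}:\sigma^*\to(\sigma\to\tau^* )\to\tau^*$. Terms: constants, typed variables, applications. Atomic formulas: $\bot$, $t=_\rho q$, $t\in_\rho q$ ($q:\rho^*$). Formulas: closed under $\lor,\land,\to,\forall x,\exists x$ and bounded quantifiers $\forall x\in t,\exists x\in t$ ($t:\rho^*$ not containing $x:\rho$). $\exists$-free: no unbounded $\exists x$. $\mathrm{IL}^{\omega}_*$ (in this language) is intuitionistic predicate logic in all finite types with: $x=x$;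 $x=y\land A\to A'$ ($A$ atomic, $A'$ replacing some $x$ by $y$); $\forall x\in t\,A\leftrightarrow\forall x(x\in t\to A)$; $\exists x\in t\,A\leftrightarrow\exists x(x\in t\land A)$; $\Sigma xyz=xz(yz)$; $\Pi xy=x$; $w\in\mathfrak{s}x\leftrightarrow w=x$; $w\in\cup xy\leftrightarrow w\in x\lor w\in y$; $z\in x\land w\in yz\to w\in\bigcup xy$; $\bigcup(\mathfrak{s}x)y=yx$; $\bigcup(\cup xy)z=\cup(\bigcup xz)(\bigcup yz)$. $\mathrm{HA}^\omega_*$ is $\mathrm{IL}^\omega_*$ plus the universal axioms for successor and recursor ($\neg(Sx=0)$, $Sx=Sy\to x=y$, $R0yz=y$, $R(Sx)yz=z(Rxyz)x$) and the full induction scheme $A(0)\land\forall n(A(n)\to A(Sn))\to\forall n\,A(n)$. $\mathrm{AC}^{\omega}_*$: $\forall x^\rho\exists y^\sigma A(x,y)\to\exists f^{\rho\to\sigma^*}\forall x\exists y\in fx\,A(x,y)$. $\mathrm{IP}^*_{\not\exists}$: $(B(x)\to\exists y\,A(y))\to\exists w(B(x)\to\exists y\in w\,A(y))$ for $\exists$-free $B$. The translation $A^{HR}\equiv\exists\underline{x}A_{HR}(\underline{x})$ ($A_{HR}$ $\exists$-free): atomic $A$: $A^{HR}:\equiv A_{HR}:\equiv A$; $(A\lor B)^{HR}:\equiv\exists\underline{x},\underline{u}(A_{HR}(\underline{x})\lor B_{HR}(\underline{u}))$; $(A\land B)^{HR}:\equiv\exists\underline{x},\underline{u}(A_{HR}(\underline{x})\land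 B_{HR}(\underline{u}))$; $(A\to B)^{HR}:\equiv\exists\underline{U}\forall\underline{x}(A_{HR}(\underline{x})\to B_{HR}(\underline{U}\underline{x}))$; $(\exists zA(z))^{HR}:\equiv\exists Z,\underline{x}\,\exists z\in Z\,A_{HR}(z,\underline{x})$; $(\forall zA(z))^{HR}:\equiv\exists\underline{X}\forall z\,A_{HR}(z,\underline{X}z)$; $(\exists z\in t\,A(z))^{HR}:\equiv\exists\underline{x}\exists z\in t\,A_{HR}(z,\underline{x})$; $(\forall z\in t\,A(z))^{HR}:\equiv\exists\underline{x}\forall z\in t\,A_{HR}(z,\underline{x})$, where $A^{HR}\equiv\exists\underline{x}A_{HR}(\underline{x})$ and $B^{HR}\equiv\exists\underline{u}B_{HR}(\underline{u})$. *)

theory Defs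
  imports Main
begin

datatype ty = N | Fun ty ty (infixr "\<rightarrow>" 70) | Star ty

text \<open>
  \<open>Var \<sigma> n\<close> is a variable of type \<open>\<sigma>\<close>. Binding in formulas is by de Bruijn indices that are
  counted separately for each type: an occurrence of \<open>Var \<sigma> n\<close> refers to the (\<open>n+1\<close>)-st enclosing
  quantifier \<^emph>\<open>of type\<close> \<open>\<sigma>\<close>, and if there are only \<open>k \<le> n\<close> of these, it is the free variable
  \<open>(\<sigma>, n - k)\<close>. So there are countably many free variables of each type, and the type of a term
  does not depend on a context.
\<close>

datatype tm =
    Var ty nat
  | Zero | Succ | Rec ty
  | PiC ty ty | SigmaC ty ty ty
  | Sing ty | Cup ty | BigCup ty ty
  | App tm tm (infixl "\<cdot>" 100)

inductive has_ty :: "tm \<Rightarrow> ty \<Rightarrow> bool" (infix "\<Colon>" 50) where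
  "Var \<sigma> n \<Colon> \<sigma>"
| "Zero \<Colon> N"
| "Succ \<Colon> N \<rightarrow> N"
| "Rec \<sigma> \<Colon> N \<rightarrow> \<sigma> \<rightarrow> (\<sigma> \<rightarrow> N \<rightarrow> \<sigma>) \<rightarrow> \<sigma>"
| "PiC \<sigma> \<tau> \<Colon> \<sigma> \<rightarrow> \<tau> \<rightarrow> \<sigma>"
| "SigmaC \<rho> \<sigma> \<tau> \<Colon> (\<rho> \<rightarrow> \<sigma> \<rightarrow> \<tau>) \<rightarrow> (\<rho> \<rightarrow> \<sigma>) \<rightarrow> \<rho> \<rightarrow> \<tau>"
| "Sing \<sigma> \<Colon> \<sigma> \<rightarrow> Star \<sigma>"
| "Cup \<sigma> \<Colon> Star \<sigma> \<rightarrow> Star \<sigma> \<rightarrow> Star \<sigma>"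
| "BigCup \<sigma> \<tau> \<Colon> Star \<sigma> \<rightarrow> (\<sigma> \<rightarrow> Star \<tau>) \<rightarrow> Star \<tau>"
| "s \<Colon> \<sigma> \<rightarrow> \<tau> \<Longrightarrow> t \<Colon> \<sigma> \<Longrightarrow> s \<cdot> t \<Colon> \<tau>"

text \<open>In \<open>BAll \<sigma> t A\<close> and \<open>BEx \<sigma> t A\<close> the bound \<open>t\<close> is outside the scope of the quantifier.\<close>

datatype fm =
    Bot
  | Eq ty tm tm
  | Mem ty tm tm
  | Or fm fm (infixr "\<^bold>\<or>" 130)
  | And fm fm (infixr "\<^bold>\<and>" 135)
  | Imp fm fm (infixr "\<^bold>\<longrightarrow>" 125)
  | All ty fm
  | Ex ty fm
  | BAll ty tm fm
  | BEx ty tm fm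

abbreviation Neg :: "fm \<Rightarrow> fm" where
  "Neg A \<equiv> A \<^bold>\<longrightarrow> Bot"

abbreviation Iff :: "fm \<Rightarrow> fm \<Rightarrow> fm" (infix "\<^bold>\<longleftrightarrow>" 120) where
  "A \<^bold>\<longleftrightarrow> B \<equiv> (A \<^bold>\<longrightarrow> B) \<^bold>\<and> (B \<^bold>\<longrightarrow> A)"

fun wff :: "fm \<Rightarrow> bool" where
  "wff Bot \<longleftrightarrow> True"
| "wff (Eq \<sigma> s t) \<longleftrightarrow> s \<Colon> \<sigma> \<and> t \<Colon> \<sigma>"
| "wff (Mem \<sigma> s t) \<longleftrightarrow> s \<Colon> \<sigma> \<and> t \<Colon> Star \<sigma>"
| "wff (A \<^bold>\<or> B) \<longleftrightarrow> wff A \<and> wff B"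
| "wff (A \<^bold>\<and> B) \<longleftrightarrow> wff A \<and> wff B"
| "wff (A \<^bold>\<longrightarrow> B) \<longleftrightarrow> wff A \<and> wff B"
| "wff (All \<sigma> A) \<longleftrightarrow> wff A"
| "wff (Ex \<sigma> A) \<longleftrightarrow> wff A"
| "wff (BAll \<sigma> t A) \<longleftrightarrow> t \<Colon> Star \<sigma> \<and> wff A"
| "wff (BEx \<sigma> t A) \<longleftrightarrow> t \<Colon> Star \<sigma> \<and> wff A"

fun atomic :: "fm \<Rightarrow> bool" where
  "atomic Bot \<longleftrightarrow> True"
| "atomic (Eq \<sigma> s t) \<longleftrightarrow> True"
| "atomic (Mem \<sigma> s t) \<longleftrightarrow> True"
| "atomic _ \<longleftrightarrow> False"

fun ex_free :: "fm \<Rightarrow> bool" where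
  "ex_free Bot \<longleftrightarrow> True"
| "ex_free (Eq \<sigma> s t) \<longleftrightarrow> True"
| "ex_free (Mem \<sigma> s t) \<longleftrightarrow> True"
| "ex_free (A \<^bold>\<or> B) \<longleftrightarrow> ex_free A \<and> ex_free B"
| "ex_free (A \<^bold>\<and> B) \<longleftrightarrow> ex_free A \<and> ex_free B"
| "ex_free (A \<^bold>\<longrightarrow> B) \<longleftrightarrow> ex_free A \<and> ex_free B"
| "ex_free (All \<sigma> A) \<longleftrightarrow> ex_free A"
| "ex_free (Ex \<sigma> A) \<longleftrightarrow> False"
| "ex_free (BAll \<sigma> t A) \<longleftrightarrow> ex_free A"
| "ex_free (BEx \<sigma> t A) \<longleftrightarrow> ex_free A"

fun fv_tm :: "tm \<Rightarrow> (ty \<times> nat) set" where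
  "fv_tm (Var \<sigma> n) = {(\<sigma>, n)}"
| "fv_tm (s \<cdot> t) = fv_tm s \<union> fv_tm t"
| "fv_tm _ = {}"

definition unbind :: "ty \<Rightarrow> (ty \<times> nat) set \<Rightarrow> (ty \<times> nat) set" where
  "unbind \<sigma> V = {(\<tau>, n). (\<tau>, if \<tau> = \<sigma> then Suc n else n) \<in> V}"

fun fv :: "fm \<Rightarrow> (ty \<times> nat) set" where
  "fv Bot = {}"
| "fv (Eq \<sigma> s t) = fv_tm s \<union> fv_tm t"
| "fv (Mem \<sigma> s t) = fv_tm s \<union> fv_tm t"
| "fv (A \<^bold>\<or> B) = fv A \<union> fv B"
| "fv (A \<^bold>\<and> B) = fv A \<union> fv B"
| "fv (A \<^bold>\<longrightarrow> B) = fv A \<union> fv B"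
| "fv (All \<sigma> A) = unbind \<sigma> (fv A)"
| "fv (Ex \<sigma> A) = unbind \<sigma> (fv A)"
| "fv (BAll \<sigma> t A) = fv_tm t \<union> unbind \<sigma> (fv A)"
| "fv (BEx \<sigma> t A) = fv_tm t \<union> unbind \<sigma> (fv A)"

definition closed_tm :: "tm \<Rightarrow> bool" where
  "closed_tm t \<longleftrightarrow> fv_tm t = {}"

type_synonym sub = "ty \<Rightarrow> nat \<Rightarrow> tm"

fun subst_tm :: "sub \<Rightarrow> tm \<Rightarrow> tm" where
  "subst_tm s (Var \<sigma> n) = s \<sigma> n"
| "subst_tm s (t \<cdot> u) = subst_tm s t \<cdot> subst_tm s u"
| "subst_tm s t = t"

definition shift :: "ty \<Rightarrow> sub" where
  "shift \<sigma> = (\<lambda>\<tau> n. Var \<tau> (if \<tau> = \<sigma> then Suc n else n))"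

definition lift_tm :: "ty \<Rightarrow> tm \<Rightarrow> tm" where
  "lift_tm \<sigma> t = subst_tm (shift \<sigma>) t"

definition scons :: "ty \<Rightarrow> tm \<Rightarrow> sub \<Rightarrow> sub" where
  "scons \<sigma> t s = s(\<sigma> := case_nat t (s \<sigma>))"

definition under :: "ty \<Rightarrow> sub \<Rightarrow> sub" where
  "under \<sigma> s = scons \<sigma> (Var \<sigma> 0) (\<lambda>\<tau> n. lift_tm \<sigma> (s \<tau> n))"

fun subst :: "sub \<Rightarrow> fm \<Rightarrow> fm" where
  "subst s Bot = Bot"
| "subst s (Eq \<sigma> t u) = Eq \<sigma> (subst_tm s t) (subst_tm s u)"
| "subst s (Mem \<sigma> t u) = Mem \<sigma> (subst_tm s t) (subst_tm s u)"
| "subst s (A \<^bold>\<or> B) = subst s A \<^bold>\<or> subst s B"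
| "subst s (A \<^bold>\<and> B) = subst s A \<^bold>\<and> subst s B"
| "subst s (A \<^bold>\<longrightarrow> B) = subst s A \<^bold>\<longrightarrow> subst s B"
| "subst s (All \<sigma> A) = All \<sigma> (subst (under \<sigma> s) A)"
| "subst s (Ex \<sigma> A) = Ex \<sigma> (subst (under \<sigma> s) A)"
| "subst s (BAll \<sigma> t A) = BAll \<sigma> (subst_tm s t) (subst (under \<sigma> s) A)"
| "subst s (BEx \<sigma> t A) = BEx \<sigma> (subst_tm s t) (subst (under \<sigma> s) A)"

definition lift :: "ty \<Rightarrow> fm \<Rightarrow> fm" where
  "lift \<sigma> A = subst (shift \<sigma>) A"

text \<open>\<open>inst \<sigma> t A\<close> is \<open>A(t)\<close>, where \<open>A(x)\<close> is the body of a quantifier over \<open>x\<close> of type \<open>\<sigma>\<close>.\<close>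

definition inst :: "ty \<Rightarrow> tm \<Rightarrow> fm \<Rightarrow> fm" where
  "inst \<sigma> t A = subst (scons \<sigma> t Var) A"

text \<open>
  Intuitionistic natural deduction over the set \<open>Ax\<close> of non-logical axioms. Free variables of
  axioms are generalizable (read universally), in contrast to those of the assumptions \<open>\<Gamma>\<close>.
\<close>

inductive deriv :: "fm set \<Rightarrow> fm list \<Rightarrow> fm \<Rightarrow> bool" for Ax :: "fm set" where
  Axiom: "A \<in> Ax \<Longrightarrow> deriv Ax \<Gamma> A"
| Assm: "A \<in> set \<Gamma> \<Longrightarrow> deriv Ax \<Gamma> A"
| BotE: "deriv Ax \<Gamma> Bot \<Longrightarrow> wff A \<Longrightarrow> deriv Ax \<Gamma> A"
| AndI: "deriv Ax \<Gamma> A \<Longrightarrow> deriv Ax \<Gamma> B \<Longrightarrow> deriv Ax \<Gamma> (A \<^bold>\<and> B)"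
| AndE1: "deriv Ax \<Gamma> (A \<^bold>\<and> B) \<Longrightarrow> deriv Ax \<Gamma> A"
| AndE2: "deriv Ax \<Gamma> (A \<^bold>\<and> B) \<Longrightarrow> deriv Ax \<Gamma> B"
| OrI1: "deriv Ax \<Gamma> A \<Longrightarrow> wff B \<Longrightarrow> deriv Ax \<Gamma> (A \<^bold>\<or> B)"
| OrI2: "deriv Ax \<Gamma> B \<Longrightarrow> wff A \<Longrightarrow> deriv Ax \<Gamma> (A \<^bold>\<or> B)"
| OrE: "deriv Ax \<Gamma> (A \<^bold>\<or> B) \<Longrightarrow> deriv Ax (A # \<Gamma>) C \<Longrightarrow> deriv Ax (B # \<Gamma>) C \<Longrightarrow> deriv Ax \<Gamma> C"
| ImpI: "wff A \<Longrightarrow> deriv Ax (A # \<Gamma>) B \<Longrightarrow> deriv Ax \<Gamma> (A \<^bold>\<longrightarrow> B)"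
| ImpE: "deriv Ax \<Gamma> (A \<^bold>\<longrightarrow> B) \<Longrightarrow> deriv Ax \<Gamma> A \<Longrightarrow> deriv Ax \<Gamma> B"
| AllI: "deriv Ax (map (lift \<sigma>) \<Gamma>) A \<Longrightarrow> deriv Ax \<Gamma> (All \<sigma> A)"
| AllE: "deriv Ax \<Gamma> (All \<sigma> A) \<Longrightarrow> t \<Colon> \<sigma> \<Longrightarrow> deriv Ax \<Gamma> (inst \<sigma> t A)"
| ExI: "deriv Ax \<Gamma> (inst \<sigma> t A) \<Longrightarrow> t \<Colon> \<sigma> \<Longrightarrow> wff A \<Longrightarrow> deriv Ax \<Gamma> (Ex \<sigma> A)"
| ExE: "deriv Ax \<Gamma> (Ex \<sigma> A) \<Longrightarrow> deriv Ax (A # map (lift \<sigma>) \<Gamma>) (lift \<sigma> C) \<Longrightarrow> deriv Ax \<Gamma> C"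

abbreviation provable :: "fm set \<Rightarrow> fm \<Rightarrow> bool" (infix "\<turnstile>" 40) where
  "Ax \<turnstile> A \<equiv> deriv Ax [] A"

text \<open>
  The universal axioms are stated for arbitrary terms in place of the variables. In \<open>eq_repl\<close>,
  \<open>P\<close> is an atomic formula with a distinguished variable of type \<open>\<sigma>\<close> that marks the replaced
  occurrences.
\<close>

inductive_set IL :: "fm set" where
  eq_refl: "x \<Colon> \<sigma> \<Longrightarrow> Eq \<sigma> x x \<in> IL"
| eq_repl: "x \<Colon> \<sigma> \<Longrightarrow> y \<Colon> \<sigma> \<Longrightarrow> atomic P \<Longrightarrow> wff P \<Longrightarrow>
    Eq \<sigma> x y \<^bold>\<and> inst \<sigma> x P \<^bold>\<longrightarrow> inst \<sigma> y P \<in> IL"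
| ball: "t \<Colon> Star \<sigma> \<Longrightarrow> wff A \<Longrightarrow>
    BAll \<sigma> t A \<^bold>\<longleftrightarrow> All \<sigma> (Mem \<sigma> (Var \<sigma> 0) (lift_tm \<sigma> t) \<^bold>\<longrightarrow> A) \<in> IL"
| bex: "t \<Colon> Star \<sigma> \<Longrightarrow> wff A \<Longrightarrow>
    BEx \<sigma> t A \<^bold>\<longleftrightarrow> Ex \<sigma> (Mem \<sigma> (Var \<sigma> 0) (lift_tm \<sigma> t) \<^bold>\<and> A) \<in> IL"
| sigma: "x \<Colon> \<rho> \<rightarrow> \<sigma> \<rightarrow> \<tau> \<Longrightarrow> y \<Colon> \<rho> \<rightarrow> \<sigma> \<Longrightarrow> z \<Colon> \<rho> \<Longrightarrow>
    Eq \<tau> (SigmaC \<rho> \<sigma> \<tau> \<cdot> x \<cdot> y \<cdot> z) (x \<cdot> z \<cdot> (y \<cdot> z)) \<in> IL"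
| pi: "x \<Colon> \<sigma> \<Longrightarrow> y \<Colon> \<tau> \<Longrightarrow> Eq \<sigma> (PiC \<sigma> \<tau> \<cdot> x \<cdot> y) x \<in> IL"
| mem_sing: "w \<Colon> \<sigma> \<Longrightarrow> x \<Colon> \<sigma> \<Longrightarrow> Mem \<sigma> w (Sing \<sigma> \<cdot> x) \<^bold>\<longleftrightarrow> Eq \<sigma> w x \<in> IL"
| mem_cup: "w \<Colon> \<sigma> \<Longrightarrow> x \<Colon> Star \<sigma> \<Longrightarrow> y \<Colon> Star \<sigma> \<Longrightarrow>
    Mem \<sigma> w (Cup \<sigma> \<cdot> x \<cdot> y) \<^bold>\<longleftrightarrow> Mem \<sigma> w x \<^bold>\<or> Mem \<sigma> w y \<in> IL"
| mem_bigcup: "x \<Colon> Star \<sigma> \<Longrightarrow> y \<Colon> \<sigma> \<rightarrow> Star \<tau> \<Longrightarrow> z \<Colon> \<sigma> \<Longrightarrow> w \<Colon> \<tau> \<Longrightarrow>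
    Mem \<sigma> z x \<^bold>\<and> Mem \<tau> w (y \<cdot> z) \<^bold>\<longrightarrow> Mem \<tau> w (BigCup \<sigma> \<tau> \<cdot> x \<cdot> y) \<in> IL"
| bigcup_sing: "x \<Colon> \<sigma> \<Longrightarrow> y \<Colon> \<sigma> \<rightarrow> Star \<tau> \<Longrightarrow>
    Eq (Star \<tau>) (BigCup \<sigma> \<tau> \<cdot> (Sing \<sigma> \<cdot> x) \<cdot> y) (y \<cdot> x) \<in> IL"
| bigcup_cup: "x \<Colon> Star \<sigma> \<Longrightarrow> y \<Colon> Star \<sigma> \<Longrightarrow> z \<Colon> \<sigma> \<rightarrow> Star \<tau> \<Longrightarrow>
    Eq (Star \<tau>) (BigCup \<sigma> \<tau> \<cdot> (Cup \<sigma> \<cdot> x \<cdot> y) \<cdot> z)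
      (Cup \<tau> \<cdot> (BigCup \<sigma> \<tau> \<cdot> x \<cdot> z) \<cdot> (BigCup \<sigma> \<tau> \<cdot> y \<cdot> z)) \<in> IL"

text \<open>In \<open>induction\<close>, the induction variable is \<open>Var N 0\<close>; the substitution in \<open>A(S n)\<close> keeps it bound
  by the same quantifier and fixes all other variables.\<close>

inductive_set HA :: "fm set" where
  IL: "A \<in> IL \<Longrightarrow> A \<in> HA"
| succ_neq_zero: "x \<Colon> N \<Longrightarrow> Neg (Eq N (Succ \<cdot> x) Zero) \<in> HA"
| succ_inj: "x \<Colon> N \<Longrightarrow> y \<Colon> N \<Longrightarrow> Eq N (Succ \<cdot> x) (Succ \<cdot> y) \<^bold>\<longrightarrow> Eq N x y \<in> HA"
| rec_zero: "y \<Colon> \<sigma> \<Longrightarrow> z \<Colon> \<sigma> \<rightarrow> N \<rightarrow> \<sigma> \<Longrightarrow> Eq \<sigma> (Rec \<sigma> \<cdot> Zero \<cdot> y \<cdot> z) y \<in> HA"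
| rec_succ: "x \<Colon> N \<Longrightarrow> y \<Colon> \<sigma> \<Longrightarrow> z \<Colon> \<sigma> \<rightarrow> N \<rightarrow> \<sigma> \<Longrightarrow>
    Eq \<sigma> (Rec \<sigma> \<cdot> (Succ \<cdot> x) \<cdot> y \<cdot> z) (z \<cdot> (Rec \<sigma> \<cdot> x \<cdot> y \<cdot> z) \<cdot> x) \<in> HA"
| induction: "wff A \<Longrightarrow>
    inst N Zero A \<^bold>\<and> All N (A \<^bold>\<longrightarrow> subst (Var(N := (Var N)(0 := Succ \<cdot> Var N 0))) A) \<^bold>\<longrightarrow> All N A \<in> HA"

text \<open>
  In the conclusions of the next two schemata, \<open>A\<close> is weakened by the new variable (\<open>f\<close>, resp.
  \<open>w\<close>), which is bound outside \<open>x\<close> and \<open>y\<close>, resp. outside \<open>y\<close>.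
\<close>

inductive_set AC :: "fm set" where
  "wff A \<Longrightarrow> \<phi> = \<rho> \<rightarrow> Star \<sigma> \<Longrightarrow>
    All \<rho> (Ex \<sigma> A) \<^bold>\<longrightarrow>
    Ex \<phi> (All \<rho> (BEx \<sigma> (lift_tm \<rho> (Var \<phi> 0) \<cdot> Var \<rho> 0) (subst (under \<sigma> (under \<rho> (shift \<phi>))) A))) \<in> AC"

inductive_set IP :: "fm set" where
  "wff A \<Longrightarrow> wff B \<Longrightarrow> ex_free B \<Longrightarrow>
    (B \<^bold>\<longrightarrow> Ex \<sigma> A) \<^bold>\<longrightarrow>
    Ex (Star \<sigma>) (lift (Star \<sigma>) B \<^bold>\<longrightarrow> BEx \<sigma> (Var (Star \<sigma>) 0) (subst (under \<sigma> (shift (Star \<sigma>))) A)) \<in> IP"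

abbreviation Funs :: "ty list \<Rightarrow> ty \<Rightarrow> ty" (infixr "\<rightarrow>*" 70) where
  "\<sigma>s \<rightarrow>* \<tau> \<equiv> foldr Fun \<sigma>s \<tau>"

abbreviation Apps :: "tm \<Rightarrow> tm list \<Rightarrow> tm" (infixl "\<cdot>*" 100) where
  "t \<cdot>* us \<equiv> foldl App t us"

abbreviation Alls :: "ty list \<Rightarrow> fm \<Rightarrow> fm" where
  "Alls \<sigma>s A \<equiv> foldr All \<sigma>s A"

abbreviation lifts_tm :: "ty list \<Rightarrow> tm \<Rightarrow> tm" where
  "lifts_tm \<sigma>s t \<equiv> fold lift_tm \<sigma>s t"

abbreviation lifts :: "ty list \<Rightarrow> fm \<Rightarrow> fm" where
  "lifts \<sigma>s A \<equiv> fold lift \<sigma>s A"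

text \<open>\<open>bvars \<sigma>s\<close> lists the variables bound by \<open>Alls \<sigma>s\<close>, as seen from inside all these quantifiers.\<close>

fun bvars :: "ty list \<Rightarrow> tm list" where
  "bvars [] = []"
| "bvars (\<sigma> # \<sigma>s) = lifts_tm \<sigma>s (Var \<sigma> 0) # bvars \<sigma>s"

text \<open>
  \<open>hr_tys A\<close> are the types of the tuple \<open>x\<close> in \<open>\<exists>x. A\<^sub>H\<^sub>R(x)\<close>, and \<open>hr A ts\<close> is \<open>A\<^sub>H\<^sub>R(ts)\<close>, for a
  tuple of terms \<open>ts\<close> of these types.
\<close>

fun hr_tys :: "fm \<Rightarrow> ty list" where
  "hr_tys Bot = []"
| "hr_tys (Eq \<sigma> s t) = []"
| "hr_tys (Mem \<sigma> s t) = []"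
| "hr_tys (A \<^bold>\<or> B) = hr_tys A @ hr_tys B"
| "hr_tys (A \<^bold>\<and> B) = hr_tys A @ hr_tys B"
| "hr_tys (A \<^bold>\<longrightarrow> B) = map (\<lambda>\<tau>. hr_tys A \<rightarrow>* \<tau>) (hr_tys B)"
| "hr_tys (All \<sigma> A) = map (\<lambda>\<tau>. \<sigma> \<rightarrow> \<tau>) (hr_tys A)"
| "hr_tys (Ex \<sigma> A) = Star \<sigma> # hr_tys A"
| "hr_tys (BAll \<sigma> t A) = hr_tys A"
| "hr_tys (BEx \<sigma> t A) = hr_tys A"

lemma size_subst [simp]: "size (subst s A) = size A"
  by (induction A arbitrary: s) auto

lemma size_lifts [simp]: "size (lifts \<sigma>s A) = size A"
  by (induction \<sigma>s arbitrary: A) (auto simp: lift_def)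

function hr :: "fm \<Rightarrow> tm list \<Rightarrow> fm" where
  "hr Bot ts = Bot"
| "hr (Eq \<sigma> s t) ts = Eq \<sigma> s t"
| "hr (Mem \<sigma> s t) ts = Mem \<sigma> s t"
| "hr (A \<^bold>\<or> B) ts =
    hr A (take (length (hr_tys A)) ts) \<^bold>\<or> hr B (drop (length (hr_tys A)) ts)"
| "hr (A \<^bold>\<and> B) ts =
    hr A (take (length (hr_tys A)) ts) \<^bold>\<and> hr B (drop (length (hr_tys A)) ts)"
| "hr (A \<^bold>\<longrightarrow> B) ts =
    (let \<sigma>s = hr_tys A; xs = bvars \<sigma>s in
     Alls \<sigma>s (hr (lifts \<sigma>s A) xs \<^bold>\<longrightarrow> hr (lifts \<sigma>s B) (map (\<lambda>t. lifts_tm \<sigma>s t \<cdot>* xs) ts)))"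
| "hr (All \<sigma> A) ts = All \<sigma> (hr A (map (\<lambda>t. lift_tm \<sigma> t \<cdot> Var \<sigma> 0) ts))"
| "hr (Ex \<sigma> A) ts = BEx \<sigma> (hd ts) (hr A (map (lift_tm \<sigma>) (tl ts)))"
| "hr (BAll \<sigma> t A) ts = BAll \<sigma> t (hr A (map (lift_tm \<sigma>) ts))"
| "hr (BEx \<sigma> t A) ts = BEx \<sigma> t (hr A (map (lift_tm \<sigma>) ts))"
  by pat_completeness auto
termination
  by (relation "measure (size \<circ> fst)") auto

end

theory Submission
  imports Defs
begin

text \<open>
  The types of realizers all end in a star type, so realizers can be compared by pointwise
  inclusion, and \<open>A\<^sub>H\<^sub>R\<close> is monotone for this order. This makes \<open>\<or>\<close>-elimination (union of the two
  realizers), \<open>\<exists>\<close>-elimination (union over the finite set of candidate witnesses) and bounded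
  quantification realizable; provably equal realizers are a special case. The characteristic
  principles are realized by the singleton of the given function, respectively of the given finite set.

  Soundness is proved by induction on derivations: for all terms realizing the assumptions, there
  are terms realizing the conclusion. Implication and \<open>\<forall>\<close> are handled by realizing the premises
  with fresh variables and abstracting by combinators. Induction needs simultaneous recursion at a
  tuple of types, which is reduced to \<open>R\<close> by continuation passing.
\<close>

section \<open>Substitution\<close>

text \<open>Equality comes without extensionality and without a rule for rewriting under an
  abstraction, so a combinator term that represents an abstraction meets its defining equation only
  once it is applied. Realizers are therefore compared by their values: each conversion is weakened
  to an inclusion, which \<open>hr_mono\<close> accepts.

  A realizer of a disjunction carries no tag for the valid disjunct, and a realizer of an
  existential statement does not single out a witness. Since no case distinction is possible on
  realizers, bounds over all candidates are formed instead. They exist because every component of a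
  realizer tuple stems from an existential quantifier.

  The terms found for a sequent may depend on the substitution applied to it and on the realizers of
  its assumptions; where abstraction requires uniformity, variables are taken as realizers. The
  terms may also contain variables foreign to the proved formula, which are filled with closed terms
  before the free variables of the formula are abstracted.\<close>

inductive_cases has_ty_VarE [elim!]: "Var \<sigma> n \<Colon> \<tau>"
inductive_cases has_ty_AppE: "s \<cdot> t \<Colon> \<tau>"

lemmas has_ty_const [simp] = has_ty.intros(1-9)
lemmas has_ty_App = has_ty.intros(10)

lemma has_ty_Var_iff [simp]: "Var \<sigma> n \<Colon> \<tau> \<longleftrightarrow> \<tau> = \<sigma>"
  by auto

lemma has_ty_unique: "t \<Colon> \<sigma> \<Longrightarrow> t \<Colon> \<tau> \<Longrightarrow> \<sigma> = \<tau>"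
proof (induction arbitrary: \<tau> rule: has_ty.induct)
  case (10 s \<sigma> \<tau>' t)
  then show ?case by (elim has_ty_AppE) blast
qed (auto elim: has_ty.cases)

definition wts :: "sub \<Rightarrow> bool" where
  "wts s \<longleftrightarrow> (\<forall>\<sigma> n. s \<sigma> n \<Colon> \<sigma>)"

definition comp_sub :: "sub \<Rightarrow> sub \<Rightarrow> sub" (infixl "\<odot>" 55) where
  "s \<odot> r = (\<lambda>\<sigma> n. subst_tm s (r \<sigma> n))"

text \<open>This is the composite with \<open>shift \<sigma>\<close> on the right. It has a constant
  of its own so that the simp rules below can normalize substitutions in the manner of the calculus
  of explicit substitutions, with \<open>scons\<close> as cons.\<close>

definition tail :: "ty \<Rightarrow> sub \<Rightarrow> sub" where
  "tail \<sigma> s = s(\<sigma> := \<lambda>n. s \<sigma> (Suc n))"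

lemma subst_tm_cong: "(\<And>\<sigma> n. (\<sigma>, n) \<in> fv_tm t \<Longrightarrow> s \<sigma> n = r \<sigma> n) \<Longrightarrow> subst_tm s t = subst_tm r t"
  by (induction t) auto

lemma subst_tm_subst_tm: "subst_tm s (subst_tm r t) = subst_tm (s \<odot> r) t"
  by (induction t) (auto simp: comp_sub_def)

lemma subst_tm_Var [simp]: "subst_tm Var t = t"
  by (induction t) auto

lemma comp_Var [simp]: "s \<odot> Var = s" "Var \<odot> s = s"
  by (auto simp: comp_sub_def)

lemma comp_shift [simp]: "s \<odot> shift \<sigma> = tail \<sigma> s"
  by (auto simp: comp_sub_def shift_def tail_def fun_eq_iff)

lemma comp_scons [simp]: "s \<odot> scons \<sigma> t r = scons \<sigma> (subst_tm s t) (s \<odot> r)"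
  by (auto simp: comp_sub_def scons_def fun_eq_iff split: nat.split)

lemma comp_assoc [simp]: "s \<odot> r \<odot> q = s \<odot> (r \<odot> q)"
  by (auto simp: comp_sub_def subst_tm_subst_tm)

lemma tail_scons [simp]: "tail \<sigma> (scons \<sigma> t s) = s"
  by (auto simp: tail_def scons_def fun_eq_iff)

lemma scons_tail [simp]: "scons \<sigma> (s \<sigma> 0) (tail \<sigma> s) = s"
  by (auto simp: tail_def scons_def fun_eq_iff split: nat.split)

lemma scons_Var_shift [simp]: "scons \<sigma> (Var \<sigma> 0) (shift \<sigma>) = Var"
  by (auto simp: shift_def scons_def fun_eq_iff split: nat.split)

lemma scons_same [simp]: "scons \<sigma> t s \<sigma> 0 = t"
  by (simp add: scons_def)

lemma under_same [simp]: "under \<sigma> s \<sigma> 0 = Var \<sigma> 0"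
  by (simp add: under_def)

lemma under_alt: "under \<sigma> s = scons \<sigma> (Var \<sigma> 0) (shift \<sigma> \<odot> s)"
  by (simp add: under_def lift_tm_def comp_sub_def)

lemma scons_comp_under [simp]: "scons \<sigma> t s \<odot> under \<sigma> r = scons \<sigma> t (s \<odot> r)"
  by (simp add: under_alt flip: comp_assoc)

lemma tail_under [simp]: "tail \<sigma> (under \<sigma> s) = shift \<sigma> \<odot> s"
  by (simp add: under_alt)

lemma under_comp: "under \<sigma> s \<odot> under \<sigma> r = under \<sigma> (s \<odot> r)"
  by (simp add: under_alt flip: comp_assoc)

lemma under_Var [simp]: "under \<sigma> Var = Var"
  by (simp add: under_alt)

lemma subst_Var [simp]: "subst Var A = A"
  by (induction A) auto

lemma subst_subst: "subst s (subst r A) = subst (s \<odot> r) A"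
  by (induction A arbitrary: s r) (auto simp: subst_tm_subst_tm under_comp)

lemma subst_cong: "(\<And>\<sigma> n. (\<sigma>, n) \<in> fv A \<Longrightarrow> s \<sigma> n = r \<sigma> n) \<Longrightarrow> subst s A = subst r A"
proof (induction A arbitrary: s r)
  case (All \<sigma> A)
  have "subst (under \<sigma> s) A = subst (under \<sigma> r) A"
    using All.prems by (intro All.IH) (auto simp: under_def scons_def unbind_def split: nat.split if_splits)
  then show ?case by simp
next
  case (Ex \<sigma> A)
  have "subst (under \<sigma> s) A = subst (under \<sigma> r) A"
    using Ex.prems by (intro Ex.IH) (auto simp: under_def scons_def unbind_def split: nat.split if_splits)
  then show ?case by simp
next
  case (BAll \<sigma> t A)
  have "subst (under \<sigma> s) A = subst (under \<sigma> r) A"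
    using BAll.prems by (intro BAll.IH) (auto simp: under_def scons_def unbind_def split: nat.split if_splits)
  moreover have "subst_tm s t = subst_tm r t"
    using BAll.prems by (intro subst_tm_cong) auto
  ultimately show ?case by simp
next
  case (BEx \<sigma> t A)
  have "subst (under \<sigma> s) A = subst (under \<sigma> r) A"
    using BEx.prems by (intro BEx.IH) (auto simp: under_def scons_def unbind_def split: nat.split if_splits)
  moreover have "subst_tm s t = subst_tm r t"
    using BEx.prems by (intro subst_tm_cong) auto
  ultimately show ?case by simp
next
  case (Or A B)
  have "subst s A = subst r A" "subst s B = subst r B"
    using Or.prems by (auto intro!: Or.IH)
  then show ?case by simp
next
  case (And A B)
  have "subst s A = subst r A" "subst s B = subst r B"
    using And.prems by (auto intro!: And.IH)
  then show ?case by simp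
next
  case (Imp A B)
  have "subst s A = subst r A" "subst s B = subst r B"
    using Imp.prems by (auto intro!: Imp.IH)
  then show ?case by simp
qed (auto intro!: subst_tm_cong)

lemma subst_closed: "fv A = {} \<Longrightarrow> subst s A = A"
  using subst_cong[of A s Var] by simp

lemma lift_tm_simps [simp]:
  "lift_tm \<sigma> (s \<cdot> t) = lift_tm \<sigma> s \<cdot> lift_tm \<sigma> t"
  "lift_tm \<sigma> Zero = Zero" "lift_tm \<sigma> Succ = Succ" "lift_tm \<sigma> (Rec \<tau>) = Rec \<tau>"
  by (simp_all add: lift_tm_def)

lemma subst_tm_lift_tm [simp]: "subst_tm s (lift_tm \<sigma> t) = subst_tm (tail \<sigma> s) t"
  by (simp add: lift_tm_def subst_tm_subst_tm)

lemma subst_lift [simp]: "subst s (lift \<sigma> A) = subst (tail \<sigma> s) A"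
  by (simp add: lift_def subst_subst)

lemma lift_tm_subst_tm: "lift_tm \<sigma> (subst_tm s t) = subst_tm (shift \<sigma> \<odot> s) t"
  by (simp add: lift_tm_def subst_tm_subst_tm)

lemma lift_subst: "lift \<sigma> (subst s t) = subst (shift \<sigma> \<odot> s) t"
  by (simp add: lift_def subst_subst)

lemma subst_inst: "subst s (inst \<sigma> t A) = inst \<sigma> (subst_tm s t) (subst (under \<sigma> s) A)"
  by (simp add: inst_def subst_subst)

lemma inst_under [simp]: "inst \<sigma> t (subst (under \<sigma> s) A) = subst (scons \<sigma> t s) A"
  by (simp add: inst_def subst_subst)

lemma wts_Var [simp]: "wts Var"
  by (auto simp: wts_def)

lemma wts_shift [simp]: "wts (shift \<sigma>)"
  by (auto simp: wts_def shift_def)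

lemma has_ty_subst_tm [simp]:
  assumes "wts s"
  shows "subst_tm s t \<Colon> \<sigma> \<longleftrightarrow> t \<Colon> \<sigma>"
proof (induction t arbitrary: \<sigma>)
  case (Var \<tau> n)
  then show ?case using assms has_ty_unique by (auto simp: wts_def)
next
  case (App t u)
  then show ?case by (auto elim!: has_ty_AppE intro: has_ty_App)
qed auto

lemma has_ty_lift_tm [simp]: "lift_tm \<sigma> t \<Colon> \<tau> \<longleftrightarrow> t \<Colon> \<tau>"
  by (simp add: lift_tm_def)

lemma wts_comp [simp]: "wts s \<Longrightarrow> wts r \<Longrightarrow> wts (s \<odot> r)"
  unfolding wts_def[of r] wts_def[of "s \<odot> r"] by (simp add: comp_sub_def)

lemma wts_scons [simp]: "t \<Colon> \<sigma> \<Longrightarrow> wts s \<Longrightarrow> wts (scons \<sigma> t s)"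
  by (auto simp: wts_def scons_def split: nat.split)

lemma wts_under [simp]: "wts s \<Longrightarrow> wts (under \<sigma> s)"
  by (simp add: under_alt)

lemma wts_tail [simp]: "wts s \<Longrightarrow> wts (tail \<sigma> s)"
  by (auto simp: wts_def tail_def)

lemma wff_subst [simp]: "wts s \<Longrightarrow> wff (subst s A) \<longleftrightarrow> wff A"
  by (induction A arbitrary: s) auto

lemma wff_lift [simp]: "wff (lift \<sigma> A) \<longleftrightarrow> wff A"
  by (simp add: lift_def)

lemma wff_inst [simp]: "t \<Colon> \<sigma> \<Longrightarrow> wff (inst \<sigma> t A) \<longleftrightarrow> wff A"
  by (simp add: inst_def)

lemma ex_free_subst [simp]: "ex_free (subst s A) \<longleftrightarrow> ex_free A"
  by (induction A arbitrary: s) auto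

lemma hr_tys_subst [simp]: "hr_tys (subst s A) = hr_tys A"
  by (induction A arbitrary: s) auto

lemma hr_tys_lift [simp]: "hr_tys (lift \<sigma> A) = hr_tys A"
  by (simp add: lift_def)

lemma hr_tys_inst [simp]: "hr_tys (inst \<sigma> t A) = hr_tys A"
  by (simp add: inst_def)

lemma hr_tys_lifts [simp]: "hr_tys (lifts \<sigma>s A) = hr_tys A"
  by (induction \<sigma>s arbitrary: A) auto

section \<open>Blocks of quantifiers\<close>

abbreviation unders :: "ty list \<Rightarrow> sub \<Rightarrow> sub" where
  "unders \<sigma>s s \<equiv> fold under \<sigma>s s"

text \<open>The first entry is consed first and so lies deepest, because the first type of
  \<open>Alls \<sigma>s\<close> belongs to the outermost quantifier.\<close>

fun sconses :: "ty list \<Rightarrow> tm list \<Rightarrow> sub \<Rightarrow> sub" where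
  "sconses (\<sigma> # \<sigma>s) (t # ts) s = sconses \<sigma>s ts (scons \<sigma> t s)"
| "sconses _ _ s = s"

abbreviation has_tys :: "tm list \<Rightarrow> ty list \<Rightarrow> bool" (infix "\<Colon>*" 50) where
  "ts \<Colon>* \<sigma>s \<equiv> list_all2 has_ty ts \<sigma>s"

lemma subst_Alls: "subst s (Alls \<sigma>s A) = Alls \<sigma>s (subst (unders \<sigma>s s) A)"
  by (induction \<sigma>s arbitrary: s) auto

lemma under_subst_lift_tm: "subst_tm (under \<sigma> s) (lift_tm \<sigma> t) = lift_tm \<sigma> (subst_tm s t)"
  by (simp add: lift_tm_subst_tm)

lemma under_subst_lift: "subst (under \<sigma> s) (lift \<sigma> A) = lift \<sigma> (subst s A)"
  by (simp add: lift_subst)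

lemma unders_lifts_tm: "subst_tm (unders \<sigma>s s) (lifts_tm \<sigma>s t) = lifts_tm \<sigma>s (subst_tm s t)"
  by (induction \<sigma>s arbitrary: s t) (auto simp: under_subst_lift_tm simp del: subst_tm_lift_tm)

lemma unders_lifts: "subst (unders \<sigma>s s) (lifts \<sigma>s A) = lifts \<sigma>s (subst s A)"
  by (induction \<sigma>s arbitrary: s A) (auto simp: under_subst_lift simp del: subst_lift)

lemma unders_bvars: "map (subst_tm (unders \<sigma>s s)) (bvars \<sigma>s) = bvars \<sigma>s"
  by (induction \<sigma>s arbitrary: s) (auto simp: unders_lifts_tm)

lemma sconses_lifts_tm:
  "length ts = length \<sigma>s \<Longrightarrow> subst_tm (sconses \<sigma>s ts s) (lifts_tm \<sigma>s t) = subst_tm s t"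
  by (induction \<sigma>s ts s arbitrary: t rule: sconses.induct) auto

lemma sconses_lifts:
  "length ts = length \<sigma>s \<Longrightarrow> subst (sconses \<sigma>s ts s) (lifts \<sigma>s A) = subst s A"
  by (induction \<sigma>s ts s arbitrary: A rule: sconses.induct) auto

lemma sconses_bvars: "length ts = length \<sigma>s \<Longrightarrow> map (subst_tm (sconses \<sigma>s ts s)) (bvars \<sigma>s) = ts"
  by (induction \<sigma>s ts s rule: sconses.induct) (auto simp: sconses_lifts_tm)

lemma wts_sconses: "ts \<Colon>* \<sigma>s \<Longrightarrow> wts s \<Longrightarrow> wts (sconses \<sigma>s ts s)"
  by (induction \<sigma>s ts s rule: sconses.induct) auto

lemma has_ty_lifts_tm [simp]: "lifts_tm \<sigma>s t \<Colon> \<tau> \<longleftrightarrow> t \<Colon> \<tau>"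
  by (induction \<sigma>s arbitrary: t) auto

lemma wff_lifts [simp]: "wff (lifts \<sigma>s A) \<longleftrightarrow> wff A"
  by (induction \<sigma>s arbitrary: A) auto

lemma has_tys_bvars [simp]: "bvars \<sigma>s \<Colon>* \<sigma>s"
  by (induction \<sigma>s) auto

lemma length_bvars [simp]: "length (bvars \<sigma>s) = length \<sigma>s"
  by (induction \<sigma>s) auto

lemma has_ty_Apps: "t \<Colon> \<sigma>s \<rightarrow>* \<tau> \<Longrightarrow> us \<Colon>* \<sigma>s \<Longrightarrow> t \<cdot>* us \<Colon> \<tau>"
  by (induction \<sigma>s arbitrary: t us) (auto simp: list_all2_Cons2 dest: has_ty_App)

lemma subst_tm_Apps [simp]: "subst_tm s (t \<cdot>* us) = subst_tm s t \<cdot>* map (subst_tm s) us"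
  by (induction us arbitrary: t) auto

lemma has_tys_subst [simp]: "wts s \<Longrightarrow> map (subst_tm s) ts \<Colon>* \<sigma>s \<longleftrightarrow> ts \<Colon>* \<sigma>s"
  by (simp add: list_all2_map1)

lemma has_tys_lift [simp]: "map (lift_tm \<sigma>) ts \<Colon>* \<sigma>s \<longleftrightarrow> ts \<Colon>* \<sigma>s"
  by (simp add: list_all2_map1)

lemma has_tys_Apps:
  assumes "ts \<Colon>* map (\<lambda>\<tau>. \<sigma>s \<rightarrow>* \<tau>) \<tau>s" "us \<Colon>* \<sigma>s"
  shows "map (\<lambda>t. t \<cdot>* us) ts \<Colon>* \<tau>s"
  using assms(1) has_ty_Apps[OF _ assms(2)] by (auto simp: list_all2_conv_all_nth)

lemma has_tys_App:
  assumes "ts \<Colon>* map (\<lambda>\<tau>. \<sigma> \<rightarrow> \<tau>) \<tau>s" "u \<Colon> \<sigma>"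
  shows "map (\<lambda>t. t \<cdot> u) ts \<Colon>* \<tau>s"
  using assms has_ty_App by (auto simp: list_all2_conv_all_nth)

lemma wff_Alls [simp]: "wff (Alls \<sigma>s A) \<longleftrightarrow> wff A"
  by (induction \<sigma>s) auto

text \<open>The form with \<open>take\<close> and \<open>drop\<close> matches the way
  \<open>hr\<close> splits the tuple of a disjunction or conjunction.\<close>

lemma list_all2_append_right:
  "list_all2 P ts (us @ vs) \<longleftrightarrow>
    list_all2 P (take (length us) ts) us \<and> list_all2 P (drop (length us) ts) vs"
proof
  assume "list_all2 P ts (us @ vs)"
  then show "list_all2 P (take (length us) ts) us \<and> list_all2 P (drop (length us) ts) vs"
    by (auto simp: list_all2_append2 dest: list_all2_lengthD)
next
  assume "list_all2 P (take (length us) ts) us \<and> list_all2 P (drop (length us) ts) vs"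
  then show "list_all2 P ts (us @ vs)"
    using list_all2_appendI by fastforce
qed

text \<open>The length hypothesis keeps \<open>hd\<close> away from the empty list in the clause for
  \<open>Ex\<close>, where it need not commute with substitution. In the clause for implication, the
  substitution is pushed under the whole block by \<open>unders\<close>, which fixes the block
  variables.\<close>

lemma subst_hr:
  "length ts = length (hr_tys A) \<Longrightarrow> subst s (hr A ts) = hr (subst s A) (map (subst_tm s) ts)"
proof (induction A ts arbitrary: s rule: hr.induct)
  case (6 A B ts)
  let ?\<sigma>s = "hr_tys A"
  have B: "map (subst_tm (unders ?\<sigma>s s)) (map (\<lambda>t. lifts_tm ?\<sigma>s t \<cdot>* bvars ?\<sigma>s) ts) =
      map (\<lambda>t. lifts_tm ?\<sigma>s t \<cdot>* bvars ?\<sigma>s) (map (subst_tm s) ts)"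
    by (simp add: unders_lifts_tm unders_bvars)
  show ?case
    using 6(1)[OF refl refl, of "unders ?\<sigma>s s"] 6(2)[OF refl refl, of "unders ?\<sigma>s s"] 6(3)
    by (simp only: hr.simps Let_def subst.simps subst_Alls unders_lifts B unders_bvars hr_tys_subst
        length_map hr_tys.simps hr_tys_lifts length_bvars)
next
  case (8 \<sigma> A ts)
  then obtain u us where "ts = u # us" by (cases ts) auto
  with 8 show ?case by (simp add: comp_def lift_tm_subst_tm)
qed (auto simp: take_map drop_map comp_def lift_tm_subst_tm)

lemma lift_hr:
  "length ts = length (hr_tys A) \<Longrightarrow> lift \<sigma> (hr A ts) = hr (lift \<sigma> A) (map (lift_tm \<sigma>) ts)"
  by (simp add: lift_def subst_hr lift_tm_def[abs_def])

lemma inst_hr: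
  "length ts = length (hr_tys A) \<Longrightarrow>
    inst \<sigma> u (hr A ts) = hr (inst \<sigma> u A) (map (subst_tm (scons \<sigma> u Var)) ts)"
  by (simp add: inst_def subst_hr)

lemma lifts_hr:
  "length ts = length (hr_tys A) \<Longrightarrow> lifts \<sigma>s (hr A ts) = hr (lifts \<sigma>s A) (map (lifts_tm \<sigma>s) ts)"
  by (induction \<sigma>s arbitrary: A ts) (auto simp: lift_hr comp_def)

lemma wff_hr: "wff A \<Longrightarrow> ts \<Colon>* hr_tys A \<Longrightarrow> wff (hr A ts)"
proof (induction A ts rule: hr.induct)
  case (6 A B ts)
  let ?\<sigma>s = "hr_tys A"
  have "map (\<lambda>t. lifts_tm ?\<sigma>s t \<cdot>* bvars ?\<sigma>s) ts \<Colon>* hr_tys B"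
    using has_tys_Apps[of "map (lifts_tm ?\<sigma>s) ts" ?\<sigma>s "hr_tys B" "bvars ?\<sigma>s"] 6(4)
    by (simp add: list_all2_map1 comp_def)
  then show ?case using 6 by (simp add: Let_def)
next
  case (7 \<sigma> A ts)
  have "map (\<lambda>t. lift_tm \<sigma> t \<cdot> Var \<sigma> 0) ts \<Colon>* hr_tys A"
    using has_tys_App[of "map (lift_tm \<sigma>) ts"] 7(3) by (simp add: comp_def)
  then show ?case using 7 by simp
next
  case (8 \<sigma> A ts)
  then show ?case by (cases ts) auto
qed (auto simp: list_all2_append_right)

text \<open>This is why the axioms in \<open>T\<close> survive the translation unchanged, and why
  the premise of an instance of \<open>IP\<close> contributes no arguments to the realizers of an
  implication.\<close>

lemma hr_ex_free: "ex_free A \<Longrightarrow> hr_tys A = [] \<and> hr A [] = A"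
  by (induction A) auto

section \<open>Derivations\<close>

lemma deriv_mono: "deriv Ax \<Gamma> A \<Longrightarrow> set \<Gamma> \<subseteq> set \<Delta> \<Longrightarrow> deriv Ax \<Delta> A"
proof (induction arbitrary: \<Delta> rule: deriv.induct)
  case (OrE \<Gamma> A B C)
  have "deriv Ax (A # \<Delta>) C"
    using OrE.prems by (intro OrE.IH(2)) auto
  moreover have "deriv Ax (B # \<Delta>) C"
    using OrE.prems by (intro OrE.IH(3)) auto
  moreover note OrE
  ultimately show ?case by (blast intro: deriv.OrE)
next
  case (ImpI A \<Gamma> B)
  have "deriv Ax (A # \<Delta>) B"
    using ImpI.prems by (auto intro!: ImpI.IH)
  with ImpI show ?case by (blast intro: deriv.ImpI)
next
  case (AllI \<sigma> \<Gamma> A)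
  have "deriv Ax (map (lift \<sigma>) \<Delta>) A"
    using AllI.prems by (intro AllI.IH) (simp add: image_mono)
  then show ?case by (blast intro: deriv.AllI)
next
  case (ExE \<Gamma> \<sigma> A C)
  have "deriv Ax (A # map (lift \<sigma>) \<Delta>) (lift \<sigma> C)"
    using ExE.prems by (intro ExE.IH(2)) (simp, blast)
  with ExE show ?case by (blast intro: deriv.ExE)
qed (auto intro: deriv.intros)

section \<open>Universal closure and substitution in derivations\<close>

lemma unbind_iff: "(\<tau>, n) \<in> unbind \<sigma> V \<longleftrightarrow> (\<tau>, if \<tau> = \<sigma> then Suc n else n) \<in> V"
  by (simp add: unbind_def)

lemma finite_unbind: "finite V \<Longrightarrow> finite (unbind \<sigma> V)"
proof -
  assume "finite V"
  moreover have "unbind \<sigma> V = (\<lambda>(\<tau>, n). (\<tau>, if \<tau> = \<sigma> then Suc n else n)) -` V"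
    by (auto simp: unbind_iff)
  moreover have "inj (\<lambda>(\<tau>, n). (\<tau>, if \<tau> = \<sigma> then Suc n else n))"
    by (auto simp: inj_def split: if_splits)
  ultimately show ?thesis by (simp add: finite_vimageI)
qed

lemma finite_fv_tm: "finite (fv_tm t)"
  by (induction t) auto

lemma finite_fv: "finite (fv A)"
  by (induction A) (auto simp: finite_unbind finite_fv_tm)

text \<open>Indices are counted per type, so each quantifier of type \<open>\<tau>\<close> in the
  block lowers the outer index of a variable of type \<open>\<tau>\<close> by one, and no other
  quantifier affects it.\<close>

lemma fv_Alls_iff: "(\<tau>, n) \<in> fv (Alls \<sigma>s A) \<longleftrightarrow> (\<tau>, n + count_list \<sigma>s \<tau>) \<in> fv A"
  by (induction \<sigma>s arbitrary: n) (auto simp: unbind_iff)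

lemma count_list_replicate: "count_list (replicate k x) x = k"
  by (induction k) auto

lemma count_list_replicates:
  assumes "(\<tau>, n) \<in> set xs"
  shows "n < count_list (concat (map (\<lambda>(\<tau>, n). replicate (Suc n) \<tau>) xs)) \<tau>"
proof -
  obtain ys zs where "xs = ys @ (\<tau>, n) # zs" using assms by (meson split_list)
  then show ?thesis using count_list_replicate[of n \<tau>] by simp
qed

text \<open>Binding the variable of index \<open>n\<close> takes \<open>Suc n\<close> quantifiers of
  its type. The block therefore has \<open>Suc n\<close> copies of \<open>\<tau>\<close> for each
  free variable \<open>(\<tau>, n)\<close>; more than necessary do no harm.\<close>

lemma ex_closing_block: "\<exists>\<sigma>s. fv (Alls \<sigma>s A) = {}"
proof -
  obtain xs where xs: "set xs = fv A" using finite_list[OF finite_fv] by blast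
  have "(\<tau>, n) \<notin> fv (Alls (concat (map (\<lambda>(\<tau>, n). replicate (Suc n) \<tau>) xs)) A)" for \<tau> n
    using count_list_replicates[of \<tau> "n + count_list _ \<tau>" xs] xs unfolding fv_Alls_iff by fastforce
  then show ?thesis by (metis equals0I surj_pair)
qed

lemma provable_Alls: "Ax \<turnstile> A \<Longrightarrow> Ax \<turnstile> Alls \<sigma>s A"
  by (induction \<sigma>s) (auto intro: AllI)

text \<open>The set \<open>Ax\<close> is not assumed to be closed under substitution, so an
  induction on the derivation would get stuck at \<open>Axiom\<close>. Instead the formula is closed
  by generalization; the closure is fixed by every substitution, and instantiating its quantifiers
  yields all well-typed instances.\<close>

lemma provable_subst:
  assumes "Ax \<turnstile> A" "wts s"
  shows "Ax \<turnstile> subst s A"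
proof -
  obtain \<sigma>s where "fv (Alls \<sigma>s A) = {}" using ex_closing_block by blast
  then have "Ax \<turnstile> subst r (Alls \<sigma>s A)" for r
    using assms provable_Alls subst_closed by metis
  \<comment> \<open>With the premise \<open>wts r\<close> the claim has the shape that the induction
    passes on: once a quantifier has been removed, only well-typed instances are available.\<close>
  then have "wts r \<Longrightarrow> Ax \<turnstile> subst r (Alls \<sigma>s A)" for r .
  then have "wts s \<Longrightarrow> Ax \<turnstile> subst s A" for s
  proof (induction \<sigma>s arbitrary: s)
    case (Cons \<sigma> \<sigma>s)
    have "Ax \<turnstile> subst r (Alls \<sigma>s A)" if "wts r" for r
    proof -
      \<comment> \<open>An arbitrary \<open>r\<close> is
        \<open>scons \<sigma> (r \<sigma> 0) (tail \<sigma> r)\<close>, so it is reached by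
        substituting \<open>tail \<sigma> r\<close> and then instantiating the outer quantifier at
        \<open>r \<sigma> 0\<close>.\<close>
      have "Ax \<turnstile> All \<sigma> (subst (under \<sigma> (tail \<sigma> r)) (Alls \<sigma>s A))"
        using Cons.prems(2)[of "tail \<sigma> r"] that by simp
      then have "Ax \<turnstile> inst \<sigma> (r \<sigma> 0) (subst (under \<sigma> (tail \<sigma> r)) (Alls \<sigma>s A))"
        by (rule AllE) (use that in \<open>simp add: wts_def\<close>)
      then show ?thesis by simp
    qed
    with Cons show ?case by blast
  qed simp
  then show ?thesis using assms by blast
qed

lemma deriv_subst:
  "deriv Ax \<Gamma> A \<Longrightarrow> wts s \<Longrightarrow> deriv Ax (map (subst s) \<Gamma>) (subst s A)"
proof (induction arbitrary: s rule: deriv.induct)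
  case (Axiom A \<Gamma>)
  then show ?case using provable_subst[OF deriv.Axiom] deriv_mono by fastforce
next
  case (OrE \<Gamma> A B C)
  show ?case by (rule deriv.OrE[of _ _ "subst s A" "subst s B"]) (use OrE in auto)
next
  case (AllI \<sigma> \<Gamma> A)
  then show ?case by (auto simp: lift_subst comp_def intro!: deriv.AllI dest!: meta_spec[of _ "under \<sigma> s"])
next
  case (AllE \<Gamma> \<sigma> A t)
  then have "deriv Ax (map (subst s) \<Gamma>) (inst \<sigma> (subst_tm s t) (subst (under \<sigma> s) A))"
    by (intro deriv.AllE) auto
  then show ?case by (simp add: subst_inst)
next
  case (ExI \<Gamma> \<sigma> t A)
  then have "deriv Ax (map (subst s) \<Gamma>) (Ex \<sigma> (subst (under \<sigma> s) A))"
    by (intro deriv.ExI[of _ _ _ "subst_tm s t"]) (auto simp: subst_inst simp del: inst_under)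
  then show ?case by simp
next
  case (ExE \<Gamma> \<sigma> A C)
  show ?case
    by (rule deriv.ExE[of _ _ \<sigma> "subst (under \<sigma> s) A"])
      (use ExE.IH(1)[of s] ExE.IH(2)[of "under \<sigma> s"] ExE.prems in \<open>auto simp: lift_subst comp_def\<close>)
qed (auto intro: deriv.intros)

lemma deriv_lift: "deriv Ax \<Gamma> A \<Longrightarrow> deriv Ax (map (lift \<sigma>) \<Gamma>) (lift \<sigma> A)"
  unfolding lift_def[abs_def] by (rule deriv_subst) auto

lemma deriv_lifts: "deriv Ax \<Gamma> A \<Longrightarrow> deriv Ax (map (lifts \<sigma>s) \<Gamma>) (lifts \<sigma>s A)"
proof (induction \<sigma>s arbitrary: \<Gamma> A)
  case (Cons \<sigma> \<sigma>s)
  show ?case using Cons.IH[OF deriv_lift[OF Cons.prems, of \<sigma>]] by (simp add: comp_def)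
qed simp

text \<open>The given derivations are carried along through the proof: they are weakened wherever a
  rule discharges a hypothesis and lifted wherever it introduces an eigenvariable. It serves to
  trade a conjunction among the hypotheses for its members.\<close>

lemma deriv_cut: "deriv Ax \<Gamma> A \<Longrightarrow> (\<And>G. G \<in> set \<Gamma> \<Longrightarrow> deriv Ax \<Delta> G) \<Longrightarrow> deriv Ax \<Delta> A"
proof (induction arbitrary: \<Delta> rule: deriv.induct)
  case (OrE \<Gamma> A B C)
  have "deriv Ax (D # \<Delta>) G" if "G \<in> set (D # \<Gamma>)" for D G
    using that OrE.prems deriv_mono[of Ax \<Delta> G "D # \<Delta>"] by (auto intro: deriv.Assm)
  with OrE show ?case by (blast intro: deriv.OrE)
next
  case (ImpI A \<Gamma> B)
  have "deriv Ax (A # \<Delta>) G" if "G \<in> set (A # \<Gamma>)" for G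
    using that ImpI.prems deriv_mono[of Ax \<Delta> G "A # \<Delta>"] by (auto intro: deriv.Assm)
  with ImpI show ?case by (blast intro: deriv.ImpI)
next
  case (AllI \<sigma> \<Gamma> A)
  then show ?case by (force intro!: deriv.AllI AllI.IH deriv_lift)
next
  case (ExE \<Gamma> \<sigma> A C)
  have "deriv Ax (A # map (lift \<sigma>) \<Delta>) G" if "G \<in> set (A # map (lift \<sigma>) \<Gamma>)" for G
    using that ExE.prems deriv_mono[OF deriv_lift[of Ax \<Delta> _ \<sigma>], of _ "A # map (lift \<sigma>) \<Delta>"]
    by (auto intro: deriv.Assm)
  with ExE show ?case by (blast intro: deriv.ExE)
qed (auto intro: deriv.intros)

lemma deriv_wff:
  "deriv Ax \<Gamma> A \<Longrightarrow> (\<And>B. B \<in> Ax \<Longrightarrow> wff B) \<Longrightarrow> (\<And>B. B \<in> set \<Gamma> \<Longrightarrow> wff B) \<Longrightarrow> wff A"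
proof (induction rule: deriv.induct)
  case (AllI \<sigma> \<Gamma> A)
  then show ?case by fastforce
next
  case (ExE \<Gamma> \<sigma> A C)
  then have "wff (lift \<sigma> C)" by (intro ExE.IH(2)) auto
  then show ?case by simp
qed auto

lemma AllsI: "deriv Ax (map (lifts \<sigma>s) \<Gamma>) A \<Longrightarrow> deriv Ax \<Gamma> (Alls \<sigma>s A)"
proof (induction \<sigma>s arbitrary: \<Gamma>)
  case (Cons \<sigma> \<sigma>s)
  then show ?case by (auto intro!: AllI simp: comp_def)
qed (simp add: comp_def)

lemma AllsE:
  assumes "deriv Ax \<Gamma> (Alls \<sigma>s A)" "ts \<Colon>* \<sigma>s"
  shows "deriv Ax \<Gamma> (subst (sconses \<sigma>s ts Var) A)"
proof -
  have "deriv Ax \<Gamma> (subst (sconses \<sigma>s ts s) A)" if "deriv Ax \<Gamma> (subst s (Alls \<sigma>s A))" for s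
    using assms(2) that
  proof (induction \<sigma>s ts s rule: sconses.induct)
    case (1 \<sigma> \<sigma>s t ts s)
    then show ?case using AllE[of Ax \<Gamma> \<sigma> _ t] by fastforce
  qed auto
  then show ?thesis using assms(1) by (metis subst_Var)
qed

text \<open>Instantiation at the newest variable undoes the lifting of the body, since
  \<open>scons \<sigma> (Var \<sigma> 0) (shift \<sigma>)\<close> is the identity
  substitution.\<close>

lemma deriv_lift_Var_E:
  assumes "deriv Ax (map (lift \<sigma>) \<Gamma>) (lift \<sigma> (All \<sigma> A))"
  shows "deriv Ax (map (lift \<sigma>) \<Gamma>) A"
  using AllE[of Ax "map (lift \<sigma>) \<Gamma>" \<sigma> _ "Var \<sigma> 0"] assms by (fastforce simp: lift_def)

section \<open>Derived rules for equality and the bounded quantifiers\<close>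

locale il_theory =
  fixes Ax :: "fm set"
  assumes IL_sub: "IL \<subseteq> Ax"
begin

abbreviation derives :: "fm list \<Rightarrow> fm \<Rightarrow> bool" (infix "\<tturnstile>" 40) where
  "\<Gamma> \<tturnstile> A \<equiv> deriv Ax \<Gamma> A"

lemma IL_deriv: "A \<in> IL \<Longrightarrow> \<Gamma> \<tturnstile> A"
  using IL_sub by (auto intro: Axiom)

lemma Eq_refl: "t \<Colon> \<sigma> \<Longrightarrow> \<Gamma> \<tturnstile> Eq \<sigma> t t"
  by (intro IL_deriv IL.eq_refl)

lemma Eq_repl:
  "\<Gamma> \<tturnstile> Eq \<sigma> x y \<Longrightarrow> \<Gamma> \<tturnstile> inst \<sigma> x P \<Longrightarrow> atomic P \<Longrightarrow> wff P \<Longrightarrow> x \<Colon> \<sigma> \<Longrightarrow> y \<Colon> \<sigma> \<Longrightarrow> \<Gamma> \<tturnstile> inst \<sigma> y P"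
  by (rule ImpE[OF IL_deriv[OF IL.eq_repl] AndI])

lemma Eq_sym: "\<Gamma> \<tturnstile> Eq \<sigma> x y \<Longrightarrow> x \<Colon> \<sigma> \<Longrightarrow> y \<Colon> \<sigma> \<Longrightarrow> \<Gamma> \<tturnstile> Eq \<sigma> y x"
  using Eq_repl[of \<Gamma> \<sigma> x y "Eq \<sigma> (Var \<sigma> 0) (lift_tm \<sigma> x)"] Eq_refl[of x \<sigma>] by (simp add: inst_def)

lemma Eq_trans:
  "\<Gamma> \<tturnstile> Eq \<sigma> x y \<Longrightarrow> \<Gamma> \<tturnstile> Eq \<sigma> y z \<Longrightarrow> x \<Colon> \<sigma> \<Longrightarrow> y \<Colon> \<sigma> \<Longrightarrow> z \<Colon> \<sigma> \<Longrightarrow> \<Gamma> \<tturnstile> Eq \<sigma> x z"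
  using Eq_repl[of \<Gamma> \<sigma> y z "Eq \<sigma> (lift_tm \<sigma> x) (Var \<sigma> 0)"] by (simp add: inst_def)

lemma Eq_App1:
  "\<Gamma> \<tturnstile> Eq (\<sigma> \<rightarrow> \<tau>) x y \<Longrightarrow> x \<Colon> \<sigma> \<rightarrow> \<tau> \<Longrightarrow> y \<Colon> \<sigma> \<rightarrow> \<tau> \<Longrightarrow> t \<Colon> \<sigma> \<Longrightarrow> \<Gamma> \<tturnstile> Eq \<tau> (x \<cdot> t) (y \<cdot> t)"
  using Eq_repl[of \<Gamma> "\<sigma> \<rightarrow> \<tau>" x y "Eq \<tau> (lift_tm (\<sigma> \<rightarrow> \<tau>) (x \<cdot> t)) (Var (\<sigma> \<rightarrow> \<tau>) 0 \<cdot> lift_tm (\<sigma> \<rightarrow> \<tau>) t)"]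
    Eq_refl[of "x \<cdot> t" \<tau>] by (simp add: inst_def has_ty_App)

lemma Eq_App2:
  "\<Gamma> \<tturnstile> Eq \<sigma> x y \<Longrightarrow> x \<Colon> \<sigma> \<Longrightarrow> y \<Colon> \<sigma> \<Longrightarrow> t \<Colon> \<sigma> \<rightarrow> \<tau> \<Longrightarrow> \<Gamma> \<tturnstile> Eq \<tau> (t \<cdot> x) (t \<cdot> y)"
  using Eq_repl[of \<Gamma> \<sigma> x y "Eq \<tau> (lift_tm \<sigma> (t \<cdot> x)) (lift_tm \<sigma> t \<cdot> Var \<sigma> 0)"]
    Eq_refl[of "t \<cdot> x" \<tau>] by (simp add: inst_def has_ty_App)

lemma Eq_App:
  assumes "\<Gamma> \<tturnstile> Eq (\<sigma> \<rightarrow> \<tau>) x y" "\<Gamma> \<tturnstile> Eq \<sigma> t u"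
    "x \<Colon> \<sigma> \<rightarrow> \<tau>" "y \<Colon> \<sigma> \<rightarrow> \<tau>" "t \<Colon> \<sigma>" "u \<Colon> \<sigma>"
  shows "\<Gamma> \<tturnstile> Eq \<tau> (x \<cdot> t) (y \<cdot> u)"
  using Eq_trans[OF Eq_App1[OF assms(1)] Eq_App2[OF assms(2)]] assms by (simp add: has_ty_App)

lemma Eq_Apps:
  assumes "\<Gamma> \<tturnstile> Eq (\<sigma>s \<rightarrow>* \<tau>) x y" "x \<Colon> \<sigma>s \<rightarrow>* \<tau>" "y \<Colon> \<sigma>s \<rightarrow>* \<tau>"
    "ts \<Colon>* \<sigma>s" "us \<Colon>* \<sigma>s" "\<And>i. i < length \<sigma>s \<Longrightarrow> \<Gamma> \<tturnstile> Eq (\<sigma>s ! i) (ts ! i) (us ! i)"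
  shows "\<Gamma> \<tturnstile> Eq \<tau> (x \<cdot>* ts) (y \<cdot>* us)"
  using assms
proof (induction \<sigma>s arbitrary: x y ts us)
  case (Cons \<sigma> \<sigma>s)
  obtain t ts' u us' where *: "ts = t # ts'" "us = u # us'"
    using Cons.prems by (auto simp: list_all2_Cons2)
  have "\<Gamma> \<tturnstile> Eq (\<sigma>s \<rightarrow>* \<tau>) (x \<cdot> t) (y \<cdot> u)"
    using Cons.prems(1-5) Cons.prems(6)[of 0] * by (intro Eq_App[of _ \<sigma>]) auto
  moreover have "\<Gamma> \<tturnstile> Eq (\<sigma>s ! i) (ts' ! i) (us' ! i)" if "i < length \<sigma>s" for i
    using Cons.prems(6)[of "Suc i"] that * by simp
  ultimately show ?case using Cons.prems * Cons.IH[of "x \<cdot> t" "y \<cdot> u" ts' us']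
    by (auto intro: has_ty_App)
qed auto

lemma Mem_Eq2:
  "\<Gamma> \<tturnstile> Eq (Star \<sigma>) x y \<Longrightarrow> \<Gamma> \<tturnstile> Mem \<sigma> t x \<Longrightarrow> x \<Colon> Star \<sigma> \<Longrightarrow> y \<Colon> Star \<sigma> \<Longrightarrow> t \<Colon> \<sigma> \<Longrightarrow> \<Gamma> \<tturnstile> Mem \<sigma> t y"
  using Eq_repl[of \<Gamma> "Star \<sigma>" x y "Mem \<sigma> (lift_tm (Star \<sigma>) t) (Var (Star \<sigma>) 0)"] by (simp add: inst_def)

lemma Mem_Sing: "t \<Colon> \<sigma> \<Longrightarrow> \<Gamma> \<tturnstile> Mem \<sigma> t (Sing \<sigma> \<cdot> t)"
  by (rule ImpE[OF AndE2[OF IL_deriv[OF IL.mem_sing]] Eq_refl])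

lemma BAllI:
  assumes "Mem \<sigma> (Var \<sigma> 0) (lift_tm \<sigma> t) # map (lift \<sigma>) \<Gamma> \<tturnstile> A" "t \<Colon> Star \<sigma>" "wff A"
  shows "\<Gamma> \<tturnstile> BAll \<sigma> t A"
  using assms by (intro ImpE[OF AndE2[OF IL_deriv[OF IL.ball]]] AllI ImpI) auto

lemma BAllE:
  assumes "\<Gamma> \<tturnstile> BAll \<sigma> t A" "\<Gamma> \<tturnstile> Mem \<sigma> u t" "t \<Colon> Star \<sigma>" "wff A" "u \<Colon> \<sigma>"
  shows "\<Gamma> \<tturnstile> inst \<sigma> u A"
proof -
  have "\<Gamma> \<tturnstile> inst \<sigma> u (Mem \<sigma> (Var \<sigma> 0) (lift_tm \<sigma> t) \<^bold>\<longrightarrow> A)"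
    using assms by (intro AllE ImpE[OF AndE1[OF IL_deriv[OF IL.ball]]])
  then have "\<Gamma> \<tturnstile> Mem \<sigma> u t \<^bold>\<longrightarrow> inst \<sigma> u A" by (simp add: inst_def)
  then show ?thesis using assms(2) by (rule ImpE)
qed

lemma BExI:
  assumes "\<Gamma> \<tturnstile> Mem \<sigma> u t" "\<Gamma> \<tturnstile> inst \<sigma> u A" "t \<Colon> Star \<sigma>" "wff A" "u \<Colon> \<sigma>"
  shows "\<Gamma> \<tturnstile> BEx \<sigma> t A"
proof -
  have "\<Gamma> \<tturnstile> inst \<sigma> u (Mem \<sigma> (Var \<sigma> 0) (lift_tm \<sigma> t) \<^bold>\<and> A)"
    using AndI[OF assms(1,2)] by (simp add: inst_def)
  then show ?thesis
    using assms by (intro ImpE[OF AndE2[OF IL_deriv[OF IL.bex]]] ExI[of _ _ _ u]) auto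
qed

lemma BExE:
  assumes "\<Gamma> \<tturnstile> BEx \<sigma> t A" "A # Mem \<sigma> (Var \<sigma> 0) (lift_tm \<sigma> t) # map (lift \<sigma>) \<Gamma> \<tturnstile> lift \<sigma> C"
    "t \<Colon> Star \<sigma>" "wff A"
  shows "\<Gamma> \<tturnstile> C"
proof -
  let ?M = "Mem \<sigma> (Var \<sigma> 0) (lift_tm \<sigma> t)" and ?\<Gamma> = "map (lift \<sigma>) \<Gamma>"
  have "\<Gamma> \<tturnstile> Ex \<sigma> (?M \<^bold>\<and> A)"
    using assms by (intro ImpE[OF AndE1[OF IL_deriv[OF IL.bex]]])
  moreover have "(?M \<^bold>\<and> A) # ?\<Gamma> \<tturnstile> lift \<sigma> C"
  proof (rule deriv_cut[OF assms(2)])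
    have "(?M \<^bold>\<and> A) # ?\<Gamma> \<tturnstile> ?M \<^bold>\<and> A" by (simp add: Assm)
    then show "(?M \<^bold>\<and> A) # ?\<Gamma> \<tturnstile> G" if "G \<in> set (A # ?M # ?\<Gamma>)" for G
      using that by (auto intro: Assm AndE1 AndE2)
  qed
  ultimately show ?thesis by (rule ExE)
qed

lemma hr_ImpE:
  assumes "\<Gamma> \<tturnstile> hr (A \<^bold>\<longrightarrow> B) ts" "\<Gamma> \<tturnstile> hr A us" "us \<Colon>* hr_tys A" "length ts = length (hr_tys B)"
  shows "\<Gamma> \<tturnstile> hr B (map (\<lambda>t. t \<cdot>* us) ts)"
proof -
  let ?\<sigma>s = "hr_tys A"
  let ?s = "sconses ?\<sigma>s us Var"
  have l: "length us = length ?\<sigma>s" using assms(3) by (rule list_all2_lengthD)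
  have "\<Gamma> \<tturnstile> subst ?s (hr (lifts ?\<sigma>s A) (bvars ?\<sigma>s) \<^bold>\<longrightarrow>
      hr (lifts ?\<sigma>s B) (map (\<lambda>t. lifts_tm ?\<sigma>s t \<cdot>* bvars ?\<sigma>s) ts))"
    using assms(1,3) by (intro AllsE) (auto simp: Let_def)
  then have "\<Gamma> \<tturnstile> hr A us \<^bold>\<longrightarrow> hr B (map (\<lambda>t. t \<cdot>* us) ts)"
    using assms(4) l by (simp add: subst_hr sconses_lifts sconses_lifts_tm sconses_bvars comp_def)
  then show ?thesis using assms(2) by (rule ImpE)
qed

lemma hr_AllE:
  assumes "\<Gamma> \<tturnstile> hr (All \<sigma> A) ts" "u \<Colon> \<sigma>" "length ts = length (hr_tys A)"
  shows "\<Gamma> \<tturnstile> hr (inst \<sigma> u A) (map (\<lambda>t. t \<cdot> u) ts)"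
  using AllE[of Ax \<Gamma> \<sigma> "hr A (map (\<lambda>t. lift_tm \<sigma> t \<cdot> Var \<sigma> 0) ts)" u] assms
  by (simp add: inst_hr comp_def)

end
section \<open>Monotonicity of realizers\<close>

text \<open>Pointwise inclusion, to be used at the types of realizers, which all end in a star type.
  At the ground type the choice does not matter; with equality the relation is reflexive there too.\<close>

fun le :: "ty \<Rightarrow> tm \<Rightarrow> tm \<Rightarrow> fm" where
  "le N t u = Eq N t u"
| "le (\<sigma> \<rightarrow> \<tau>) t u = All \<sigma> (le \<tau> (lift_tm \<sigma> t \<cdot> Var \<sigma> 0) (lift_tm \<sigma> u \<cdot> Var \<sigma> 0))"
| "le (Star \<sigma>) t u = All \<sigma> (Mem \<sigma> (Var \<sigma> 0) (lift_tm \<sigma> t) \<^bold>\<longrightarrow> Mem \<sigma> (Var \<sigma> 0) (lift_tm \<sigma> u))"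

lemma lift_simps [simp]:
  "lift \<sigma> Bot = Bot"
  "lift \<sigma> (Eq \<tau> t u) = Eq \<tau> (lift_tm \<sigma> t) (lift_tm \<sigma> u)"
  "lift \<sigma> (Mem \<tau> t u) = Mem \<tau> (lift_tm \<sigma> t) (lift_tm \<sigma> u)"
  "lift \<sigma> (A \<^bold>\<or> B) = lift \<sigma> A \<^bold>\<or> lift \<sigma> B"
  "lift \<sigma> (A \<^bold>\<and> B) = lift \<sigma> A \<^bold>\<and> lift \<sigma> B"
  "lift \<sigma> (A \<^bold>\<longrightarrow> B) = lift \<sigma> A \<^bold>\<longrightarrow> lift \<sigma> B"
  by (simp_all add: lift_def lift_tm_def)

lemma subst_le [simp]: "subst s (le \<tau> t u) = le \<tau> (subst_tm s t) (subst_tm s u)"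
  by (induction \<tau> arbitrary: s t u) (auto simp: lift_tm_subst_tm)

declare le.simps(2,3) [simp del]

lemma lift_le [simp]: "lift \<sigma> (le \<tau> t u) = le \<tau> (lift_tm \<sigma> t) (lift_tm \<sigma> u)"
  by (simp add: lift_def lift_tm_def)

lemma lifts_le: "lifts \<sigma>s (le \<tau> t u) = le \<tau> (lifts_tm \<sigma>s t) (lifts_tm \<sigma>s u)"
  by (induction \<sigma>s arbitrary: t u) auto

lemma nth_has_ty: "ts \<Colon>* \<sigma>s \<Longrightarrow> i < length \<sigma>s \<Longrightarrow> ts ! i \<Colon> \<sigma>s ! i"
  by (rule list_all2_nthD2)

context il_theory
begin

lemma weaken: "\<Gamma> \<tturnstile> A \<Longrightarrow> set \<Gamma> \<subseteq> set \<Delta> \<Longrightarrow> \<Delta> \<tturnstile> A"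
  by (rule deriv_mono)

lemma provable_weaken: "[] \<tturnstile> A \<Longrightarrow> \<Delta> \<tturnstile> A"
  by (erule deriv_mono) simp

lemma le_App:
  assumes "\<Gamma> \<tturnstile> le (\<sigma> \<rightarrow> \<tau>) t u" "r \<Colon> \<sigma>"
  shows "\<Gamma> \<tturnstile> le \<tau> (t \<cdot> r) (u \<cdot> r)"
  using AllE[OF assms(1)[unfolded le.simps] assms(2)] by (simp add: inst_def)

lemma le_Apps:
  assumes "\<Gamma> \<tturnstile> le (\<sigma>s \<rightarrow>* \<tau>) t u" "rs \<Colon>* \<sigma>s"
  shows "\<Gamma> \<tturnstile> le \<tau> (t \<cdot>* rs) (u \<cdot>* rs)"
  using assms
proof (induction \<sigma>s arbitrary: t u rs)
  case (Cons \<sigma> \<sigma>s)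
  then show ?case by (auto simp: list_all2_Cons2 dest!: le_App)
qed simp

lemma le_StarD:
  assumes "\<Gamma> \<tturnstile> le (Star \<sigma>) t u" "\<Gamma> \<tturnstile> Mem \<sigma> r t" "r \<Colon> \<sigma>"
  shows "\<Gamma> \<tturnstile> Mem \<sigma> r u"
  using AllE[OF assms(1)[unfolded le.simps] assms(3)] assms(2) by (auto simp: inst_def intro: ImpE)

lemma le_StarI:
  "Mem \<sigma> (Var \<sigma> 0) (lift_tm \<sigma> t) # map (lift \<sigma>) \<Gamma> \<tturnstile> Mem \<sigma> (Var \<sigma> 0) (lift_tm \<sigma> u) \<Longrightarrow>
    t \<Colon> Star \<sigma> \<Longrightarrow> \<Gamma> \<tturnstile> le (Star \<sigma>) t u"
  by (auto simp: le.simps intro!: AllI ImpI)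

lemma le_FunI:
  "map (lift \<sigma>) \<Gamma> \<tturnstile> le \<tau> (lift_tm \<sigma> t \<cdot> Var \<sigma> 0) (lift_tm \<sigma> u \<cdot> Var \<sigma> 0) \<Longrightarrow> \<Gamma> \<tturnstile> le (\<sigma> \<rightarrow> \<tau>) t u"
  by (auto simp: le.simps intro!: AllI)

text \<open>Congruence of application pushes the equation down to values of star or ground type.
  This converts the equations of combinators and recursors into the inclusions that
  \<open>hr_mono\<close> consumes; the way back would need extensionality.\<close>

lemma Eq_le: "\<Gamma> \<tturnstile> Eq \<tau> t u \<Longrightarrow> t \<Colon> \<tau> \<Longrightarrow> u \<Colon> \<tau> \<Longrightarrow> \<Gamma> \<tturnstile> le \<tau> t u"
proof (induction \<tau> arbitrary: \<Gamma> t u)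
  case (Fun \<sigma> \<tau>)
  have "map (lift \<sigma>) \<Gamma> \<tturnstile> Eq \<tau> (lift_tm \<sigma> t \<cdot> Var \<sigma> 0) (lift_tm \<sigma> u \<cdot> Var \<sigma> 0)"
    using deriv_lift[OF Fun.prems(1), of \<sigma>] Fun.prems(2,3) by (intro Eq_App1[of _ \<sigma>]) auto
  then show ?case using Fun.prems(2,3)
    by (intro le_FunI) (rule Fun.IH(2), auto intro: has_ty_App)
next
  case (Star \<sigma>)
  let ?\<Gamma> = "Mem \<sigma> (Var \<sigma> 0) (lift_tm \<sigma> t) # map (lift \<sigma>) \<Gamma>"
  have "?\<Gamma> \<tturnstile> Eq (Star \<sigma>) (lift_tm \<sigma> t) (lift_tm \<sigma> u)"
    using deriv_lift[OF Star.prems(1), of \<sigma>] by (auto intro: weaken)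
  then have "?\<Gamma> \<tturnstile> Mem \<sigma> (Var \<sigma> 0) (lift_tm \<sigma> u)"
    by (rule Mem_Eq2) (use Star.prems in \<open>auto intro: Assm\<close>)
  then show ?case using Star.prems(2) by (rule le_StarI)
qed simp

lemma le_trans:
  "\<Gamma> \<tturnstile> le \<tau> t u \<Longrightarrow> \<Gamma> \<tturnstile> le \<tau> u v \<Longrightarrow> t \<Colon> \<tau> \<Longrightarrow> u \<Colon> \<tau> \<Longrightarrow> v \<Colon> \<tau> \<Longrightarrow> \<Gamma> \<tturnstile> le \<tau> t v"
proof (induction \<tau> arbitrary: \<Gamma> t u v)
  case N
  then show ?case by (auto intro: Eq_trans)
next
  case (Fun \<sigma> \<tau>)
  have "map (lift \<sigma>) \<Gamma> \<tturnstile> le (\<sigma> \<rightarrow> \<tau>) (lift_tm \<sigma> t) (lift_tm \<sigma> u)"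
    "map (lift \<sigma>) \<Gamma> \<tturnstile> le (\<sigma> \<rightarrow> \<tau>) (lift_tm \<sigma> u) (lift_tm \<sigma> v)"
    using deriv_lift[OF Fun.prems(1), of \<sigma>] deriv_lift[OF Fun.prems(2), of \<sigma>] by simp_all
  from this[THEN le_App, of "Var \<sigma> 0"] show ?case using Fun.prems(3-)
    by (intro le_FunI) (rule Fun.IH(2), auto intro: has_ty_App)
next
  case (Star \<sigma>)
  let ?M = "Mem \<sigma> (Var \<sigma> 0) (lift_tm \<sigma> t)"
  have "?M # map (lift \<sigma>) \<Gamma> \<tturnstile> le (Star \<sigma>) (lift_tm \<sigma> t) (lift_tm \<sigma> u)"
    "?M # map (lift \<sigma>) \<Gamma> \<tturnstile> le (Star \<sigma>) (lift_tm \<sigma> u) (lift_tm \<sigma> v)"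
    using deriv_lift[OF Star.prems(1), of \<sigma>] deriv_lift[OF Star.prems(2), of \<sigma>]
    by (auto intro: weaken)
  from this[THEN le_StarD, of "Var \<sigma> 0"] show ?case using Star.prems(3)
    by (intro le_StarI) (simp_all add: Assm)
qed

text \<open>The tuple itself supplies only one kind of bound, that of the \<open>BEx\<close> arising
  from \<open>Ex\<close>, and there a larger set keeps the witness. No contravariant position
  arises: in an implication the realizers of the premise are universally quantified variables, and
  the compared functions, applied to them, occur in the conclusion only.\<close>

lemma hr_mono:
  assumes "\<Gamma> \<tturnstile> hr A ts" "wff A" "ts \<Colon>* hr_tys A" "us \<Colon>* hr_tys A"
    "\<And>i. i < length (hr_tys A) \<Longrightarrow> \<Gamma> \<tturnstile> le (hr_tys A ! i) (ts ! i) (us ! i)"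
  shows "\<Gamma> \<tturnstile> hr A us"
  using assms
proof (induction A ts arbitrary: us \<Gamma> rule: hr.induct)
  case (4 A B ts)
  let ?n = "length (hr_tys A)"
  have ty: "take ?n ts \<Colon>* hr_tys A" "drop ?n ts \<Colon>* hr_tys B" "take ?n us \<Colon>* hr_tys A" "drop ?n us \<Colon>* hr_tys B"
    and wf: "wff A" "wff B"
    using "4.prems" by (auto simp: list_all2_append_right)
  have l: "length ts = ?n + length (hr_tys B)" "length us = ?n + length (hr_tys B)"
    using "4.prems"(3,4) by (auto dest: list_all2_lengthD)
  have A: "\<Delta> \<tturnstile> le (hr_tys A ! i) (ts ! i) (us ! i)" if "i < ?n" "set \<Gamma> \<subseteq> set \<Delta>" for i \<Delta>
    using "4.prems"(5)[of i] that by (auto simp: nth_append intro: weaken)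
  have B: "\<Delta> \<tturnstile> le (hr_tys B ! i) (ts ! (?n + i)) (us ! (?n + i))"
    if "i < length (hr_tys B)" "set \<Gamma> \<subseteq> set \<Delta>" for i \<Delta>
    using "4.prems"(5)[of "?n + i"] that l by (auto simp: nth_append intro: weaken)
  show ?case unfolding hr.simps
  proof (rule OrE)
    show "\<Gamma> \<tturnstile> hr A (take ?n ts) \<^bold>\<or> hr B (drop ?n ts)" using "4.prems" by simp
    show "hr A (take ?n ts) # \<Gamma> \<tturnstile> hr A (take ?n us) \<^bold>\<or> hr B (drop ?n us)"
      by (rule OrI1, rule "4.IH"(1)) (use ty wf in \<open>auto intro: Assm A wff_hr simp: l\<close>)
    show "hr B (drop ?n ts) # \<Gamma> \<tturnstile> hr A (take ?n us) \<^bold>\<or> hr B (drop ?n us)"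
      by (rule OrI2, rule "4.IH"(2)) (use ty wf in \<open>auto intro: Assm B wff_hr simp: l\<close>)
  qed
next
  case (5 A B ts)
  let ?n = "length (hr_tys A)"
  have ty: "take ?n ts \<Colon>* hr_tys A" "drop ?n ts \<Colon>* hr_tys B" "take ?n us \<Colon>* hr_tys A" "drop ?n us \<Colon>* hr_tys B"
    and wf: "wff A" "wff B"
    using "5.prems" by (auto simp: list_all2_append_right)
  have l: "length ts = ?n + length (hr_tys B)" "length us = ?n + length (hr_tys B)"
    using "5.prems"(3,4) by (auto dest: list_all2_lengthD)
  have A: "\<Gamma> \<tturnstile> le (hr_tys A ! i) (take ?n ts ! i) (take ?n us ! i)" if "i < ?n" for i
    using "5.prems"(5)[of i] that by (auto simp: nth_append)
  have B: "\<Gamma> \<tturnstile> le (hr_tys B ! i) (drop ?n ts ! i) (drop ?n us ! i)" if "i < length (hr_tys B)" for i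
    using "5.prems"(5)[of "?n + i"] that l by (auto simp: nth_append)
  have *: "\<Gamma> \<tturnstile> hr A (take ?n ts) \<^bold>\<and> hr B (drop ?n ts)" using "5.prems" by simp
  show ?case unfolding hr.simps
  proof (rule AndI)
    show "\<Gamma> \<tturnstile> hr A (take ?n us)"
      by (rule "5.IH"(1)) (use ty wf AndE1[OF *] A in auto)
    show "\<Gamma> \<tturnstile> hr B (drop ?n us)"
      by (rule "5.IH"(2)) (use ty wf AndE2[OF *] B in auto)
  qed
next
  case (6 A B ts)
  let ?\<sigma>s = "hr_tys A"
  let ?xs = "bvars ?\<sigma>s"
  let ?\<Delta> = "hr (lifts ?\<sigma>s A) ?xs # map (lifts ?\<sigma>s) \<Gamma>"
  let ?f = "\<lambda>t. lifts_tm ?\<sigma>s t \<cdot>* ?xs"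
  have l: "length ts = length (hr_tys B)" "length us = length (hr_tys B)"
    using "6.prems"(3,4) by (auto dest: list_all2_lengthD)
  have wf: "wff A" "wff B" using "6.prems" by auto
  have ty: "map ?f ts \<Colon>* hr_tys B" "map ?f us \<Colon>* hr_tys B"
    using has_tys_Apps[of "map (lifts_tm ?\<sigma>s) ts" ?\<sigma>s "hr_tys B" ?xs]
      has_tys_Apps[of "map (lifts_tm ?\<sigma>s) us" ?\<sigma>s "hr_tys B" ?xs] "6.prems"(3,4)
    by (simp_all add: list_all2_map1 comp_def)
  have "map (lifts ?\<sigma>s) \<Gamma> \<tturnstile> hr (lifts ?\<sigma>s (A \<^bold>\<longrightarrow> B)) (map (lifts_tm ?\<sigma>s) ts)"
    using deriv_lifts[OF "6.prems"(1), of ?\<sigma>s] l by (simp add: lifts_hr del: hr.simps)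
  moreover have "lifts \<sigma>s (A \<^bold>\<longrightarrow> B) = lifts \<sigma>s A \<^bold>\<longrightarrow> lifts \<sigma>s B" for \<sigma>s
    by (induction \<sigma>s arbitrary: A B) auto
  ultimately have "?\<Delta> \<tturnstile> hr (lifts ?\<sigma>s A \<^bold>\<longrightarrow> lifts ?\<sigma>s B) (map (lifts_tm ?\<sigma>s) ts)"
    by (metis weaken set_subset_Cons)
  from hr_ImpE[OF this, of ?xs] have "?\<Delta> \<tturnstile> hr (lifts ?\<sigma>s B) (map ?f ts)"
    using l by (simp add: Assm comp_def)
  moreover have "?\<Delta> \<tturnstile> le (hr_tys B ! i) (?f (ts ! i)) (?f (us ! i))" if "i < length (hr_tys B)" for i
  proof -
    have "map (lifts ?\<sigma>s) \<Gamma> \<tturnstile> le (?\<sigma>s \<rightarrow>* hr_tys B ! i) (lifts_tm ?\<sigma>s (ts ! i)) (lifts_tm ?\<sigma>s (us ! i))"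
      using deriv_lifts[OF "6.prems"(5)[of i], of ?\<sigma>s] that by (simp add: lifts_le)
    from le_Apps[OF this has_tys_bvars] show ?thesis by (rule weaken) auto
  qed
  ultimately have "?\<Delta> \<tturnstile> hr (lifts ?\<sigma>s B) (map ?f us)"
    using wf ty l by (intro "6.IH"(2)[OF refl refl, of _ "map ?f us"]) auto
  then show ?case using wf by (auto simp: Let_def intro!: AllsI ImpI wff_hr)
next
  case (7 \<sigma> A ts)
  let ?f = "\<lambda>t. lift_tm \<sigma> t \<cdot> Var \<sigma> 0"
  have l: "length ts = length (hr_tys A)" "length us = length (hr_tys A)"
    using "7.prems"(3,4) by (auto dest: list_all2_lengthD)
  have ty: "map ?f ts \<Colon>* hr_tys A" "map ?f us \<Colon>* hr_tys A"
    using has_tys_App[of "map (lift_tm \<sigma>) ts" \<sigma> "hr_tys A" "Var \<sigma> 0"]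
      has_tys_App[of "map (lift_tm \<sigma>) us" \<sigma> "hr_tys A" "Var \<sigma> 0"] "7.prems"(3,4)
    by (simp_all add: comp_def)
  have "map (lift \<sigma>) \<Gamma> \<tturnstile> hr A (map ?f ts)"
    using deriv_lift[OF "7.prems"(1), of \<sigma>] deriv_lift_Var_E[of Ax \<sigma> \<Gamma>] by simp
  moreover have "map (lift \<sigma>) \<Gamma> \<tturnstile> le (hr_tys A ! i) (?f (ts ! i)) (?f (us ! i))" if "i < length (hr_tys A)" for i
    using le_App[of "map (lift \<sigma>) \<Gamma>" \<sigma> "hr_tys A ! i" "lift_tm \<sigma> (ts ! i)" "lift_tm \<sigma> (us ! i)" "Var \<sigma> 0"]
      deriv_lift[OF "7.prems"(5)[of i], of \<sigma>] that by simp
  ultimately have "map (lift \<sigma>) \<Gamma> \<tturnstile> hr A (map ?f us)"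
    using "7.prems" ty l by (intro "7.IH"[of _ "map ?f us"]) auto
  then show ?case by (auto intro: AllI)
next
  case (8 \<sigma> A ts)
  obtain t ts' u us' where *: "ts = t # ts'" "us = u # us'"
    and ty: "t \<Colon> Star \<sigma>" "u \<Colon> Star \<sigma>" "ts' \<Colon>* hr_tys A" "us' \<Colon>* hr_tys A"
    using "8.prems"(3,4) by (auto simp: list_all2_Cons2)
  have wf: "wff A" using "8.prems" by auto
  have l: "length ts' = length (hr_tys A)" "length us' = length (hr_tys A)"
    using ty by (auto dest: list_all2_lengthD)
  let ?H = "hr A (map (lift_tm \<sigma>) ts')" and ?M = "Mem \<sigma> (Var \<sigma> 0) (lift_tm \<sigma> t)"
  let ?\<Delta> = "?H # ?M # map (lift \<sigma>) \<Gamma>"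
  let ?K = "hr A (map (lift_tm \<sigma>) us')"
  have w: "wff ?H" "wff ?K" using wf ty by (auto intro!: wff_hr)
  have "?\<Delta> \<tturnstile> le (hr_tys A ! i) (lift_tm \<sigma> (ts' ! i)) (lift_tm \<sigma> (us' ! i))" if "i < length (hr_tys A)" for i
    using deriv_lift[OF "8.prems"(5)[of "Suc i"], of \<sigma>] that * by (auto intro: weaken)
  then have "?\<Delta> \<tturnstile> ?K"
    using "8.IH"[of ?\<Delta> "map (lift_tm \<sigma>) us'"] wf ty * l by (simp add: Assm)
  moreover have "?\<Delta> \<tturnstile> le (Star \<sigma>) (lift_tm \<sigma> t) (lift_tm \<sigma> u)"
    using deriv_lift[OF "8.prems"(5)[of 0], of \<sigma>] * by (auto intro: weaken)
  then have "?\<Delta> \<tturnstile> Mem \<sigma> (Var \<sigma> 0) (lift_tm \<sigma> u)"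
    by (rule le_StarD) (auto intro: Assm)
  ultimately have "?\<Delta> \<tturnstile> lift \<sigma> (BEx \<sigma> u ?K)"
    using ty wf w by (auto simp: lift_def[of \<sigma> "BEx _ _ _"] simp flip: lift_tm_def intro!: BExI[of _ _ "Var \<sigma> 0"])
  moreover have "\<Gamma> \<tturnstile> BEx \<sigma> t ?H" using "8.prems"(1) * by simp
  ultimately show ?case using ty w * by (auto intro: BExE)
next
  case (9 \<sigma> t A ts)
  let ?H = "hr A (map (lift_tm \<sigma>) ts)" and ?M = "Mem \<sigma> (Var \<sigma> 0) (lift_tm \<sigma> t)"
  let ?\<Delta> = "?M # map (lift \<sigma>) \<Gamma>"
  let ?K = "hr A (map (lift_tm \<sigma>) us)"
  have ty: "t \<Colon> Star \<sigma>" "ts \<Colon>* hr_tys A" "us \<Colon>* hr_tys A" and wf: "wff A" using "9.prems" by auto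
  then have w: "wff ?H" "wff ?K" by (auto intro!: wff_hr)
  have l: "length ts = length (hr_tys A)" "length us = length (hr_tys A)"
    using ty by (auto dest: list_all2_lengthD)
  have "map (lift \<sigma>) \<Gamma> \<tturnstile> BAll \<sigma> (lift_tm \<sigma> t) (subst (under \<sigma> (shift \<sigma>)) ?H)"
    using deriv_lift[OF "9.prems"(1), of \<sigma>] by (simp add: lift_def lift_tm_def)
  then have "?\<Delta> \<tturnstile> BAll \<sigma> (lift_tm \<sigma> t) (subst (under \<sigma> (shift \<sigma>)) ?H)"
    by (rule weaken) auto
  from BAllE[OF this, of "Var \<sigma> 0"] have "?\<Delta> \<tturnstile> ?H"
    using ty w by (simp add: Assm)
  moreover have "?\<Delta> \<tturnstile> le (hr_tys A ! i) (lift_tm \<sigma> (ts ! i)) (lift_tm \<sigma> (us ! i))" if "i < length (hr_tys A)" for i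
    using deriv_lift[OF "9.prems"(5)[of i], of \<sigma>] that by (auto intro: weaken)
  ultimately have "?\<Delta> \<tturnstile> ?K"
    using "9.IH"[of ?\<Delta> "map (lift_tm \<sigma>) us"] wf ty l by auto
  then show ?case using ty w by (auto intro: BAllI)
next
  case (10 \<sigma> t A ts)
  let ?H = "hr A (map (lift_tm \<sigma>) ts)" and ?M = "Mem \<sigma> (Var \<sigma> 0) (lift_tm \<sigma> t)"
  let ?\<Delta> = "?H # ?M # map (lift \<sigma>) \<Gamma>"
  let ?K = "hr A (map (lift_tm \<sigma>) us)"
  have ty: "t \<Colon> Star \<sigma>" "ts \<Colon>* hr_tys A" "us \<Colon>* hr_tys A" and wf: "wff A" using "10.prems" by auto
  then have w: "wff ?H" "wff ?K" by (auto intro!: wff_hr)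
  have l: "length ts = length (hr_tys A)" "length us = length (hr_tys A)"
    using ty by (auto dest: list_all2_lengthD)
  have "?\<Delta> \<tturnstile> le (hr_tys A ! i) (lift_tm \<sigma> (ts ! i)) (lift_tm \<sigma> (us ! i))" if "i < length (hr_tys A)" for i
    using deriv_lift[OF "10.prems"(5)[of i], of \<sigma>] that by (auto intro: weaken)
  then have "?\<Delta> \<tturnstile> ?K"
    using "10.IH"[of ?\<Delta> "map (lift_tm \<sigma>) us"] wf ty l by (simp add: Assm)
  then have "?\<Delta> \<tturnstile> lift \<sigma> (BEx \<sigma> t ?K)"
    using ty wf w by (auto simp: lift_def[of \<sigma> "BEx _ _ _"] simp flip: lift_tm_def intro!: BExI[of _ _ "Var \<sigma> 0"] intro: Assm)
  moreover have "\<Gamma> \<tturnstile> BEx \<sigma> t ?H" using "10.prems"(1) by simp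
  ultimately show ?case using ty w by (auto intro: BExE)
qed auto

section \<open>Combinatory completeness and upper bounds\<close>

lemma constant_abstraction:
  assumes "b \<Colon> \<tau>" "fv_tm b = {}"
  shows "\<exists>c. c \<Colon> \<sigma> \<rightarrow> \<tau> \<and> fv_tm c = fv_tm b - {(\<sigma>, n)} \<and> [] \<tturnstile> Eq \<tau> (c \<cdot> Var \<sigma> n) b"
  using assms by (intro exI[of _ "PiC \<tau> \<sigma> \<cdot> b"]) (auto intro!: IL_deriv IL.pi intro: has_ty_App has_ty_const)

text \<open>This is bracket abstraction with \<open>SigmaC\<close> and \<open>PiC\<close> for a
  variable treated as a name: the indices of the other variables stay as they are. It is enough to
  have the equation at the variable itself, as other arguments follow by
  \<open>provable_subst\<close>. The exact set of free variables is recorded for the closed terms of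
  the final theorem.\<close>

lemma bracket_abstraction:
  assumes "b \<Colon> \<tau>"
  shows "\<exists>c. c \<Colon> \<sigma> \<rightarrow> \<tau> \<and> fv_tm c = fv_tm b - {(\<sigma>, n)} \<and> [] \<tturnstile> Eq \<tau> (c \<cdot> Var \<sigma> n) b"
  using assms
proof (induction rule: has_ty.induct)
  case (1 \<rho> m)
  show ?case
  proof (cases "\<rho> = \<sigma> \<and> m = n")
    case True
    \<comment> \<open>The identity is the usual SKK, with the two copies of K at different
      types.\<close>
    let ?K = "PiC \<sigma> (\<sigma> \<rightarrow> \<sigma>)" and ?K' = "PiC \<sigma> \<sigma>" and ?x = "Var \<sigma> n"
    let ?c = "SigmaC \<sigma> (\<sigma> \<rightarrow> \<sigma>) \<sigma> \<cdot> ?K \<cdot> ?K'"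
    have c: "?c \<Colon> \<sigma> \<rightarrow> \<sigma>" by (meson has_ty.intros)
    have ty: "?c \<cdot> ?x \<Colon> \<sigma>" "?K' \<cdot> ?x \<Colon> \<sigma> \<rightarrow> \<sigma>" by (meson c has_ty.intros)+
    then have ty': "?K \<cdot> ?x \<cdot> (?K' \<cdot> ?x) \<Colon> \<sigma>" by (meson has_ty.intros)
    have "[] \<tturnstile> Eq \<sigma> (?c \<cdot> ?x) (?K \<cdot> ?x \<cdot> (?K' \<cdot> ?x))"
      by (intro IL_deriv IL.sigma) simp_all
    moreover have "[] \<tturnstile> Eq \<sigma> (?K \<cdot> ?x \<cdot> (?K' \<cdot> ?x)) ?x"
      using ty by (intro IL_deriv IL.pi) simp_all
    ultimately have "[] \<tturnstile> Eq \<sigma> (?c \<cdot> ?x) ?x"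
      by (rule Eq_trans) (use ty ty' in simp_all)
    with c True show ?thesis by (intro exI[of _ ?c]) auto
  next
    case False
    then show ?thesis
      by (intro exI[of _ "PiC \<rho> \<sigma> \<cdot> Var \<rho> m"]) (auto intro!: IL_deriv IL.pi intro: has_ty_App has_ty_const)
  qed
next
  case (10 s \<rho> \<tau> t)
  then obtain c d where c: "c \<Colon> \<sigma> \<rightarrow> \<rho> \<rightarrow> \<tau>" "fv_tm c = fv_tm s - {(\<sigma>, n)}" "[] \<tturnstile> Eq (\<rho> \<rightarrow> \<tau>) (c \<cdot> Var \<sigma> n) s"
    and d: "d \<Colon> \<sigma> \<rightarrow> \<rho>" "fv_tm d = fv_tm t - {(\<sigma>, n)}" "[] \<tturnstile> Eq \<rho> (d \<cdot> Var \<sigma> n) t"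
    by blast
  let ?x = "Var \<sigma> n" and ?c = "SigmaC \<sigma> \<rho> \<tau> \<cdot> c \<cdot> d"
  have ty: "?c \<Colon> \<sigma> \<rightarrow> \<tau>" "c \<cdot> ?x \<Colon> \<rho> \<rightarrow> \<tau>" "d \<cdot> ?x \<Colon> \<rho>" using c(1) d(1) by (meson has_ty.intros)+
  have "[] \<tturnstile> Eq \<tau> (?c \<cdot> ?x) (c \<cdot> ?x \<cdot> (d \<cdot> ?x))"
    using c(1) d(1) by (intro IL_deriv IL.sigma) auto
  moreover have "[] \<tturnstile> Eq \<tau> (c \<cdot> ?x \<cdot> (d \<cdot> ?x)) (s \<cdot> t)"
    using c(3) d(3) ty 10 by (intro Eq_App[of _ \<rho>]) auto
  ultimately have "[] \<tturnstile> Eq \<tau> (?c \<cdot> ?x) (s \<cdot> t)"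
    by (rule Eq_trans) (use ty 10 in \<open>auto intro: has_ty_App\<close>)
  then show ?case using ty c d by (intro exI[of _ ?c]) auto
qed (rule constant_abstraction; simp)+

text \<open>The version of bracket abstraction that respects binding: the variable of index 0 is
  abstracted and the other indices of its type drop by one. The equation is stated under every
  well-typed \<open>s\<close>, so that the same term can be used after lifting.\<close>

lemma lam_ex:
  assumes "b \<Colon> \<tau>"
  obtains c where "c \<Colon> \<sigma> \<rightarrow> \<tau>"
    "\<And>s u \<Gamma>. wts s \<Longrightarrow> u \<Colon> \<sigma> \<Longrightarrow> \<Gamma> \<tturnstile> Eq \<tau> (subst_tm s c \<cdot> u) (subst_tm (scons \<sigma> u s) b)"
proof -
  obtain c where c: "c \<Colon> \<sigma> \<rightarrow> \<tau>" "(\<sigma>, 0) \<notin> fv_tm c" "[] \<tturnstile> Eq \<tau> (c \<cdot> Var \<sigma> 0) b"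
    using bracket_abstraction[OF assms, of \<sigma> 0] by blast
  \<comment> \<open>This substitution lowers the indices of type \<open>\<sigma>\<close>. Its value
    at index 0 is a dummy, since that variable does not occur in \<open>c\<close>.\<close>
  let ?d = "subst_tm (scons \<sigma> (Var \<sigma> 0) Var) c"
  show ?thesis
  proof (rule that[of ?d])
    fix s u \<Gamma> assume *: "wts s" "u \<Colon> \<sigma>"
    have "subst_tm (scons \<sigma> u s) c = subst_tm s ?d"
      unfolding subst_tm_subst_tm
      by (rule subst_tm_cong) (use c(2) in \<open>auto simp: comp_sub_def scons_def split: nat.split\<close>)
    then show "\<Gamma> \<tturnstile> Eq \<tau> (subst_tm s ?d \<cdot> u) (subst_tm (scons \<sigma> u s) b)"
      using provable_weaken[OF provable_subst[OF c(3), of "scons \<sigma> u s"]] * by simp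
  qed (use c(1) in auto)
qed

text \<open>The inner abstraction \<open>c\<close> is a term again and gets abstracted in turn. Its
  equation is used only after the outer one has been applied to its argument, so no equality under
  an abstraction is needed.\<close>

lemma lams_ex:
  assumes "b \<Colon> \<tau>"
  shows "\<exists>c. c \<Colon> \<sigma>s \<rightarrow>* \<tau> \<and> (\<forall>s us \<Gamma>. wts s \<longrightarrow> us \<Colon>* \<sigma>s \<longrightarrow>
    \<Gamma> \<tturnstile> Eq \<tau> (subst_tm s c \<cdot>* us) (subst_tm (sconses \<sigma>s us s) b))"
proof (induction \<sigma>s)
  case Nil
  show ?case using assms Eq_refl by (intro exI[of _ b]) auto
next
  case (Cons \<sigma> \<sigma>s)
  then obtain c where c: "c \<Colon> \<sigma>s \<rightarrow>* \<tau>" "\<And>s us \<Gamma>. wts s \<Longrightarrow> us \<Colon>* \<sigma>s \<Longrightarrow>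
    \<Gamma> \<tturnstile> Eq \<tau> (subst_tm s c \<cdot>* us) (subst_tm (sconses \<sigma>s us s) b)" by blast
  obtain d where d: "d \<Colon> \<sigma> \<rightarrow> \<sigma>s \<rightarrow>* \<tau>" "\<And>s u \<Gamma>. wts s \<Longrightarrow> u \<Colon> \<sigma> \<Longrightarrow>
    \<Gamma> \<tturnstile> Eq (\<sigma>s \<rightarrow>* \<tau>) (subst_tm s d \<cdot> u) (subst_tm (scons \<sigma> u s) c)"
    using lam_ex[OF c(1)] by blast
  have "\<Gamma> \<tturnstile> Eq \<tau> (subst_tm s d \<cdot>* us) (subst_tm (sconses (\<sigma> # \<sigma>s) us s) b)"
    if *: "wts s" "us \<Colon>* \<sigma> # \<sigma>s" for s us \<Gamma>
  proof -
    obtain v vs where v: "us = v # vs" "v \<Colon> \<sigma>" "vs \<Colon>* \<sigma>s" using * by (auto simp: list_all2_Cons2)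
    have ty: "subst_tm s d \<cdot> v \<Colon> \<sigma>s \<rightarrow>* \<tau>" "subst_tm (scons \<sigma> v s) c \<Colon> \<sigma>s \<rightarrow>* \<tau>"
      using * v c(1) d(1) by (auto intro: has_ty_App)
    have "\<Gamma> \<tturnstile> Eq \<tau> (subst_tm s d \<cdot> v \<cdot>* vs) (subst_tm (scons \<sigma> v s) c \<cdot>* vs)"
      using v * nth_has_ty[OF v(3)] by (intro Eq_Apps[OF d(2)] ty) (auto intro: Eq_refl)
    moreover have "\<Gamma> \<tturnstile> Eq \<tau> (subst_tm (scons \<sigma> v s) c \<cdot>* vs) (subst_tm (sconses \<sigma>s vs (scons \<sigma> v s)) b)"
      using v * by (intro c(2)) auto
    ultimately have "\<Gamma> \<tturnstile> Eq \<tau> (subst_tm s d \<cdot> v \<cdot>* vs) (subst_tm (sconses \<sigma>s vs (scons \<sigma> v s)) b)"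
      by (rule Eq_trans) (use ty v * assms wts_sconses in \<open>auto intro: has_ty_Apps\<close>)
    then show ?thesis using v by simp
  qed
  with d(1) show ?case by (intro exI[of _ d]) auto
qed

end

section \<open>Upper bounds of realizers\<close>

fun end_star :: "ty \<Rightarrow> bool" where
  "end_star N \<longleftrightarrow> False"
| "end_star (\<sigma> \<rightarrow> \<tau>) \<longleftrightarrow> end_star \<tau>"
| "end_star (Star \<sigma>) \<longleftrightarrow> True"

lemma end_star_Funs [simp]: "end_star (\<sigma>s \<rightarrow>* \<tau>) \<longleftrightarrow> end_star \<tau>"
  by (induction \<sigma>s) auto

text \<open>Components enter a tuple only in the clause for \<open>Ex\<close>, with a star type, and
  the other clauses merely put argument types in front. The final type \<open>N\<close> has to be
  avoided because \<open>le\<close> is equality there, so that two terms need not have a common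
  bound.\<close>

lemma end_star_hr_tys: "\<tau> \<in> set (hr_tys A) \<Longrightarrow> end_star \<tau>"
  by (induction A arbitrary: \<tau>) auto

lemma ex_closed_tm: "\<exists>t. t \<Colon> \<sigma> \<and> fv_tm t = {}"
proof (induction \<sigma>)
  case N
  show ?case by (intro exI[of _ Zero]) auto
next
  case (Fun \<sigma> \<tau>)
  then obtain t where "t \<Colon> \<tau>" "fv_tm t = {}" by blast
  then show ?case by (intro exI[of _ "PiC \<tau> \<sigma> \<cdot> t"]) (auto intro: has_ty_App has_ty_const)
next
  case (Star \<sigma>)
  then obtain t where "t \<Colon> \<sigma>" "fv_tm t = {}" by blast
  then show ?case by (intro exI[of _ "Sing \<sigma> \<cdot> t"]) (auto intro: has_ty_App has_ty_const)
qed

lemma ex_has_tys: "\<exists>ts. ts \<Colon>* \<tau>s"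
proof (induction \<tau>s)
  case (Cons \<tau> \<tau>s)
  with ex_closed_tm[of \<tau>] show ?case by (auto simp: list_all2_Cons2)
qed simp

context il_theory
begin

lemma Eq_sym_le: "\<Gamma> \<tturnstile> Eq \<tau> u t \<Longrightarrow> u \<Colon> \<tau> \<Longrightarrow> t \<Colon> \<tau> \<Longrightarrow> \<Gamma> \<tturnstile> le \<tau> t u"
  using Eq_le Eq_sym by blast

text \<open>Abstracting a pointwise bound gives a bound at function type. This is the common core of
  the function cases in the two constructions of bounds that follow.\<close>

lemma ex_upper_bound_Fun:
  assumes "c' \<Colon> \<tau>"
  obtains c where "c \<Colon> \<sigma> \<rightarrow> \<tau>"
    "\<And>s t \<Gamma>. wts s \<Longrightarrow> t \<Colon> \<sigma> \<rightarrow> \<tau> \<Longrightarrow>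
      map (lift \<sigma>) \<Gamma> \<tturnstile> le \<tau> (lift_tm \<sigma> t \<cdot> Var \<sigma> 0) (subst_tm (under \<sigma> s) c') \<Longrightarrow>
      \<Gamma> \<tturnstile> le (\<sigma> \<rightarrow> \<tau>) t (subst_tm s c)"
proof -
  obtain c where c: "c \<Colon> \<sigma> \<rightarrow> \<tau>" "\<And>s u \<Gamma>. wts s \<Longrightarrow> u \<Colon> \<sigma> \<Longrightarrow>
    \<Gamma> \<tturnstile> Eq \<tau> (subst_tm s c \<cdot> u) (subst_tm (scons \<sigma> u s) c')"
    using lam_ex[OF assms] by blast
  show ?thesis
  proof (rule that[OF c(1)])
    fix s t \<Gamma>
    assume *: "wts s" "t \<Colon> \<sigma> \<rightarrow> \<tau>"
      and le: "map (lift \<sigma>) \<Gamma> \<tturnstile> le \<tau> (lift_tm \<sigma> t \<cdot> Var \<sigma> 0) (subst_tm (under \<sigma> s) c')"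
    have ty: "lift_tm \<sigma> t \<cdot> Var \<sigma> 0 \<Colon> \<tau>" "lift_tm \<sigma> (subst_tm s c) \<cdot> Var \<sigma> 0 \<Colon> \<tau>" "subst_tm (under \<sigma> s) c' \<Colon> \<tau>"
      using * c(1) assms by (auto intro: has_ty_App)
    have "map (lift \<sigma>) \<Gamma> \<tturnstile> Eq \<tau> (lift_tm \<sigma> (subst_tm s c) \<cdot> Var \<sigma> 0) (subst_tm (under \<sigma> s) c')"
      using c(2)[of "shift \<sigma> \<odot> s" "Var \<sigma> 0" "map (lift \<sigma>) \<Gamma>"] * by (simp add: lift_tm_subst_tm under_alt)
    then have "map (lift \<sigma>) \<Gamma> \<tturnstile> le \<tau> (subst_tm (under \<sigma> s) c') (lift_tm \<sigma> (subst_tm s c) \<cdot> Var \<sigma> 0)"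
      using ty by (intro Eq_sym_le)
    from le_trans[OF le this] show "\<Gamma> \<tturnstile> le (\<sigma> \<rightarrow> \<tau>) t (subst_tm s c)"
      using ty by (intro le_FunI) simp
  qed
qed

lemma ex_upper_bound:
  "end_star \<tau> \<Longrightarrow> t \<Colon> \<tau> \<Longrightarrow> u \<Colon> \<tau> \<Longrightarrow> \<exists>c. c \<Colon> \<tau> \<and> [] \<tturnstile> le \<tau> t c \<and> [] \<tturnstile> le \<tau> u c"
proof (induction \<tau> arbitrary: t u)
  case (Fun \<sigma> \<tau>)
  have ty: "lift_tm \<sigma> t \<cdot> Var \<sigma> 0 \<Colon> \<tau>" "lift_tm \<sigma> u \<cdot> Var \<sigma> 0 \<Colon> \<tau>"
    using Fun.prems by (auto intro: has_ty_App)
  then obtain c' where c': "c' \<Colon> \<tau>" "[] \<tturnstile> le \<tau> (lift_tm \<sigma> t \<cdot> Var \<sigma> 0) c'" "[] \<tturnstile> le \<tau> (lift_tm \<sigma> u \<cdot> Var \<sigma> 0) c'"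
    using Fun.IH(2)[OF _ ty] Fun.prems by auto
  obtain c where "c \<Colon> \<sigma> \<rightarrow> \<tau>" "\<And>s t \<Gamma>. wts s \<Longrightarrow> t \<Colon> \<sigma> \<rightarrow> \<tau> \<Longrightarrow>
      map (lift \<sigma>) \<Gamma> \<tturnstile> le \<tau> (lift_tm \<sigma> t \<cdot> Var \<sigma> 0) (subst_tm (under \<sigma> s) c') \<Longrightarrow>
      \<Gamma> \<tturnstile> le (\<sigma> \<rightarrow> \<tau>) t (subst_tm s c)"
    using ex_upper_bound_Fun[OF c'(1)] by blast
  from this(1) this(2)[of Var _ "[]"] c' Fun.prems show ?case by (intro exI[of _ c]) auto
next
  case (Star \<sigma>)
  let ?c = "Cup \<sigma> \<cdot> t \<cdot> u"
  have c: "?c \<Colon> Star \<sigma>" using Star.prems by (meson has_ty.intros)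
  have mem: "\<Gamma> \<tturnstile> Mem \<sigma> (Var \<sigma> 0) (lift_tm \<sigma> ?c)"
    if "\<Gamma> \<tturnstile> Mem \<sigma> (Var \<sigma> 0) (lift_tm \<sigma> t) \<^bold>\<or> Mem \<sigma> (Var \<sigma> 0) (lift_tm \<sigma> u)" for \<Gamma>
    using ImpE[OF AndE2[OF IL_deriv[OF IL.mem_cup]] that] Star.prems by (simp add: lift_tm_def)
  show ?case
  proof (intro exI[of _ ?c] conjI c le_StarI mem)
    show "Mem \<sigma> (Var \<sigma> 0) (lift_tm \<sigma> t) # map (lift \<sigma>) [] \<tturnstile> Mem \<sigma> (Var \<sigma> 0) (lift_tm \<sigma> t) \<^bold>\<or> Mem \<sigma> (Var \<sigma> 0) (lift_tm \<sigma> u)"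
      using Star.prems by (intro OrI1 Assm) auto
    show "Mem \<sigma> (Var \<sigma> 0) (lift_tm \<sigma> u) # map (lift \<sigma>) [] \<tturnstile> Mem \<sigma> (Var \<sigma> 0) (lift_tm \<sigma> t) \<^bold>\<or> Mem \<sigma> (Var \<sigma> 0) (lift_tm \<sigma> u)"
      using Star.prems by (intro OrI2 Assm) auto
  qed (use Star.prems in auto)
qed auto

text \<open>At a star type the bound is \<open>BigCup\<close> of the family. At a function type it
  is formed pointwise: for a fixed argument \<open>x\<close>, the family of the terms
  \<open>f u x\<close> is bounded over \<open>u\<close> in \<open>Z\<close>, and the bound is then
  abstracted over \<open>x\<close>. The terms are built once for all \<open>s\<close>, so that the
  bound cannot depend on the member \<open>u\<close>.\<close>

lemma ex_family_upper_bound: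
  "end_star \<tau> \<Longrightarrow> Z \<Colon> Star \<sigma> \<Longrightarrow> f \<Colon> \<sigma> \<rightarrow> \<tau> \<Longrightarrow> \<exists>c. c \<Colon> \<tau> \<and>
    (\<forall>s u \<Gamma>. wts s \<longrightarrow> u \<Colon> \<sigma> \<longrightarrow> \<Gamma> \<tturnstile> Mem \<sigma> u (subst_tm s Z) \<longrightarrow> \<Gamma> \<tturnstile> le \<tau> (subst_tm s f \<cdot> u) (subst_tm s c))"
proof (induction \<tau> arbitrary: Z f)
  case (Fun \<rho> \<tau>)
  \<comment> \<open>\<open>?b\<close> is \<open>f u x\<close> with \<open>x\<close> the outer
    variable of type \<open>\<rho>\<close> and \<open>u\<close> the inner one of type
    \<open>\<sigma>\<close>. Abstracting \<open>u\<close> alone leaves a family \<open>f'\<close>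
    with values in \<open>\<tau>\<close> and \<open>x\<close> free, to which the induction
    hypothesis applies.\<close>
  have "lift_tm \<sigma> (lift_tm \<rho> f) \<cdot> Var \<sigma> 0 \<cdot> lift_tm \<sigma> (Var \<rho> 0) \<Colon> \<tau>" (is "?b \<Colon> _")
    using Fun.prems by (auto intro!: has_ty_App)
  then obtain f' where f': "f' \<Colon> \<sigma> \<rightarrow> \<tau>" "\<And>s u \<Gamma>. wts s \<Longrightarrow> u \<Colon> \<sigma> \<Longrightarrow>
      \<Gamma> \<tturnstile> Eq \<tau> (subst_tm s f' \<cdot> u) (subst_tm (scons \<sigma> u s) ?b)"
    using lam_ex by blast
  obtain c' where c': "c' \<Colon> \<tau>" "\<And>s u \<Gamma>. wts s \<Longrightarrow> u \<Colon> \<sigma> \<Longrightarrow> \<Gamma> \<tturnstile> Mem \<sigma> u (subst_tm s (lift_tm \<rho> Z)) \<Longrightarrow>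
      \<Gamma> \<tturnstile> le \<tau> (subst_tm s f' \<cdot> u) (subst_tm s c')"
    using Fun.IH(2)[of "lift_tm \<rho> Z" f'] f'(1) Fun.prems by auto
  obtain c where c: "c \<Colon> \<rho> \<rightarrow> \<tau>" "\<And>s t \<Gamma>. wts s \<Longrightarrow> t \<Colon> \<rho> \<rightarrow> \<tau> \<Longrightarrow>
      map (lift \<rho>) \<Gamma> \<tturnstile> le \<tau> (lift_tm \<rho> t \<cdot> Var \<rho> 0) (subst_tm (under \<rho> s) c') \<Longrightarrow>
      \<Gamma> \<tturnstile> le (\<rho> \<rightarrow> \<tau>) t (subst_tm s c)"
    using ex_upper_bound_Fun[OF c'(1)] by blast
  have "\<Gamma> \<tturnstile> le (\<rho> \<rightarrow> \<tau>) (subst_tm s f \<cdot> u) (subst_tm s c)"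
    if *: "wts s" "u \<Colon> \<sigma>" "\<Gamma> \<tturnstile> Mem \<sigma> u (subst_tm s Z)" for s u \<Gamma>
  proof (rule c(2))
    let ?\<Gamma> = "map (lift \<rho>) \<Gamma>" and ?s = "under \<rho> s" and ?u = "lift_tm \<rho> u"
    let ?t = "lift_tm \<rho> (subst_tm s f \<cdot> u) \<cdot> Var \<rho> 0"
    have ty: "?t \<Colon> \<tau>" "subst_tm ?s f' \<cdot> ?u \<Colon> \<tau>" "subst_tm ?s c' \<Colon> \<tau>"
      using * f'(1) c'(1) Fun.prems by (auto intro!: has_ty_App)
    have "?\<Gamma> \<tturnstile> Eq \<tau> (subst_tm ?s f' \<cdot> ?u) ?t"
      using f'(2)[of ?s ?u ?\<Gamma>] * by (simp add: lift_tm_subst_tm)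
    then have "?\<Gamma> \<tturnstile> le \<tau> ?t (subst_tm ?s f' \<cdot> ?u)"
      using ty by (intro Eq_sym_le)
    moreover have "?\<Gamma> \<tturnstile> le \<tau> (subst_tm ?s f' \<cdot> ?u) (subst_tm ?s c')"
      using * deriv_lift[OF *(3), of \<rho>] by (intro c'(2)) (auto simp: lift_tm_subst_tm)
    ultimately show "?\<Gamma> \<tturnstile> le \<tau> ?t (subst_tm ?s c')"
      using ty by (rule le_trans)
  qed (use * Fun.prems in \<open>auto intro: has_ty_App\<close>)
  with c(1) show ?case by blast
next
  case (Star \<rho>)
  let ?c = "BigCup \<sigma> \<rho> \<cdot> Z \<cdot> f"
  have c: "?c \<Colon> Star \<rho>" using Star.prems by (meson has_ty.intros)
  have "\<Gamma> \<tturnstile> le (Star \<rho>) (subst_tm s f \<cdot> u) (subst_tm s ?c)"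
    if *: "wts s" "u \<Colon> \<sigma>" "\<Gamma> \<tturnstile> Mem \<sigma> u (subst_tm s Z)" for s u \<Gamma>
  proof (rule le_StarI)
    let ?M = "Mem \<rho> (Var \<rho> 0) (lift_tm \<rho> (subst_tm s f \<cdot> u))"
    have "?M # map (lift \<rho>) \<Gamma> \<tturnstile> Mem \<sigma> (lift_tm \<rho> u) (lift_tm \<rho> (subst_tm s Z))"
      using deriv_lift[OF *(3), of \<rho>] by (auto intro: weaken)
    moreover have "?M # map (lift \<rho>) \<Gamma> \<tturnstile> Mem \<rho> (Var \<rho> 0) (lift_tm \<rho> (subst_tm s f) \<cdot> lift_tm \<rho> u)"
      by (simp add: Assm)
    ultimately have "?M # map (lift \<rho>) \<Gamma> \<tturnstile>
        Mem \<rho> (Var \<rho> 0) (BigCup \<sigma> \<rho> \<cdot> lift_tm \<rho> (subst_tm s Z) \<cdot> lift_tm \<rho> (subst_tm s f))"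
      using * Star.prems by (intro ImpE[OF IL_deriv[OF IL.mem_bigcup] AndI]) auto
    then show "?M # map (lift \<rho>) \<Gamma> \<tturnstile> Mem \<rho> (Var \<rho> 0) (lift_tm \<rho> (subst_tm s ?c))"
      by (simp add: lift_tm_def[of \<rho> "BigCup _ _"])
  qed (use * Star.prems in \<open>auto intro: has_ty_App\<close>)
  with c show ?case by blast
qed auto

end

section \<open>Simultaneous recursion\<close>

text \<open>The language has no constant for truth, so a provable equation serves as the empty
  conjunction.\<close>

fun conj :: "fm list \<Rightarrow> fm" where
  "conj [] = Eq N Zero Zero"
| "conj (A # As) = A \<^bold>\<and> conj As"

lemma subst_conj: "subst s (conj As) = conj (map (subst s) As)"
  by (induction As) auto

lemma wff_conj: "(\<And>A. A \<in> set As \<Longrightarrow> wff A) \<Longrightarrow> wff (conj As)"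
  by (induction As) auto

text \<open>This brings the substitution of the induction axiom into a form that the simp rules for
  \<open>scons\<close> and \<open>shift\<close> can handle.\<close>

lemma step_sub_eq: "Var(N := (Var N)(0 := Succ \<cdot> Var N 0)) = scons N (Succ \<cdot> Var N 0) (shift N)"
  by (auto simp: scons_def shift_def fun_eq_iff split: nat.split)

locale ha_theory =
  fixes Ax :: "fm set"
  assumes HA_sub: "HA \<subseteq> Ax"

sublocale ha_theory \<subseteq> il_theory
  using HA_sub HA.IL by unfold_locales blast

context ha_theory
begin

lemma HA_deriv: "A \<in> HA \<Longrightarrow> \<Gamma> \<tturnstile> A"
  using HA_sub by (auto intro: Axiom)

lemma conjI_deriv: "(\<And>A. A \<in> set As \<Longrightarrow> \<Gamma> \<tturnstile> A) \<Longrightarrow> \<Gamma> \<tturnstile> conj As"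
  by (induction As) (auto intro: AndI Eq_refl)

lemma conjE_deriv: "\<Gamma> \<tturnstile> conj As \<Longrightarrow> A \<in> set As \<Longrightarrow> \<Gamma> \<tturnstile> A"
  by (induction As) (auto dest: AndE1 AndE2)

lemma induct_deriv:
  assumes "\<Gamma> \<tturnstile> inst N Zero A" "A # map (lift N) \<Gamma> \<tturnstile> subst (scons N (Succ \<cdot> Var N 0) (shift N)) A" "wff A"
  shows "\<Gamma> \<tturnstile> All N A"
  by (rule ImpE[OF HA_deriv[OF HA.induction]], fact, intro AndI AllI ImpI)
    (use assms in \<open>auto simp: step_sub_eq\<close>)

text \<open>Induction on the conjunction of all members, so that the step for each may use the whole
  list at the preceding stage. The induction variable is left free in the conclusion;
  \<open>provable_subst\<close> then gives every instance.\<close>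

lemma simultaneous_induct_deriv:
  assumes "\<And>A. A \<in> set As \<Longrightarrow> [] \<tturnstile> inst N Zero A"
    "\<And>A. A \<in> set As \<Longrightarrow> As \<tturnstile> subst (scons N (Succ \<cdot> Var N 0) (shift N)) A"
    "\<And>A. A \<in> set As \<Longrightarrow> wff A" "A \<in> set As"
  shows "[] \<tturnstile> A"
proof -
  have "[] \<tturnstile> All N (conj As)"
  proof (rule induct_deriv)
    show "[] \<tturnstile> inst N Zero (conj As)"
      using assms(1) by (auto simp: inst_def subst_conj intro!: conjI_deriv)
    have "[conj As] \<tturnstile> subst (scons N (Succ \<cdot> Var N 0) (shift N)) B" if "B \<in> set As" for B
      by (rule deriv_cut[OF assms(2)[OF that]]) (rule conjE_deriv[of _ As], auto intro: Assm)
    then show "conj As # map (lift N) [] \<tturnstile> subst (scons N (Succ \<cdot> Var N 0) (shift N)) (conj As)"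
      by (auto simp: subst_conj intro!: conjI_deriv)
  qed (use assms(3) wff_conj in blast)
  from deriv_lift_Var_E[of Ax N "[]"] deriv_lift[OF this, of N] have "[] \<tturnstile> conj As" by simp
  then show ?thesis using assms(4) by (rule conjE_deriv)
qed

end
context ha_theory
begin

text \<open>Without product types, a tuple is iterated in continuation-passing style:
  \<open>F n k\<close> is \<open>k\<close> applied to the tuple of the \<open>n\<close>-th stage, and only the result type \<open>\<upsilon>\<close> of the
  continuation \<open>k\<close> has to be fixed in advance.\<close>

lemma ex_cps_iterator:
  assumes xs: "xs \<Colon>* \<tau>s" and us: "us \<Colon>* map (\<lambda>\<tau>. N \<rightarrow> \<tau>s \<rightarrow>* \<tau>) \<tau>s"
  shows "\<exists>F G. F \<Colon> N \<rightarrow> (\<tau>s \<rightarrow>* \<upsilon>) \<rightarrow> \<upsilon> \<and> G \<Colon> (\<tau>s \<rightarrow>* \<upsilon>) \<rightarrow> N \<rightarrow> \<tau>s \<rightarrow>* \<upsilon> \<and>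
    (\<forall>s k \<Gamma>. wts s \<longrightarrow> k \<Colon> \<tau>s \<rightarrow>* \<upsilon> \<longrightarrow>
      \<Gamma> \<tturnstile> Eq \<upsilon> (subst_tm s F \<cdot> Zero \<cdot> k) (k \<cdot>* map (subst_tm s) xs)) \<and>
    (\<forall>s k n \<Gamma>. wts s \<longrightarrow> k \<Colon> \<tau>s \<rightarrow>* \<upsilon> \<longrightarrow> n \<Colon> N \<longrightarrow>
      \<Gamma> \<tturnstile> Eq \<upsilon> (subst_tm s F \<cdot> (Succ \<cdot> n) \<cdot> k) (subst_tm s F \<cdot> n \<cdot> (subst_tm s G \<cdot> k \<cdot> n))) \<and>
    (\<forall>s k n ys \<Gamma>. wts s \<longrightarrow> k \<Colon> \<tau>s \<rightarrow>* \<upsilon> \<longrightarrow> n \<Colon> N \<longrightarrow> ys \<Colon>* \<tau>s \<longrightarrow>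
      \<Gamma> \<tturnstile> Eq \<upsilon> (subst_tm s G \<cdot> k \<cdot> n \<cdot>* ys) (k \<cdot>* map (\<lambda>u. subst_tm s u \<cdot> n \<cdot>* ys) us))"
proof -
  define \<kappa> where "\<kappa> = \<tau>s \<rightarrow>* \<upsilon>"
  \<comment> \<open>\<open>B\<close> is stage zero in continuation-passing form: it hands the
    initial tuple \<open>xs\<close> to the continuation.\<close>
  have "Var \<kappa> 0 \<cdot>* map (lift_tm \<kappa>) xs \<Colon> \<upsilon>"
    using xs by (intro has_ty_Apps) (auto simp: \<kappa>_def)
  from lam_ex[OF this, of \<kappa>] obtain B where B: "B \<Colon> \<kappa> \<rightarrow> \<upsilon>" "\<And>s k \<Gamma>. wts s \<Longrightarrow> k \<Colon> \<kappa> \<Longrightarrow>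
      \<Gamma> \<tturnstile> Eq \<upsilon> (subst_tm s B \<cdot> k) (k \<cdot>* map (subst_tm s) xs)"
    by (auto simp: comp_def)
  \<comment> \<open>\<open>?\<rho>s\<close> lists the types of the arguments \<open>k\<close>,
    \<open>n\<close>, \<open>ys\<close> of \<open>G\<close>. The term \<open>G k n\<close> is the
    continuation that first performs step \<open>n\<close> on its tuple and then calls
    \<open>k\<close>, that is, \<open>G k n ys\<close> is \<open>k\<close> applied to the terms
    \<open>u n ys\<close> for \<open>u\<close> in \<open>us\<close>.\<close>
  let ?\<rho>s = "\<kappa> # N # \<tau>s"
  let ?g = "\<lambda>u. lifts_tm ?\<rho>s u \<cdot>* tl (bvars ?\<rho>s)"
  have "map ?g us \<Colon>* \<tau>s"
    using has_tys_Apps[of "map (lifts_tm ?\<rho>s) us" "N # \<tau>s" \<tau>s "tl (bvars ?\<rho>s)"] us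
    by (simp add: list_all2_map1 comp_def)
  then have "hd (bvars ?\<rho>s) \<cdot>* map ?g us \<Colon> \<upsilon>" (is "?b \<Colon> _")
    by (intro has_ty_Apps) (auto simp: \<kappa>_def)
  from lams_ex[OF this, of ?\<rho>s] obtain G where G: "G \<Colon> ?\<rho>s \<rightarrow>* \<upsilon>"
    "\<And>s vs \<Gamma>. wts s \<Longrightarrow> vs \<Colon>* ?\<rho>s \<Longrightarrow> \<Gamma> \<tturnstile> Eq \<upsilon> (subst_tm s G \<cdot>* vs) (subst_tm (sconses ?\<rho>s vs s) ?b)"
    by blast
  have G_ty: "G \<Colon> \<kappa> \<rightarrow> N \<rightarrow> \<kappa>" using G(1) by (simp add: \<kappa>_def)
  have G_eq: "\<Gamma> \<tturnstile> Eq \<upsilon> (subst_tm s G \<cdot> k \<cdot> n \<cdot>* ys) (k \<cdot>* map (\<lambda>u. subst_tm s u \<cdot> n \<cdot>* ys) us)"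
    if "wts s" "k \<Colon> \<kappa>" "n \<Colon> N" "ys \<Colon>* \<tau>s" for s k n ys \<Gamma>
  proof -
    let ?s = "sconses ?\<rho>s (k # n # ys) s"
    have l: "length (k # n # ys) = length ?\<rho>s" using that(4) by (simp add: list_all2_lengthD)
    have bv: "map (subst_tm ?s) (bvars ?\<rho>s) = k # n # ys" using l by (rule sconses_bvars)
    have "subst_tm ?s (hd (bvars ?\<rho>s)) = k" "map (subst_tm ?s) (tl (bvars ?\<rho>s)) = n # ys"
      using bv by auto
    moreover have "subst_tm ?s (lifts_tm ?\<rho>s u) = subst_tm s u" for u
      using l by (rule sconses_lifts_tm)
    ultimately have "subst_tm ?s ?b = k \<cdot>* map (\<lambda>u. subst_tm s u \<cdot> n \<cdot>* ys) us"
      by (simp del: bvars.simps fold.simps sconses.simps add: comp_def)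
    then show ?thesis using G(2)[of s "k # n # ys" \<Gamma>] that by (simp del: bvars.simps fold.simps sconses.simps)
  qed
  \<comment> \<open>\<open>D\<close> is the step for the recursor, with
    \<open>D f n k = f (G k n)\<close>: stage \<open>n + 1\<close> with continuation
    \<open>k\<close> is stage \<open>n\<close>, given as \<open>f\<close>, with the extended
    continuation.\<close>
  let ?\<phi> = "\<kappa> \<rightarrow> \<upsilon>"
  have "lifts_tm [N, \<kappa>] (Var ?\<phi> 0) \<cdot> (lifts_tm [?\<phi>, N, \<kappa>] G \<cdot> Var \<kappa> 0 \<cdot> lift_tm \<kappa> (Var N 0)) \<Colon> \<upsilon>" (is "?d \<Colon> _")
    using G_ty by (auto intro!: has_ty_App)
  from lams_ex[OF this, of "[?\<phi>, N, \<kappa>]"] obtain D where D: "D \<Colon> ?\<phi> \<rightarrow> N \<rightarrow> ?\<phi>"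
    "\<And>s vs \<Gamma>. wts s \<Longrightarrow> vs \<Colon>* [?\<phi>, N, \<kappa>] \<Longrightarrow> \<Gamma> \<tturnstile> Eq \<upsilon> (subst_tm s D \<cdot>* vs) (subst_tm (sconses [?\<phi>, N, \<kappa>] vs s) ?d)"
    by auto
  have D_eq: "\<Gamma> \<tturnstile> Eq \<upsilon> (subst_tm s D \<cdot> f \<cdot> n \<cdot> k) (f \<cdot> (subst_tm s G \<cdot> k \<cdot> n))"
    if "wts s" "f \<Colon> ?\<phi>" "n \<Colon> N" "k \<Colon> \<kappa>" for s f n k \<Gamma>
    using D(2)[of s "[f, n, k]" \<Gamma>] that by simp
  have "Rec ?\<phi> \<cdot> Var N 0 \<cdot> lift_tm N B \<cdot> lift_tm N D \<Colon> ?\<phi>" (is "?f \<Colon> _")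
    using B(1) D(1) by (auto intro!: has_ty_App has_ty_const)
  from lam_ex[OF this, of N] obtain F where F: "F \<Colon> N \<rightarrow> ?\<phi>" "\<And>s n \<Gamma>. wts s \<Longrightarrow> n \<Colon> N \<Longrightarrow>
      \<Gamma> \<tturnstile> Eq ?\<phi> (subst_tm s F \<cdot> n) (Rec ?\<phi> \<cdot> n \<cdot> subst_tm s B \<cdot> subst_tm s D)"
    by auto
  have R_ty: "Rec ?\<phi> \<cdot> n \<cdot> subst_tm s B \<cdot> subst_tm s D \<Colon> ?\<phi>" if "wts s" "n \<Colon> N" for s n
    using that B(1) D(1) by (auto intro!: has_ty_App has_ty_const)
  have F0: "\<Gamma> \<tturnstile> Eq \<upsilon> (subst_tm s F \<cdot> Zero \<cdot> k) (k \<cdot>* map (subst_tm s) xs)" if *: "wts s" "k \<Colon> \<kappa>" for s k \<Gamma>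
  proof -
    let ?R = "Rec ?\<phi> \<cdot> Zero \<cdot> subst_tm s B \<cdot> subst_tm s D"
    have ty: "subst_tm s F \<cdot> Zero \<Colon> ?\<phi>" "subst_tm s B \<Colon> ?\<phi>" "subst_tm s D \<Colon> ?\<phi> \<rightarrow> N \<rightarrow> ?\<phi>" "?R \<Colon> ?\<phi>"
      using * F(1) B(1) D(1) R_ty[of s Zero] by (auto intro: has_ty_App has_ty_const)
    have "\<Gamma> \<tturnstile> Eq ?\<phi> (subst_tm s F \<cdot> Zero) (subst_tm s B)"
      by (rule Eq_trans[OF F(2) HA_deriv[OF HA.rec_zero]]) (use ty * in auto)
    then have 1: "\<Gamma> \<tturnstile> Eq \<upsilon> (subst_tm s F \<cdot> Zero \<cdot> k) (subst_tm s B \<cdot> k)"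
      using ty * by (intro Eq_App1[of _ \<kappa>]) auto
    have "k \<cdot>* map (subst_tm s) xs \<Colon> \<upsilon>"
      using * xs by (intro has_ty_Apps) (auto simp: \<kappa>_def)
    with * ty show ?thesis
      by (intro Eq_trans[OF 1 B(2)]) (use * ty in \<open>auto intro: has_ty_App\<close>)
  qed
  have FS: "\<Gamma> \<tturnstile> Eq \<upsilon> (subst_tm s F \<cdot> (Succ \<cdot> n) \<cdot> k) (subst_tm s F \<cdot> n \<cdot> (subst_tm s G \<cdot> k \<cdot> n))"
    if *: "wts s" "k \<Colon> \<kappa>" "n \<Colon> N" for s k n \<Gamma>
  proof -
    let ?R = "\<lambda>n. Rec ?\<phi> \<cdot> n \<cdot> subst_tm s B \<cdot> subst_tm s D"
    let ?F = "subst_tm s F" and ?D = "subst_tm s D" and ?k = "subst_tm s G \<cdot> k \<cdot> n"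
    have n: "Succ \<cdot> n \<Colon> N" using * by (auto intro: has_ty_App has_ty_const)
    have s: "?F \<Colon> N \<rightarrow> ?\<phi>" "subst_tm s B \<Colon> ?\<phi>" "?D \<Colon> ?\<phi> \<rightarrow> N \<rightarrow> ?\<phi>" "subst_tm s G \<Colon> \<kappa> \<rightarrow> N \<rightarrow> \<kappa>"
      using * F(1) B(1) D(1) G_ty by auto
    have ty: "?F \<cdot> (Succ \<cdot> n) \<Colon> ?\<phi>" "?F \<cdot> n \<Colon> ?\<phi>" "?R n \<Colon> ?\<phi>" "?R (Succ \<cdot> n) \<Colon> ?\<phi>"
      "?D \<cdot> ?R n \<cdot> n \<Colon> ?\<phi>" "?k \<Colon> \<kappa>"
      using * s R_ty n by (auto intro!: has_ty_App[of ?F] has_ty_App[of "subst_tm s G"] has_ty_App[of ?D]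
          has_ty_App[of "?D \<cdot> ?R n"] has_ty_App[of "subst_tm s G \<cdot> k"])
    have "\<Gamma> \<tturnstile> Eq ?\<phi> (?F \<cdot> (Succ \<cdot> n)) (?D \<cdot> ?R n \<cdot> n)"
      by (rule Eq_trans[OF F(2) HA_deriv[OF HA.rec_succ]]) (use ty * s n in auto)
    then have 1: "\<Gamma> \<tturnstile> Eq \<upsilon> (?F \<cdot> (Succ \<cdot> n) \<cdot> k) (?D \<cdot> ?R n \<cdot> n \<cdot> k)"
      using ty * by (intro Eq_App1[of _ \<kappa>]) auto
    have 2: "\<Gamma> \<tturnstile> Eq \<upsilon> (?D \<cdot> ?R n \<cdot> n \<cdot> k) (?R n \<cdot> ?k)"
      using ty * by (intro D_eq) auto
    have 3: "\<Gamma> \<tturnstile> Eq \<upsilon> (?R n \<cdot> ?k) (?F \<cdot> n \<cdot> ?k)"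
      by (rule Eq_App1[OF Eq_sym[OF F(2)]]) (use ty * in auto)
    have ty': "?F \<cdot> (Succ \<cdot> n) \<cdot> k \<Colon> \<upsilon>" "?D \<cdot> ?R n \<cdot> n \<cdot> k \<Colon> \<upsilon>" "?R n \<cdot> ?k \<Colon> \<upsilon>" "?F \<cdot> n \<cdot> ?k \<Colon> \<upsilon>"
      using ty * has_ty_App by blast+
    show ?thesis by (rule Eq_trans[OF Eq_trans[OF 1 2] 3]) (fact ty')+
  qed
  show ?thesis using F(1) G_ty F0 FS G_eq unfolding \<kappa>_def by (intro exI[of _ F] exI[of _ G]) blast
qed

text \<open>The component \<open>Y i\<close> is read off by passing the projection
  \<open>p i\<close> to an iterator \<open>F i\<close> whose result type is that of the component.
  Different components thus use different iterators, and the point is that all of these run through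
  the same tuple: \<open>F j n k\<close> equals \<open>k\<close> applied to all the values
  \<open>Y i n\<close>, for every continuation \<open>k\<close>. This is proved by induction on
  \<open>n\<close>, simultaneously for all \<open>j\<close>.\<close>

lemma ex_simultaneous_recursor:
  assumes xs: "xs \<Colon>* \<tau>s" and us: "us \<Colon>* map (\<lambda>\<tau>. N \<rightarrow> \<tau>s \<rightarrow>* \<tau>) \<tau>s"
  obtains Ys where "Ys \<Colon>* map (\<lambda>\<tau>. N \<rightarrow> \<tau>) \<tau>s"
    "\<And>s i \<Gamma>. wts s \<Longrightarrow> i < length \<tau>s \<Longrightarrow> \<Gamma> \<tturnstile> Eq (\<tau>s ! i) (subst_tm s (Ys ! i) \<cdot> Zero) (subst_tm s (xs ! i))"
    "\<And>s i n \<Gamma>. wts s \<Longrightarrow> i < length \<tau>s \<Longrightarrow> n \<Colon> N \<Longrightarrow>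
      \<Gamma> \<tturnstile> Eq (\<tau>s ! i) (subst_tm s (Ys ! i) \<cdot> (Succ \<cdot> n)) (subst_tm s (us ! i) \<cdot> n \<cdot>* map (\<lambda>Y. subst_tm s Y \<cdot> n) Ys)"
proof -
  let ?l = "length \<tau>s"
  define \<kappa> where "\<kappa> i = \<tau>s \<rightarrow>* \<tau>s ! i" for i
  define P where "P i F G \<longleftrightarrow> F \<Colon> N \<rightarrow> \<kappa> i \<rightarrow> \<tau>s ! i \<and> G \<Colon> \<kappa> i \<rightarrow> N \<rightarrow> \<kappa> i \<and>
    (\<forall>s k \<Gamma>. wts s \<longrightarrow> k \<Colon> \<kappa> i \<longrightarrow>
      \<Gamma> \<tturnstile> Eq (\<tau>s ! i) (subst_tm s F \<cdot> Zero \<cdot> k) (k \<cdot>* map (subst_tm s) xs)) \<and>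
    (\<forall>s k n \<Gamma>. wts s \<longrightarrow> k \<Colon> \<kappa> i \<longrightarrow> n \<Colon> N \<longrightarrow>
      \<Gamma> \<tturnstile> Eq (\<tau>s ! i) (subst_tm s F \<cdot> (Succ \<cdot> n) \<cdot> k) (subst_tm s F \<cdot> n \<cdot> (subst_tm s G \<cdot> k \<cdot> n))) \<and>
    (\<forall>s k n ys \<Gamma>. wts s \<longrightarrow> k \<Colon> \<kappa> i \<longrightarrow> n \<Colon> N \<longrightarrow> ys \<Colon>* \<tau>s \<longrightarrow>
      \<Gamma> \<tturnstile> Eq (\<tau>s ! i) (subst_tm s G \<cdot> k \<cdot> n \<cdot>* ys) (k \<cdot>* map (\<lambda>u. subst_tm s u \<cdot> n \<cdot>* ys) us))"
    for i F G
  have "\<exists>F G. P i F G" for i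
    using ex_cps_iterator[OF assms, of "\<tau>s ! i"] unfolding P_def \<kappa>_def .
  then obtain F G where P: "P i (F i) (G i)" for i by metis
  have F: "F i \<Colon> N \<rightarrow> \<kappa> i \<rightarrow> \<tau>s ! i" and G: "G i \<Colon> \<kappa> i \<rightarrow> N \<rightarrow> \<kappa> i" for i
    using P[of i] unfolding P_def by blast+
  have F0: "\<Gamma> \<tturnstile> Eq (\<tau>s ! i) (subst_tm s (F i) \<cdot> Zero \<cdot> k) (k \<cdot>* map (subst_tm s) xs)"
    if "wts s" "k \<Colon> \<kappa> i" for s k i \<Gamma>
    using P[of i] that unfolding P_def by blast
  have FS: "\<Gamma> \<tturnstile> Eq (\<tau>s ! i) (subst_tm s (F i) \<cdot> (Succ \<cdot> n) \<cdot> k) (subst_tm s (F i) \<cdot> n \<cdot> (subst_tm s (G i) \<cdot> k \<cdot> n))"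
    if "wts s" "k \<Colon> \<kappa> i" "n \<Colon> N" for s k i n \<Gamma>
    using P[of i] that unfolding P_def by blast
  have G_eq: "\<Gamma> \<tturnstile> Eq (\<tau>s ! i) (subst_tm s (G i) \<cdot> k \<cdot> n \<cdot>* ys) (k \<cdot>* map (\<lambda>u. subst_tm s u \<cdot> n \<cdot>* ys) us)"
    if "wts s" "k \<Colon> \<kappa> i" "n \<Colon> N" "ys \<Colon>* \<tau>s" for s k i n ys \<Gamma>
    using P[of i] that unfolding P_def by blast

  \<comment> \<open>\<open>p i\<close> is the projection of a tuple to its component
    \<open>i\<close>.\<close>
  have "\<exists>p. i < ?l \<longrightarrow> p \<Colon> \<kappa> i \<and> (\<forall>s ys \<Gamma>. wts s \<longrightarrow> ys \<Colon>* \<tau>s \<longrightarrow>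
      \<Gamma> \<tturnstile> Eq (\<tau>s ! i) (subst_tm s p \<cdot>* ys) (ys ! i))" for i
  proof (cases "i < ?l")
    case True
    have "subst_tm (sconses \<tau>s ys s) (bvars \<tau>s ! i) = ys ! i" if "ys \<Colon>* \<tau>s" for ys s
      using sconses_bvars[of ys \<tau>s s] list_all2_lengthD[OF that] True by (metis length_bvars nth_map)
    then show ?thesis
      using lams_ex[OF nth_has_ty[OF has_tys_bvars True], of \<tau>s] unfolding \<kappa>_def by metis
  qed simp
  then obtain p where p: "\<And>i. i < ?l \<Longrightarrow> p i \<Colon> \<kappa> i"
    and p_eq: "\<And>i s ys \<Gamma>. i < ?l \<Longrightarrow> wts s \<Longrightarrow> ys \<Colon>* \<tau>s \<Longrightarrow> \<Gamma> \<tturnstile> Eq (\<tau>s ! i) (subst_tm s (p i) \<cdot>* ys) (ys ! i)"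
    by metis
  have "\<exists>Y. i < ?l \<longrightarrow> Y \<Colon> N \<rightarrow> \<tau>s ! i \<and> (\<forall>s n \<Gamma>. wts s \<longrightarrow> n \<Colon> N \<longrightarrow>
      \<Gamma> \<tturnstile> Eq (\<tau>s ! i) (subst_tm s Y \<cdot> n) (subst_tm s (F i) \<cdot> n \<cdot> subst_tm s (p i)))" for i
  proof (cases "i < ?l")
    case True
    have "lift_tm N (F i) \<cdot> Var N 0 \<cdot> lift_tm N (p i) \<Colon> \<tau>s ! i"
      using F p True by (auto intro!: has_ty_App)
    from lam_ex[OF this, of N] show ?thesis by (simp, metis)
  qed simp
  then obtain Y where Y: "\<And>i. i < ?l \<Longrightarrow> Y i \<Colon> N \<rightarrow> \<tau>s ! i"
    and Y_eq: "\<And>i s n \<Gamma>. i < ?l \<Longrightarrow> wts s \<Longrightarrow> n \<Colon> N \<Longrightarrow>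
      \<Gamma> \<tturnstile> Eq (\<tau>s ! i) (subst_tm s (Y i) \<cdot> n) (subst_tm s (F i) \<cdot> n \<cdot> subst_tm s (p i))"
    by metis
  define Ys where "Ys = map Y [0..<?l]"
  have Ys_ty: "Ys \<Colon>* map (\<lambda>\<tau>. N \<rightarrow> \<tau>) \<tau>s"
    using Y by (simp add: list_all2_conv_all_nth Ys_def)
  have Ysn_ty: "map (\<lambda>Y. subst_tm s Y \<cdot> n) Ys \<Colon>* \<tau>s" if "wts s" "n \<Colon> N" for s n
    using has_tys_App[of "map (subst_tm s) Ys" N \<tau>s n] Ys_ty that by (simp add: comp_def)
  have F_ty: "subst_tm s (F i) \<cdot> n \<cdot> k \<Colon> \<tau>s ! i" if "wts s" "n \<Colon> N" "k \<Colon> \<kappa> i" for s n k i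
  proof -
    have "subst_tm s (F i) \<Colon> N \<rightarrow> \<kappa> i \<rightarrow> \<tau>s ! i" using F that by simp
    then show ?thesis using that has_ty_App by blast
  qed
  have k_ty: "k \<cdot>* vs \<Colon> \<tau>s ! i" if "k \<Colon> \<kappa> i" "vs \<Colon>* \<tau>s" for k vs i
    using that has_ty_Apps unfolding \<kappa>_def by blast

  \<comment> \<open>If at stage \<open>m\<close> all iterators pass one common tuple
    \<open>vs\<close> to their continuations, then the projections show that \<open>vs\<close>
    consists of the values \<open>Y i m\<close>, and \<open>vs\<close> may be replaced by these
    values. It is applied with the initial tuple and with the result of a step.\<close>
  have stage: "(\<forall>i<?l. \<Gamma> \<tturnstile> Eq (\<tau>s ! i) (subst_tm s (Y i) \<cdot> m) (vs ! i)) \<and>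
      (\<forall>i<?l. \<forall>k. k \<Colon> \<kappa> i \<longrightarrow> \<Gamma> \<tturnstile> Eq (\<tau>s ! i) (subst_tm s (F i) \<cdot> m \<cdot> k) (k \<cdot>* map (\<lambda>Y. subst_tm s Y \<cdot> m) Ys))"
    if *: "wts s" "m \<Colon> N" "vs \<Colon>* \<tau>s"
      and vs: "\<And>j k. j < ?l \<Longrightarrow> k \<Colon> \<kappa> j \<Longrightarrow> \<Gamma> \<tturnstile> Eq (\<tau>s ! j) (subst_tm s (F j) \<cdot> m \<cdot> k) (k \<cdot>* vs)"
    for \<Gamma> s m vs
  proof -
    have 1: "\<Gamma> \<tturnstile> Eq (\<tau>s ! i) (subst_tm s (Y i) \<cdot> m) (vs ! i)" if i: "i < ?l" for i
    proof -
      have ty: "subst_tm s (p i) \<Colon> \<kappa> i" "subst_tm s (Y i) \<Colon> N \<rightarrow> \<tau>s ! i" using p Y i * by auto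
      then have ty': "subst_tm s (Y i) \<cdot> m \<Colon> \<tau>s ! i" using * has_ty_App by blast
      show ?thesis
        by (rule Eq_trans[OF Eq_trans[OF Y_eq vs] p_eq])
          (use * i ty ty' nth_has_ty[OF *(3)] in \<open>auto intro: F_ty k_ty\<close>)
    qed
    have "\<Gamma> \<tturnstile> Eq (\<tau>s ! i) (subst_tm s (F i) \<cdot> m \<cdot> k) (k \<cdot>* map (\<lambda>Y. subst_tm s Y \<cdot> m) Ys)"
      if i: "i < ?l" and k: "k \<Colon> \<kappa> i" for i k
    proof (rule Eq_trans[OF vs])
      show "\<Gamma> \<tturnstile> Eq (\<tau>s ! i) (k \<cdot>* vs) (k \<cdot>* map (\<lambda>Y. subst_tm s Y \<cdot> m) Ys)"
      proof (rule Eq_Apps)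
        fix j assume j: "j < ?l"
        have "subst_tm s (Y j) \<cdot> m \<Colon> \<tau>s ! j"
          using nth_has_ty[OF Ysn_ty[OF *(1,2)] j] j by (simp add: Ys_def)
        with 1[OF j] show "\<Gamma> \<tturnstile> Eq (\<tau>s ! j) (vs ! j) (map (\<lambda>Y. subst_tm s Y \<cdot> m) Ys ! j)"
          using nth_has_ty[OF *(3) j] j by (simp add: Ys_def Eq_sym)
      qed (use k * Ysn_ty in \<open>auto simp: \<kappa>_def intro: Eq_refl\<close>)
    qed (use i k * Ysn_ty in \<open>auto intro: F_ty k_ty\<close>)
    with 1 show ?thesis by blast
  qed

  let ?us = "\<lambda>s n. map (\<lambda>u. subst_tm s u \<cdot> n \<cdot>* map (\<lambda>Y. subst_tm s Y \<cdot> n) Ys) us"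
  have us_ty: "?us s n \<Colon>* \<tau>s" if "wts s" "n \<Colon> N" for s n
    using has_tys_Apps[OF has_tys_App[of "map (subst_tm s) us" N "map (\<lambda>\<tau>. \<tau>s \<rightarrow>* \<tau>) \<tau>s" n] Ysn_ty[OF that]] us that
    by (simp add: comp_def)
  \<comment> \<open>Unfolding stage \<open>n + 1\<close> changes the continuation from
    \<open>k\<close> to \<open>G j k n\<close>; this is why the hypothesis has to cover all
    continuations.\<close>
  have step: "\<Gamma> \<tturnstile> Eq (\<tau>s ! j) (subst_tm s (F j) \<cdot> (Succ \<cdot> n) \<cdot> k) (k \<cdot>* ?us s n)"
    if *: "wts s" "n \<Colon> N" "j < ?l" "k \<Colon> \<kappa> j"
      and IH: "\<And>k. k \<Colon> \<kappa> j \<Longrightarrow> \<Gamma> \<tturnstile> Eq (\<tau>s ! j) (subst_tm s (F j) \<cdot> n \<cdot> k) (k \<cdot>* map (\<lambda>Y. subst_tm s Y \<cdot> n) Ys)"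
    for \<Gamma> s n j k
  proof -
    have n: "Succ \<cdot> n \<Colon> N" using * by (auto intro: has_ty_App has_ty_const)
    have "subst_tm s (G j) \<Colon> \<kappa> j \<rightarrow> N \<rightarrow> \<kappa> j" using G * by simp
    then have G': "subst_tm s (G j) \<cdot> k \<cdot> n \<Colon> \<kappa> j" using * has_ty_App by blast
    show ?thesis
      by (rule Eq_trans[OF Eq_trans[OF FS IH[OF G']] G_eq])
        (use * n G' us_ty Ysn_ty in \<open>auto intro: F_ty k_ty\<close>)
  qed

  \<comment> \<open>The induction formula has the continuation as an internally quantified variable.
    \<open>A_I\<close> and \<open>A_E\<close> translate between it and equations for arbitrary
    continuations.\<close>
  define A where "A j = All (\<kappa> j) (Eq (\<tau>s ! j) (lift_tm (\<kappa> j) (lift_tm N (F j) \<cdot> Var N 0) \<cdot> Var (\<kappa> j) 0)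
      (Var (\<kappa> j) 0 \<cdot>* map (\<lambda>Y. lift_tm (\<kappa> j) (lift_tm N Y \<cdot> Var N 0)) Ys))" for j
  have subst_A: "subst (scons N n s) (A j) =
      All (\<kappa> j) (Eq (\<tau>s ! j) (lift_tm (\<kappa> j) (subst_tm s (F j) \<cdot> n) \<cdot> Var (\<kappa> j) 0)
        (Var (\<kappa> j) 0 \<cdot>* map (\<lambda>Y. lift_tm (\<kappa> j) (subst_tm s Y \<cdot> n)) Ys))" for n s j
    by (simp add: A_def lift_tm_subst_tm lift_tm_def[of _ n] comp_def)
  have A_I: "\<Gamma> \<tturnstile> subst (scons N n s) (A j)"
    if "map (lift (\<kappa> j)) \<Gamma> \<tturnstile> Eq (\<tau>s ! j) (subst_tm (shift (\<kappa> j) \<odot> s) (F j) \<cdot> lift_tm (\<kappa> j) n \<cdot> Var (\<kappa> j) 0)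
        (Var (\<kappa> j) 0 \<cdot>* map (\<lambda>Y. subst_tm (shift (\<kappa> j) \<odot> s) Y \<cdot> lift_tm (\<kappa> j) n) Ys)" for \<Gamma> n s j
    using that unfolding subst_A by (intro AllI) (simp add: lift_tm_subst_tm)
  have A_E: "\<Gamma> \<tturnstile> Eq (\<tau>s ! j) (subst_tm s (F j) \<cdot> n \<cdot> k) (k \<cdot>* map (\<lambda>Y. subst_tm s Y \<cdot> n) Ys)"
    if "\<Gamma> \<tturnstile> subst (scons N n s) (A j)" "k \<Colon> \<kappa> j" for \<Gamma> n s j k
    using AllE[OF that(1)[unfolded subst_A] that(2)] by (simp add: inst_def comp_def)
  have "[] \<tturnstile> A j" if j: "j < ?l" for j
  proof (rule simultaneous_induct_deriv)
    let ?As = "map A [0..<?l]"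
    show "A j \<in> set ?As" using j by simp
    fix B assume "B \<in> set ?As"
    then obtain i where i: "i < ?l" "B = A i" by auto
    have "shift (\<kappa> i) N 0 \<Colon> N" by (simp add: shift_def)
    then show "wff B"
      using F_ty[of "shift (\<kappa> i) \<odot> shift N" "lift_tm (\<kappa> i) (Var N 0)" "Var (\<kappa> i) 0" i]
        k_ty[OF _ Ysn_ty[of "shift (\<kappa> i) \<odot> shift N" "lift_tm (\<kappa> i) (Var N 0)"], of "Var (\<kappa> i) 0" i]
      by (simp add: i A_def lift_tm_def subst_tm_subst_tm comp_def)
    show "[] \<tturnstile> inst N Zero B"
      unfolding inst_def i
      using stage[of "shift (\<kappa> i)" Zero "map (subst_tm (shift (\<kappa> i))) xs" "[]"] F0 xs i(1)
      by (intro A_I) auto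
    let ?\<Gamma> = "map (lift (\<kappa> i)) ?As" and ?s = "shift (\<kappa> i) \<odot> shift N" and ?n = "lift_tm (\<kappa> i) (Var N 0)"
    have IH: "?\<Gamma> \<tturnstile> Eq (\<tau>s ! j) (subst_tm ?s (F j) \<cdot> ?n \<cdot> k) (k \<cdot>* map (\<lambda>Y. subst_tm ?s Y \<cdot> ?n) Ys)"
      if "j < ?l" "k \<Colon> \<kappa> j" for j k
    proof (rule A_E[OF _ that(2)])
      \<comment> \<open>Lifting a hypothesis over the quantifier of \<open>A i\<close> amounts to
        instantiating its induction variable at the lifted variable \<open>?n\<close>, so
        \<open>A_E\<close> applies to the lifted hypotheses.\<close>
      have "scons N ?n ?s = shift (\<kappa> i)"
        unfolding lift_tm_def comp_scons[symmetric] by simp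
      then show "?\<Gamma> \<tturnstile> subst (scons N ?n ?s) (A j)"
        using that(1) by (auto simp: lift_def intro: Assm)
    qed
    have n: "?n \<Colon> N" "Succ \<cdot> ?n \<Colon> N" and s: "wts ?s" by (simp, rule has_ty_App[of _ N], simp_all)
    have "?\<Gamma> \<tturnstile> Eq (\<tau>s ! j) (subst_tm ?s (F j) \<cdot> (Succ \<cdot> ?n) \<cdot> k) (k \<cdot>* ?us ?s ?n)"
      if "j < ?l" "k \<Colon> \<kappa> j" for j k
      using that s n by (intro step IH)
    from stage[OF s n(2) us_ty[OF s n(1)] this] i(1)
    have "?\<Gamma> \<tturnstile> Eq (\<tau>s ! i) (subst_tm ?s (F i) \<cdot> (Succ \<cdot> ?n) \<cdot> Var (\<kappa> i) 0)
        (Var (\<kappa> i) 0 \<cdot>* map (\<lambda>Y. subst_tm ?s Y \<cdot> (Succ \<cdot> ?n)) Ys)"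
      by simp
    then show "?As \<tturnstile> subst (scons N (Succ \<cdot> Var N 0) (shift N)) B"
      unfolding i by (intro A_I) simp
  qed
  then have all: "\<Gamma> \<tturnstile> Eq (\<tau>s ! j) (subst_tm s (F j) \<cdot> n \<cdot> k) (k \<cdot>* map (\<lambda>Y. subst_tm s Y \<cdot> n) Ys)"
    if "j < ?l" "k \<Colon> \<kappa> j" "wts s" "n \<Colon> N" for \<Gamma> s n j k
    by (rule A_E[OF provable_weaken[OF provable_subst]]) (use that in auto)
  show thesis
  proof (rule that[OF Ys_ty])
    fix s i and \<Gamma> :: "fm list" assume *: "wts s" "i < ?l"
    have "length xs = ?l" using xs by (rule list_all2_lengthD)
    then show "\<Gamma> \<tturnstile> Eq (\<tau>s ! i) (subst_tm s (Ys ! i) \<cdot> Zero) (subst_tm s (xs ! i))"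
      using stage[of s Zero "map (subst_tm s) xs" \<Gamma>] F0 xs * by (auto simp: Ys_def)
    fix n assume n: "n \<Colon> N"
    have n': "Succ \<cdot> n \<Colon> N" using n by (auto intro: has_ty_App has_ty_const)
    have "\<Gamma> \<tturnstile> Eq (\<tau>s ! j) (subst_tm s (F j) \<cdot> (Succ \<cdot> n) \<cdot> k) (k \<cdot>* ?us s n)"
      if "j < ?l" "k \<Colon> \<kappa> j" for j k
      using that * n by (intro step all)
    from stage[OF *(1) n' us_ty[OF *(1) n] this] *(2)
    have "\<Gamma> \<tturnstile> Eq (\<tau>s ! i) (subst_tm s (Y i) \<cdot> (Succ \<cdot> n)) (?us s n ! i)" by blast
    moreover have "length us = ?l" using list_all2_lengthD[OF us] by simp
    ultimately show "\<Gamma> \<tturnstile> Eq (\<tau>s ! i) (subst_tm s (Ys ! i) \<cdot> (Succ \<cdot> n)) (subst_tm s (us ! i) \<cdot> n \<cdot>* map (\<lambda>Y. subst_tm s Y \<cdot> n) Ys)"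
      using * by (simp add: Ys_def)
  qed
qed

end
section \<open>Soundness\<close>

text \<open>Iterated lifting is one well-typed substitution, so facts about arbitrary substitutions
  apply to it. The last conjunct says that instantiating a lifted block at its own variables changes
  nothing; it is \<open>scons_Var_shift\<close> for blocks.\<close>

lemma ex_shifts:
  "\<exists>r. wts r \<and> (\<forall>t. lifts_tm \<sigma>s t = subst_tm r t) \<and> (\<forall>A. lifts \<sigma>s A = subst r A) \<and> sconses \<sigma>s (bvars \<sigma>s) r = Var"
proof (induction \<sigma>s)
  case Nil
  show ?case by (intro exI[of _ Var]) auto
next
  case (Cons \<sigma> \<sigma>s)
  then obtain r where r: "wts r" "\<And>t. lifts_tm \<sigma>s t = subst_tm r t" "\<And>A. lifts \<sigma>s A = subst r A"
    "sconses \<sigma>s (bvars \<sigma>s) r = Var" by blast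
  then show ?case by (intro exI[of _ "tail \<sigma> r"]) simp
qed

lemma atomic_ex_free: "atomic A \<Longrightarrow> ex_free A"
  by (cases A) auto

section \<open>Realizability of sequents and the rules of logic\<close>

abbreviation hyps :: "sub \<Rightarrow> fm list \<Rightarrow> tm list list \<Rightarrow> fm list" where
  "hyps s \<Gamma> rss \<equiv> map2 (\<lambda>G rs. hr (subst s G) rs) \<Gamma> rss"

abbreviation realizer_tys :: "tm list list \<Rightarrow> fm list \<Rightarrow> bool" where
  "realizer_tys rss \<Gamma> \<equiv> list_all2 (\<lambda>rs G. rs \<Colon>* hr_tys G) rss \<Gamma>"

lemma subst_hyps:
  assumes "realizer_tys rss \<Gamma>"
  shows "map (subst r) (hyps s \<Gamma> rss) = hyps (r \<odot> s) \<Gamma> (map (map (subst_tm r)) rss)"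
  using assms by induction (auto simp: subst_hr subst_subst dest: list_all2_lengthD)

lemma lift_hyps:
  assumes "realizer_tys rss \<Gamma>"
  shows "map (lift \<sigma>) (hyps s \<Gamma> rss) = hyps (under \<sigma> s) (map (lift \<sigma>) \<Gamma>) (map (map (lift_tm \<sigma>)) rss)"
  using assms by induction (auto simp: lift_hr lift_subst dest: list_all2_lengthD)

lemma realizer_tys_subst: "wts r \<Longrightarrow> realizer_tys rss \<Gamma> \<Longrightarrow> realizer_tys (map (map (subst_tm r)) rss) \<Gamma>"
  by (auto simp: list_all2_map1)

lemma realizer_tys_lift: "realizer_tys rss \<Gamma> \<Longrightarrow> realizer_tys (map (map (lift_tm \<sigma>)) rss) (map (lift \<sigma>) \<Gamma>)"
  by (auto simp: list_all2_map1 list_all2_map2)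

context ha_theory
begin

text \<open>Quantifying over \<open>s\<close> makes the notion stable under lifting, which the rules
  with eigenvariables and the abstraction over block variables need. The terms \<open>ts\<close> may
  depend on \<open>s\<close> and \<open>rss\<close>: uniformity is not demanded here but obtained by
  taking variables among the \<open>rss\<close>.\<close>

definition realizable :: "fm list \<Rightarrow> fm \<Rightarrow> bool" where
  "realizable \<Gamma> A \<longleftrightarrow> (\<forall>s rss. wts s \<longrightarrow> realizer_tys rss \<Gamma> \<longrightarrow>
    (\<exists>ts. ts \<Colon>* hr_tys A \<and> hyps s \<Gamma> rss \<tturnstile> hr (subst s A) ts))"

lemma realizableD:
  assumes "realizable \<Gamma> A" "wts s" "realizer_tys rss \<Gamma>"
  obtains ts where "ts \<Colon>* hr_tys A" "hyps s \<Gamma> rss \<tturnstile> hr (subst s A) ts"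
  using assms unfolding realizable_def by blast

lemma realizableI:
  assumes "\<And>s rss. wts s \<Longrightarrow> realizer_tys rss \<Gamma> \<Longrightarrow> \<exists>ts. ts \<Colon>* hr_tys A \<and> hyps s \<Gamma> rss \<tturnstile> hr (subst s A) ts"
  shows "realizable \<Gamma> A"
  using assms unfolding realizable_def by blast

text \<open>Turns terms that use the variables of a block into functions outside it. An inclusion is
  all that \<open>hr_mono\<close> asks for. One-element blocks serve for \<open>AllI\<close> and
  \<open>ExE\<close>, the block of all realizer types of the premise for
  \<open>ImpI\<close>.\<close>

lemma ex_abstraction:
  assumes "ts' \<Colon>* \<tau>s"
  obtains ts where "ts \<Colon>* map (\<lambda>\<tau>. \<sigma>s \<rightarrow>* \<tau>) \<tau>s"
    "\<And>\<Gamma> i. i < length \<tau>s \<Longrightarrow> \<Gamma> \<tturnstile> le (\<tau>s ! i) (ts' ! i) (lifts_tm \<sigma>s (ts ! i) \<cdot>* bvars \<sigma>s)"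
proof -
  obtain r where r: "wts r" "\<And>t. lifts_tm \<sigma>s t = subst_tm r t" "sconses \<sigma>s (bvars \<sigma>s) r = Var"
    using ex_shifts[of \<sigma>s] by blast
  have "\<exists>c. c \<Colon> \<sigma>s \<rightarrow>* \<tau>s ! i \<and> (\<forall>\<Gamma>. \<Gamma> \<tturnstile> le (\<tau>s ! i) (ts' ! i) (lifts_tm \<sigma>s c \<cdot>* bvars \<sigma>s))" if i: "i < length \<tau>s" for i
  proof -
    obtain c where c: "c \<Colon> \<sigma>s \<rightarrow>* \<tau>s ! i"
      "\<And>\<Gamma>. \<Gamma> \<tturnstile> Eq (\<tau>s ! i) (subst_tm r c \<cdot>* bvars \<sigma>s) (subst_tm (sconses \<sigma>s (bvars \<sigma>s) r) (ts' ! i))"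
      using lams_ex[OF nth_has_ty[OF assms i], of \<sigma>s] r(1) has_tys_bvars by blast
    have "subst_tm r c \<cdot>* bvars \<sigma>s \<Colon> \<tau>s ! i" using c(1) r(1) by (intro has_ty_Apps[of _ \<sigma>s]) auto
    then have "\<Gamma> \<tturnstile> le (\<tau>s ! i) (ts' ! i) (lifts_tm \<sigma>s c \<cdot>* bvars \<sigma>s)" for \<Gamma>
      using c(2)[of \<Gamma>] nth_has_ty[OF assms i] r by (intro Eq_sym_le) auto
    with c(1) show ?thesis by blast
  qed
  then obtain ts where "length ts = length \<tau>s" "\<forall>i<length \<tau>s. ts ! i \<Colon> \<sigma>s \<rightarrow>* \<tau>s ! i \<and>
      (\<forall>\<Gamma>. \<Gamma> \<tturnstile> le (\<tau>s ! i) (ts' ! i) (lifts_tm \<sigma>s (ts ! i) \<cdot>* bvars \<sigma>s))"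
    using Skolem_list_nth[of "length \<tau>s" "\<lambda>i c. c \<Colon> \<sigma>s \<rightarrow>* \<tau>s ! i \<and>
      (\<forall>\<Gamma>. \<Gamma> \<tturnstile> le (\<tau>s ! i) (ts' ! i) (lifts_tm \<sigma>s c \<cdot>* bvars \<sigma>s))"] by auto
  then show thesis by (intro that[of ts]) (auto simp: list_all2_conv_all_nth)
qed

lemma ex_family_upper_bounds:
  assumes "fs \<Colon>* map (\<lambda>\<tau>. \<sigma> \<rightarrow> \<tau>) \<tau>s" "Z \<Colon> Star \<sigma>" "\<And>\<tau>. \<tau> \<in> set \<tau>s \<Longrightarrow> end_star \<tau>"
  obtains cs where "cs \<Colon>* \<tau>s"
    "\<And>\<Gamma> i. i < length \<tau>s \<Longrightarrow> \<Gamma> \<tturnstile> Mem \<sigma> (Var \<sigma> 0) (lift_tm \<sigma> Z) \<Longrightarrow>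
      \<Gamma> \<tturnstile> le (\<tau>s ! i) (lift_tm \<sigma> (fs ! i) \<cdot> Var \<sigma> 0) (lift_tm \<sigma> (cs ! i))"
proof -
  have "\<exists>c. c \<Colon> \<tau>s ! i \<and> (\<forall>\<Gamma>. \<Gamma> \<tturnstile> Mem \<sigma> (Var \<sigma> 0) (lift_tm \<sigma> Z) \<longrightarrow>
      \<Gamma> \<tturnstile> le (\<tau>s ! i) (lift_tm \<sigma> (fs ! i) \<cdot> Var \<sigma> 0) (lift_tm \<sigma> c))" if i: "i < length \<tau>s" for i
  proof -
    have "fs ! i \<Colon> \<sigma> \<rightarrow> \<tau>s ! i" using nth_has_ty[OF assms(1), of i] i by simp
    then show ?thesis
      using ex_family_upper_bound[of "\<tau>s ! i" Z \<sigma> "fs ! i"] assms(2,3) i unfolding lift_tm_def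
      by (metis has_ty_Var_iff nth_mem wts_shift)
  qed
  then obtain cs where "length cs = length \<tau>s" "\<forall>i<length \<tau>s. cs ! i \<Colon> \<tau>s ! i \<and>
      (\<forall>\<Gamma>. \<Gamma> \<tturnstile> Mem \<sigma> (Var \<sigma> 0) (lift_tm \<sigma> Z) \<longrightarrow>
      \<Gamma> \<tturnstile> le (\<tau>s ! i) (lift_tm \<sigma> (fs ! i) \<cdot> Var \<sigma> 0) (lift_tm \<sigma> (cs ! i)))"
    using Skolem_list_nth[of "length \<tau>s" "\<lambda>i c. c \<Colon> \<tau>s ! i \<and> (\<forall>\<Gamma>. \<Gamma> \<tturnstile> Mem \<sigma> (Var \<sigma> 0) (lift_tm \<sigma> Z) \<longrightarrow>
      \<Gamma> \<tturnstile> le (\<tau>s ! i) (lift_tm \<sigma> (fs ! i) \<cdot> Var \<sigma> 0) (lift_tm \<sigma> c))"] by auto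
  then show thesis by (intro that[of cs]) (auto simp: list_all2_conv_all_nth)
qed

lemma ex_upper_bounds:
  assumes "ts \<Colon>* \<tau>s" "us \<Colon>* \<tau>s" "\<And>\<tau>. \<tau> \<in> set \<tau>s \<Longrightarrow> end_star \<tau>"
  obtains cs where "cs \<Colon>* \<tau>s"
    "\<And>\<Gamma> i. i < length \<tau>s \<Longrightarrow> \<Gamma> \<tturnstile> le (\<tau>s ! i) (ts ! i) (cs ! i)"
    "\<And>\<Gamma> i. i < length \<tau>s \<Longrightarrow> \<Gamma> \<tturnstile> le (\<tau>s ! i) (us ! i) (cs ! i)"
proof -
  have "\<exists>c. c \<Colon> \<tau>s ! i \<and> [] \<tturnstile> le (\<tau>s ! i) (ts ! i) c \<and> [] \<tturnstile> le (\<tau>s ! i) (us ! i) c" if i: "i < length \<tau>s" for i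
    using nth_has_ty[OF assms(1) i] nth_has_ty[OF assms(2) i] assms(3) i by (intro ex_upper_bound) auto
  then obtain cs where "length cs = length \<tau>s" "\<forall>i<length \<tau>s. cs ! i \<Colon> \<tau>s ! i \<and>
      [] \<tturnstile> le (\<tau>s ! i) (ts ! i) (cs ! i) \<and> [] \<tturnstile> le (\<tau>s ! i) (us ! i) (cs ! i)"
    using Skolem_list_nth[of "length \<tau>s" "\<lambda>i c. c \<Colon> \<tau>s ! i \<and>
      [] \<tturnstile> le (\<tau>s ! i) (ts ! i) c \<and> [] \<tturnstile> le (\<tau>s ! i) (us ! i) c"] by auto
  then show thesis by (intro that[of cs]) (auto simp: list_all2_conv_all_nth intro: provable_weaken)
qed

lemma realizable_Assm:
  assumes "A \<in> set \<Gamma>"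
  shows "realizable \<Gamma> A"
proof (rule realizableI)
  fix s rss assume *: "wts s" "realizer_tys rss \<Gamma>"
  obtain i where i: "i < length \<Gamma>" "A = \<Gamma> ! i" using assms by (metis in_set_conv_nth)
  have l: "length rss = length \<Gamma>" using * by (auto dest: list_all2_lengthD)
  then have "hyps s \<Gamma> rss ! i = hr (subst s A) (rss ! i)" using i by simp
  then have "hr (subst s A) (rss ! i) \<in> set (hyps s \<Gamma> rss)"
    using i l by (metis length_map length_zip min.idem nth_mem)
  moreover have "rss ! i \<Colon>* hr_tys A" using list_all2_nthD2[OF *(2) i(1)] i by simp
  ultimately show "\<exists>ts. ts \<Colon>* hr_tys A \<and> hyps s \<Gamma> rss \<tturnstile> hr (subst s A) ts"
    by (blast intro: Assm)
qed

lemma realizable_BotE: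
  assumes "realizable \<Gamma> Bot" "wff A"
  shows "realizable \<Gamma> A"
proof (rule realizableI)
  fix s rss assume *: "wts s" "realizer_tys rss \<Gamma>"
  obtain ts where "ts \<Colon>* hr_tys A" using ex_has_tys by blast
  moreover have "hyps s \<Gamma> rss \<tturnstile> Bot" using realizableD[OF assms(1) *] by auto
  ultimately show "\<exists>ts. ts \<Colon>* hr_tys A \<and> hyps s \<Gamma> rss \<tturnstile> hr (subst s A) ts"
    using assms(2) * by (intro exI[of _ ts]) (auto intro!: BotE wff_hr)
qed

lemma realizable_AndI:
  assumes "realizable \<Gamma> A" "realizable \<Gamma> B"
  shows "realizable \<Gamma> (A \<^bold>\<and> B)"
proof (rule realizableI)
  fix s rss assume *: "wts s" "realizer_tys rss \<Gamma>"
  obtain ts where "ts \<Colon>* hr_tys A" "hyps s \<Gamma> rss \<tturnstile> hr (subst s A) ts" using realizableD[OF assms(1) *] .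
  moreover obtain us where "us \<Colon>* hr_tys B" "hyps s \<Gamma> rss \<tturnstile> hr (subst s B) us" using realizableD[OF assms(2) *] .
  moreover from calculation(1) have "length ts = length (hr_tys A)" by (rule list_all2_lengthD)
  ultimately show "\<exists>ts. ts \<Colon>* hr_tys (A \<^bold>\<and> B) \<and> hyps s \<Gamma> rss \<tturnstile> hr (subst s (A \<^bold>\<and> B)) ts"
    by (intro exI[of _ "ts @ us"]) (auto intro: AndI list_all2_appendI)
qed

lemma realizable_AndE:
  assumes "realizable \<Gamma> (A \<^bold>\<and> B)"
  shows "realizable \<Gamma> A" "realizable \<Gamma> B"
proof -
  have "\<exists>ts us. ts \<Colon>* hr_tys A \<and> us \<Colon>* hr_tys B \<and> hyps s \<Gamma> rss \<tturnstile> hr (subst s A) ts \<^bold>\<and> hr (subst s B) us"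
    if *: "wts s" "realizer_tys rss \<Gamma>" for s rss
  proof -
    obtain ts where "ts \<Colon>* hr_tys (A \<^bold>\<and> B)" "hyps s \<Gamma> rss \<tturnstile> hr (subst s (A \<^bold>\<and> B)) ts"
      using realizableD[OF assms *] .
    then show ?thesis by (auto simp: list_all2_append_right)
  qed
  then show "realizable \<Gamma> A" "realizable \<Gamma> B"
    unfolding realizable_def by (blast intro: AndE1 AndE2)+
qed

text \<open>The tuple needs entries for the other disjunct too; arbitrary terms of the right types
  will do, as the translated disjunction is proved through its first disjunct.\<close>

lemma realizable_OrI1:
  assumes "realizable \<Gamma> A" "wff B"
  shows "realizable \<Gamma> (A \<^bold>\<or> B)"
proof (rule realizableI)
  fix s rss assume *: "wts s" "realizer_tys rss \<Gamma>"
  obtain ts where "ts \<Colon>* hr_tys A" "hyps s \<Gamma> rss \<tturnstile> hr (subst s A) ts" using realizableD[OF assms(1) *] .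
  moreover obtain us where "us \<Colon>* hr_tys B" using ex_has_tys by blast
  moreover from calculation(1) have "length ts = length (hr_tys A)" by (rule list_all2_lengthD)
  ultimately show "\<exists>ts. ts \<Colon>* hr_tys (A \<^bold>\<or> B) \<and> hyps s \<Gamma> rss \<tturnstile> hr (subst s (A \<^bold>\<or> B)) ts"
    using assms(2) *(1)
    by (intro exI[of _ "ts @ us"]) (auto intro!: OrI1 wff_hr list_all2_appendI)
qed

lemma realizable_OrI2:
  assumes "realizable \<Gamma> B" "wff A"
  shows "realizable \<Gamma> (A \<^bold>\<or> B)"
proof (rule realizableI)
  fix s rss assume *: "wts s" "realizer_tys rss \<Gamma>"
  obtain us where "us \<Colon>* hr_tys B" "hyps s \<Gamma> rss \<tturnstile> hr (subst s B) us" using realizableD[OF assms(1) *] .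
  moreover obtain ts where "ts \<Colon>* hr_tys A" using ex_has_tys by blast
  moreover from this have "length ts = length (hr_tys A)" by (rule list_all2_lengthD)
  ultimately show "\<exists>ts. ts \<Colon>* hr_tys (A \<^bold>\<or> B) \<and> hyps s \<Gamma> rss \<tturnstile> hr (subst s (A \<^bold>\<or> B)) ts"
    using assms(2) *(1)
    by (intro exI[of _ "ts @ us"]) (auto intro!: OrI2 wff_hr list_all2_appendI)
qed

text \<open>The realizers of the disjunction do not reveal which disjunct holds, so neither
  \<open>cs\<close> nor \<open>ds\<close> can be selected; their common bound \<open>es\<close>
  works in both cases.\<close>

lemma realizable_OrE:
  assumes "realizable \<Gamma> (A \<^bold>\<or> B)" "realizable (A # \<Gamma>) C" "realizable (B # \<Gamma>) C" "wff C"
  shows "realizable \<Gamma> C"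
proof (rule realizableI)
  fix s rss assume *: "wts s" "realizer_tys rss \<Gamma>"
  obtain vs where "vs \<Colon>* hr_tys (A \<^bold>\<or> B)" "hyps s \<Gamma> rss \<tturnstile> hr (subst s (A \<^bold>\<or> B)) vs"
    using realizableD[OF assms(1) *] .
  then obtain ts us where ty: "ts \<Colon>* hr_tys A" "us \<Colon>* hr_tys B"
    and or: "hyps s \<Gamma> rss \<tturnstile> hr (subst s A) ts \<^bold>\<or> hr (subst s B) us"
    by (auto simp: list_all2_append_right)
  obtain cs where cs: "cs \<Colon>* hr_tys C" "hr (subst s A) ts # hyps s \<Gamma> rss \<tturnstile> hr (subst s C) cs"
    using realizableD[OF assms(2) *(1), of "ts # rss"] * ty by auto
  obtain ds where ds: "ds \<Colon>* hr_tys C" "hr (subst s B) us # hyps s \<Gamma> rss \<tturnstile> hr (subst s C) ds"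
    using realizableD[OF assms(3) *(1), of "us # rss"] * ty by auto
  obtain es where es: "es \<Colon>* hr_tys C"
    "\<And>\<Gamma> i. i < length (hr_tys C) \<Longrightarrow> \<Gamma> \<tturnstile> le (hr_tys C ! i) (cs ! i) (es ! i)"
    "\<And>\<Gamma> i. i < length (hr_tys C) \<Longrightarrow> \<Gamma> \<tturnstile> le (hr_tys C ! i) (ds ! i) (es ! i)"
    by (rule ex_upper_bounds[OF cs(1) ds(1) end_star_hr_tys]) auto
  have "hyps s \<Gamma> rss \<tturnstile> hr (subst s C) es"
    by (rule OrE[OF or hr_mono[OF cs(2)] hr_mono[OF ds(2)]]) (use cs(1) ds(1) es assms(4) *(1) in auto)
  with es(1) show "\<exists>ts. ts \<Colon>* hr_tys C \<and> hyps s \<Gamma> rss \<tturnstile> hr (subst s C) ts" by blast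
qed

lemma realizable_ImpI:
  assumes "realizable (A # \<Gamma>) B" "wff A" "wff B"
  shows "realizable \<Gamma> (A \<^bold>\<longrightarrow> B)"
proof (rule realizableI)
  fix s rss assume *: "wts s" "realizer_tys rss \<Gamma>"
  let ?\<sigma>s = "hr_tys A"
  let ?xs = "bvars ?\<sigma>s"
  obtain r where r: "wts r" "\<And>t. lifts_tm ?\<sigma>s t = subst_tm r t" "\<And>A. lifts ?\<sigma>s A = subst r A"
    using ex_shifts[of ?\<sigma>s] by blast
  let ?\<Delta> = "hr (subst (r \<odot> s) A) ?xs # map (lifts ?\<sigma>s) (hyps s \<Gamma> rss)"
  \<comment> \<open>The lifted context is again a list of realized assumptions, for the substitution
    \<open>r \<odot> s\<close> and the lifted realizers. Hence the hypothesis applies with the block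
    variables as realizers of the new assumption.\<close>
  have eq: "map (lifts ?\<sigma>s) (hyps s \<Gamma> rss) = hyps (r \<odot> s) \<Gamma> (map (map (subst_tm r)) rss)"
    using subst_hyps[OF *(2), of r s] r(3) by (metis ext)
  obtain ts' where ts': "ts' \<Colon>* hr_tys B" "?\<Delta> \<tturnstile> hr (subst (r \<odot> s) B) ts'"
    using realizableD[OF assms(1), of "r \<odot> s" "?xs # map (map (subst_tm r)) rss"]
      * r(1) realizer_tys_subst[OF r(1) *(2)] unfolding eq by auto
  obtain ts where ts: "ts \<Colon>* map (\<lambda>\<tau>. ?\<sigma>s \<rightarrow>* \<tau>) (hr_tys B)"
    "\<And>\<Gamma> i. i < length (hr_tys B) \<Longrightarrow> \<Gamma> \<tturnstile> le (hr_tys B ! i) (ts' ! i) (lifts_tm ?\<sigma>s (ts ! i) \<cdot>* ?xs)"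
    using ex_abstraction[OF ts'(1)] by blast
  let ?ts = "map (\<lambda>t. lifts_tm ?\<sigma>s t \<cdot>* ?xs) ts"
  have l: "length ts = length (hr_tys B)" using list_all2_lengthD[OF ts(1)] by simp
  have ty: "?ts \<Colon>* hr_tys B"
    using has_tys_Apps[of "map (lifts_tm ?\<sigma>s) ts" ?\<sigma>s "hr_tys B" ?xs] ts(1)
    by (simp add: list_all2_map1 comp_def)
  have "?\<Delta> \<tturnstile> hr (subst (r \<odot> s) B) ?ts"
    by (rule hr_mono[OF ts'(2)]) (use assms(3) * r(1) ts'(1) ts(2) ty l in auto)
  then have "hyps s \<Gamma> rss \<tturnstile> hr (subst s (A \<^bold>\<longrightarrow> B)) ts"
    using assms(2) * r(1) by (auto simp: Let_def r(3) subst_subst intro!: AllsI ImpI wff_hr)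
  with ts(1) show "\<exists>ts. ts \<Colon>* hr_tys (A \<^bold>\<longrightarrow> B) \<and> hyps s \<Gamma> rss \<tturnstile> hr (subst s (A \<^bold>\<longrightarrow> B)) ts" by auto
qed

lemma realizable_ImpE:
  assumes "realizable \<Gamma> (A \<^bold>\<longrightarrow> B)" "realizable \<Gamma> A"
  shows "realizable \<Gamma> B"
proof (rule realizableI)
  fix s rss assume *: "wts s" "realizer_tys rss \<Gamma>"
  obtain ts where ts: "ts \<Colon>* map (\<lambda>\<tau>. hr_tys A \<rightarrow>* \<tau>) (hr_tys B)" "hyps s \<Gamma> rss \<tturnstile> hr (subst s A \<^bold>\<longrightarrow> subst s B) ts"
    using realizableD[OF assms(1) *] by (metis hr_tys.simps(6) subst.simps(6))
  obtain us where us: "us \<Colon>* hr_tys A" "hyps s \<Gamma> rss \<tturnstile> hr (subst s A) us" using realizableD[OF assms(2) *] .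
  show "\<exists>ts. ts \<Colon>* hr_tys B \<and> hyps s \<Gamma> rss \<tturnstile> hr (subst s B) ts"
    using hr_ImpE[OF ts(2) us(2)] us(1) has_tys_Apps[OF ts(1) us(1)] list_all2_lengthD[OF ts(1)] by auto
qed

lemma realizable_AllI:
  assumes "realizable (map (lift \<sigma>) \<Gamma>) A" "wff A"
  shows "realizable \<Gamma> (All \<sigma> A)"
proof (rule realizableI)
  fix s rss assume *: "wts s" "realizer_tys rss \<Gamma>"
  obtain ts' where ts': "ts' \<Colon>* hr_tys A" "map (lift \<sigma>) (hyps s \<Gamma> rss) \<tturnstile> hr (subst (under \<sigma> s) A) ts'"
    using realizableD[OF assms(1) wts_under realizer_tys_lift] * unfolding lift_hyps[OF *(2)] by blast
  obtain ts where ts: "ts \<Colon>* map (\<lambda>\<tau>. \<sigma> \<rightarrow> \<tau>) (hr_tys A)"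
    "\<And>\<Gamma> i. i < length (hr_tys A) \<Longrightarrow> \<Gamma> \<tturnstile> le (hr_tys A ! i) (ts' ! i) (lift_tm \<sigma> (ts ! i) \<cdot> Var \<sigma> 0)"
    using ex_abstraction[OF ts'(1), of "[\<sigma>]"] by auto
  let ?ts = "map (\<lambda>t. lift_tm \<sigma> t \<cdot> Var \<sigma> 0) ts"
  have l: "length ts = length (hr_tys A)" using list_all2_lengthD[OF ts(1)] by simp
  have ty: "?ts \<Colon>* hr_tys A"
    using has_tys_App[of "map (lift_tm \<sigma>) ts" \<sigma> "hr_tys A" "Var \<sigma> 0"] ts(1) by (simp add: comp_def)
  have "map (lift \<sigma>) (hyps s \<Gamma> rss) \<tturnstile> hr (subst (under \<sigma> s) A) ?ts"
    by (rule hr_mono[OF ts'(2)]) (use assms(2) * ts'(1) ts(2) ty l in auto)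
  then have "hyps s \<Gamma> rss \<tturnstile> hr (subst s (All \<sigma> A)) ts"
    by (simp add: AllI)
  with ts(1) show "\<exists>ts. ts \<Colon>* hr_tys (All \<sigma> A) \<and> hyps s \<Gamma> rss \<tturnstile> hr (subst s (All \<sigma> A)) ts" by auto
qed

lemma realizable_AllE:
  assumes "realizable \<Gamma> (All \<sigma> A)" "t \<Colon> \<sigma>"
  shows "realizable \<Gamma> (inst \<sigma> t A)"
proof (rule realizableI)
  fix s rss assume *: "wts s" "realizer_tys rss \<Gamma>"
  obtain ts where ts: "ts \<Colon>* map (\<lambda>\<tau>. \<sigma> \<rightarrow> \<tau>) (hr_tys A)" "hyps s \<Gamma> rss \<tturnstile> hr (All \<sigma> (subst (under \<sigma> s) A)) ts"
    using realizableD[OF assms(1) *] by (metis hr_tys.simps(7) subst.simps(7))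
  have t: "subst_tm s t \<Colon> \<sigma>" using assms(2) * by simp
  show "\<exists>ts. ts \<Colon>* hr_tys (inst \<sigma> t A) \<and> hyps s \<Gamma> rss \<tturnstile> hr (subst s (inst \<sigma> t A)) ts"
    using hr_AllE[OF ts(2) t] has_tys_App[OF ts(1) t] list_all2_lengthD[OF ts(1)] by (auto simp: subst_inst)
qed

lemma realizable_ExI:
  assumes "realizable \<Gamma> (inst \<sigma> t A)" "t \<Colon> \<sigma>" "wff A"
  shows "realizable \<Gamma> (Ex \<sigma> A)"
proof (rule realizableI)
  fix s rss assume *: "wts s" "realizer_tys rss \<Gamma>"
  obtain ts where ts: "ts \<Colon>* hr_tys A" "hyps s \<Gamma> rss \<tturnstile> hr (subst (scons \<sigma> (subst_tm s t) s) A) ts"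
    using realizableD[OF assms(1) *] by (auto simp: subst_inst)
  have t: "subst_tm s t \<Colon> \<sigma>" using assms(2) * by simp
  let ?H = "hr (subst (under \<sigma> s) A) (map (lift_tm \<sigma>) ts)"
  have "inst \<sigma> (subst_tm s t) ?H = hr (subst (scons \<sigma> (subst_tm s t) s) A) ts"
    using list_all2_lengthD[OF ts(1)] by (simp add: inst_hr comp_def)
  then have "hyps s \<Gamma> rss \<tturnstile> BEx \<sigma> (Sing \<sigma> \<cdot> subst_tm s t) ?H"
    using ts assms(3) * t by (intro BExI[of _ _ "subst_tm s t"] Mem_Sing) (auto intro: has_ty_App has_ty_const intro!: wff_hr)
  then show "\<exists>ts. ts \<Colon>* hr_tys (Ex \<sigma> A) \<and> hyps s \<Gamma> rss \<tturnstile> hr (subst s (Ex \<sigma> A)) ts"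
    using ts(1) t by (intro exI[of _ "(Sing \<sigma> \<cdot> subst_tm s t) # ts"]) (auto intro: has_ty_App has_ty_const)
qed

text \<open>The hypothesis yields realizers of \<open>C\<close> that may depend on the
  eigenvariable, which must not occur in the result. They are abstracted to functions
  \<open>fs\<close> of the witness and bounded over the candidate set \<open>Z\<close> by
  \<open>cs\<close>. The bound may be used because eliminating the translated \<open>BEx\<close>
  supplies membership of the witness in \<open>Z\<close>.\<close>

lemma realizable_ExE:
  assumes "realizable \<Gamma> (Ex \<sigma> A)" "realizable (A # map (lift \<sigma>) \<Gamma>) (lift \<sigma> C)" "wff A" "wff C"
  shows "realizable \<Gamma> C"
proof (rule realizableI)
  fix s rss assume *: "wts s" "realizer_tys rss \<Gamma>"
  obtain vs where "vs \<Colon>* hr_tys (Ex \<sigma> A)" "hyps s \<Gamma> rss \<tturnstile> hr (subst s (Ex \<sigma> A)) vs"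
    using realizableD[OF assms(1) *] .
  then obtain Z xs where Z: "Z \<Colon> Star \<sigma>" "xs \<Colon>* hr_tys A"
    and ex: "hyps s \<Gamma> rss \<tturnstile> BEx \<sigma> Z (hr (subst (under \<sigma> s) A) (map (lift_tm \<sigma>) xs))" (is "_ \<tturnstile> BEx \<sigma> Z ?H")
    by (auto simp: list_all2_Cons2)
  let ?\<Delta> = "?H # map (lift \<sigma>) (hyps s \<Gamma> rss)" and ?M = "Mem \<sigma> (Var \<sigma> 0) (lift_tm \<sigma> Z)"
  let ?\<Delta>' = "?H # ?M # map (lift \<sigma>) (hyps s \<Gamma> rss)"
  obtain ts' where ts': "ts' \<Colon>* hr_tys C" "?\<Delta> \<tturnstile> hr (lift \<sigma> (subst s C)) ts'"
    using realizableD[OF assms(2), of "under \<sigma> s" "map (lift_tm \<sigma>) xs # map (map (lift_tm \<sigma>)) rss"]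
      * Z realizer_tys_lift[OF *(2)] unfolding lift_hyps[OF *(2)] by (auto simp: lift_subst)
  obtain fs where fs: "fs \<Colon>* map (\<lambda>\<tau>. \<sigma> \<rightarrow> \<tau>) (hr_tys C)"
    "\<And>\<Gamma> i. i < length (hr_tys C) \<Longrightarrow> \<Gamma> \<tturnstile> le (hr_tys C ! i) (ts' ! i) (lift_tm \<sigma> (fs ! i) \<cdot> Var \<sigma> 0)"
    using ex_abstraction[OF ts'(1), of "[\<sigma>]"] by auto
  obtain cs where cs: "cs \<Colon>* hr_tys C"
    "\<And>\<Gamma> i. i < length (hr_tys C) \<Longrightarrow> \<Gamma> \<tturnstile> ?M \<Longrightarrow>
      \<Gamma> \<tturnstile> le (hr_tys C ! i) (lift_tm \<sigma> (fs ! i) \<cdot> Var \<sigma> 0) (lift_tm \<sigma> (cs ! i))"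
    by (rule ex_family_upper_bounds[OF fs(1) Z(1) end_star_hr_tys]) auto
  have l: "length cs = length (hr_tys C)" using cs(1) by (rule list_all2_lengthD)
  have fs_ty: "map (\<lambda>f. lift_tm \<sigma> f \<cdot> Var \<sigma> 0) fs \<Colon>* hr_tys C"
    using has_tys_App[of "map (lift_tm \<sigma>) fs" \<sigma> "hr_tys C" "Var \<sigma> 0"] fs(1) by (simp add: comp_def)
  have lf: "length fs = length (hr_tys C)" using list_all2_lengthD[OF fs(1)] by simp
  have "?\<Delta>' \<tturnstile> hr (lift \<sigma> (subst s C)) ts'" using ts'(2) by (rule weaken) (simp only: list.set, blast)
  then have "?\<Delta>' \<tturnstile> hr (lift \<sigma> (subst s C)) (map (\<lambda>f. lift_tm \<sigma> f \<cdot> Var \<sigma> 0) fs)"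
    by (rule hr_mono) (use assms(4) * ts'(1) fs(2) fs_ty lf in auto)
  then have "?\<Delta>' \<tturnstile> hr (lift \<sigma> (subst s C)) (map (lift_tm \<sigma>) cs)"
    by (rule hr_mono) (use assms(4) * cs fs_ty lf l in \<open>simp_all add: Assm\<close>)
  then have "?\<Delta>' \<tturnstile> lift \<sigma> (hr (subst s C) cs)" using l by (simp add: lift_hr)
  then have "hyps s \<Gamma> rss \<tturnstile> hr (subst s C) cs"
    using ex Z assms(3) * by (intro BExE[OF ex]) (auto intro!: wff_hr)
  with cs(1) show "\<exists>ts. ts \<Colon>* hr_tys C \<and> hyps s \<Gamma> rss \<tturnstile> hr (subst s C) ts" by blast
qed

lemma realizable_ex_free:
  assumes "A \<in> Ax" "ex_free A"
  shows "realizable \<Gamma> A"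
proof (rule realizableI)
  fix s rss assume "wts s"
  then have "hyps s \<Gamma> rss \<tturnstile> subst s A"
    by (rule provable_weaken[OF provable_subst[OF Axiom[OF assms(1)]]])
  then show "\<exists>ts. ts \<Colon>* hr_tys A \<and> hyps s \<Gamma> rss \<tturnstile> hr (subst s A) ts"
    using hr_ex_free[of "subst s A"] assms(2) by auto
qed

end

section \<open>Realizers of the axioms and of the characteristic principles\<close>

lemma lift_quant:
  "lift \<sigma> (All \<tau> A) = All \<tau> (subst (under \<tau> (shift \<sigma>)) A)"
  "lift \<sigma> (BEx \<tau> t A) = BEx \<tau> (lift_tm \<sigma> t) (subst (under \<tau> (shift \<sigma>)) A)"
  by (simp_all add: lift_def lift_tm_def)

context ha_theory
begin

text \<open>A realizer of the bounded form is one tuple for all elements of \<open>t\<close>, while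
  the unbounded form has functions of the element. From left to right the tuple is used for every
  element; from right to left the functions are bounded over the finite set
  \<open>t\<close>.\<close>

lemma realizable_ball:
  assumes "t \<Colon> Star \<sigma>" "wff A"
  shows "realizable \<Gamma> (BAll \<sigma> t A \<^bold>\<longleftrightarrow> All \<sigma> (Mem \<sigma> (Var \<sigma> 0) (lift_tm \<sigma> t) \<^bold>\<longrightarrow> A))"
proof -
  let ?M = "Mem \<sigma> (Var \<sigma> 0) (lift_tm \<sigma> t)"
  \<comment> \<open>Only the body needs explicit realizers here; the quantifier and the implication
    are restored by \<open>realizable_AllI\<close> and \<open>realizable_ImpI\<close>.\<close>
  have "realizable (?M # map (lift \<sigma>) (BAll \<sigma> t A # \<Gamma>)) A"
  proof (rule realizableI)
    fix s rss assume *: "wts s" "realizer_tys rss (?M # map (lift \<sigma>) (BAll \<sigma> t A # \<Gamma>))"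
    then obtain ts rss' where rss: "rss = [] # ts # rss'" "ts \<Colon>* hr_tys A"
      by (auto simp: list_all2_Cons2 lift_def)
    let ?\<Delta> = "hyps s (?M # map (lift \<sigma>) (BAll \<sigma> t A # \<Gamma>)) rss"
    let ?t = "subst_tm (tail \<sigma> s) t" and ?H = "hr (subst (under \<sigma> (tail \<sigma> s)) A) (map (lift_tm \<sigma>) ts)"
    have "subst s (lift \<sigma> (BAll \<sigma> t A)) = BAll \<sigma> ?t (subst (under \<sigma> (tail \<sigma> s)) A)" by simp
    then have hyp: "?\<Delta> \<tturnstile> BAll \<sigma> ?t ?H" "?\<Delta> \<tturnstile> Mem \<sigma> (s \<sigma> 0) ?t"
      using rss by (auto intro!: Assm)
    have "s \<sigma> 0 \<Colon> \<sigma>" using * by (simp add: wts_def)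
    then have "?\<Delta> \<tturnstile> inst \<sigma> (s \<sigma> 0) ?H"
      using assms * rss by (intro BAllE[OF hyp]) (auto intro!: wff_hr)
    then have "?\<Delta> \<tturnstile> hr (subst s A) ts"
      using list_all2_lengthD[OF rss(2)] by (simp add: inst_hr comp_def)
    with rss(2) show "\<exists>ts. ts \<Colon>* hr_tys A \<and> ?\<Delta> \<tturnstile> hr (subst s A) ts" by blast
  qed
  then have "realizable (BAll \<sigma> t A # \<Gamma>) (All \<sigma> (?M \<^bold>\<longrightarrow> A))"
    using assms by (intro realizable_AllI realizable_ImpI) auto
  moreover have "realizable (All \<sigma> (?M \<^bold>\<longrightarrow> A) # \<Gamma>) (BAll \<sigma> t A)"
  proof (rule realizableI)
    fix s rss assume *: "wts s" "realizer_tys rss (All \<sigma> (?M \<^bold>\<longrightarrow> A) # \<Gamma>)"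
    then obtain fs rss' where rss: "rss = fs # rss'" "fs \<Colon>* map (\<lambda>\<tau>. \<sigma> \<rightarrow> \<tau>) (hr_tys A)"
      by (auto simp: list_all2_Cons2)
    let ?\<Delta> = "hyps s (All \<sigma> (?M \<^bold>\<longrightarrow> A) # \<Gamma>) rss"
    let ?t = "subst_tm s t" and ?fs = "map (\<lambda>f. lift_tm \<sigma> f \<cdot> Var \<sigma> 0) fs"
    let ?M' = "Mem \<sigma> (Var \<sigma> 0) (lift_tm \<sigma> ?t)"
    have t: "?t \<Colon> Star \<sigma>" using assms * by simp
    obtain cs where cs: "cs \<Colon>* hr_tys A"
      "\<And>\<Gamma> i. i < length (hr_tys A) \<Longrightarrow> \<Gamma> \<tturnstile> ?M' \<Longrightarrow>
        \<Gamma> \<tturnstile> le (hr_tys A ! i) (lift_tm \<sigma> (fs ! i) \<cdot> Var \<sigma> 0) (lift_tm \<sigma> (cs ! i))"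
      by (rule ex_family_upper_bounds[OF rss(2) t end_star_hr_tys]) auto
    have l: "length fs = length (hr_tys A)" "length cs = length (hr_tys A)"
      using list_all2_lengthD[OF rss(2)] list_all2_lengthD[OF cs(1)] by auto
    have fs_ty: "?fs \<Colon>* hr_tys A"
      using has_tys_App[of "map (lift_tm \<sigma>) fs" \<sigma> "hr_tys A" "Var \<sigma> 0"] rss(2) by (simp add: comp_def)
    have "?\<Delta> \<tturnstile> All \<sigma> (?M' \<^bold>\<longrightarrow> hr (subst (under \<sigma> s) A) ?fs)"
      using rss by (auto intro!: Assm simp: lift_tm_subst_tm comp_def)
    from deriv_lift_Var_E[OF deriv_lift[OF this]]
    have "map (lift \<sigma>) ?\<Delta> \<tturnstile> ?M' \<^bold>\<longrightarrow> hr (subst (under \<sigma> s) A) ?fs" .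
    then have "?M' # map (lift \<sigma>) ?\<Delta> \<tturnstile> ?M' \<^bold>\<longrightarrow> hr (subst (under \<sigma> s) A) ?fs"
      by (rule weaken) (simp only: list.set, blast)
    then have "?M' # map (lift \<sigma>) ?\<Delta> \<tturnstile> hr (subst (under \<sigma> s) A) ?fs"
      by (rule ImpE) (simp add: Assm)
    then have "?M' # map (lift \<sigma>) ?\<Delta> \<tturnstile> hr (subst (under \<sigma> s) A) (map (lift_tm \<sigma>) cs)"
      by (rule hr_mono) (use assms * fs_ty cs l in \<open>simp_all add: Assm\<close>)
    then have "?\<Delta> \<tturnstile> hr (subst s (BAll \<sigma> t A)) cs"
      using t assms * cs(1) by (auto intro!: BAllI wff_hr simp del: list.map map_map)
    with cs(1) show "\<exists>ts. ts \<Colon>* hr_tys (BAll \<sigma> t A) \<and> ?\<Delta> \<tturnstile> hr (subst s (BAll \<sigma> t A)) ts" by auto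
  qed
  ultimately show ?thesis using assms by (intro realizable_AndI realizable_ImpI) auto
qed

text \<open>The unbounded form has an additional set of candidates. From left to right
  \<open>t\<close> itself is that set; from right to left the set \<open>Z\<close> is dropped, as
  the translated body already says that the witness lies in \<open>t\<close>.\<close>

lemma realizable_bex:
  assumes "t \<Colon> Star \<sigma>" "wff A"
  shows "realizable \<Gamma> (BEx \<sigma> t A \<^bold>\<longleftrightarrow> Ex \<sigma> (Mem \<sigma> (Var \<sigma> 0) (lift_tm \<sigma> t) \<^bold>\<and> A))"
proof -
  let ?M = "Mem \<sigma> (Var \<sigma> 0) (lift_tm \<sigma> t)"
  have "realizable (BEx \<sigma> t A # \<Gamma>) (Ex \<sigma> (?M \<^bold>\<and> A))"
  proof (rule realizableI)
    fix s rss assume *: "wts s" "realizer_tys rss (BEx \<sigma> t A # \<Gamma>)"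
    then obtain ts rss' where rss: "rss = ts # rss'" "ts \<Colon>* hr_tys A"
      by (auto simp: list_all2_Cons2)
    let ?\<Delta> = "hyps s (BEx \<sigma> t A # \<Gamma>) rss"
    let ?t = "subst_tm s t" and ?H = "hr (subst (under \<sigma> s) A) (map (lift_tm \<sigma>) ts)"
    let ?M' = "Mem \<sigma> (Var \<sigma> 0) (lift_tm \<sigma> ?t)"
    have t: "?t \<Colon> Star \<sigma>" and H: "wff ?H" using assms * rss by (auto intro!: wff_hr)
    have ex: "?\<Delta> \<tturnstile> BEx \<sigma> ?t ?H" using rss by (auto intro!: Assm)
    have "?H # ?M' # map (lift \<sigma>) ?\<Delta> \<tturnstile> lift \<sigma> (BEx \<sigma> ?t (?M' \<^bold>\<and> ?H))"
      unfolding lift_quant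
      by (rule BExI[of _ _ "Var \<sigma> 0"]) (use t H in \<open>auto intro!: AndI intro: Assm simp del: subst.simps\<close>)
    then have "?\<Delta> \<tturnstile> BEx \<sigma> ?t (?M' \<^bold>\<and> ?H)"
      by (rule BExE[OF ex]) (fact t H)+
    then have "?\<Delta> \<tturnstile> hr (subst s (Ex \<sigma> (?M \<^bold>\<and> A))) (?t # ts)"
      by (simp add: lift_tm_subst_tm)
    then show "\<exists>ts. ts \<Colon>* hr_tys (Ex \<sigma> (?M \<^bold>\<and> A)) \<and> ?\<Delta> \<tturnstile> hr (subst s (Ex \<sigma> (?M \<^bold>\<and> A))) ts"
      using t rss(2) by (intro exI[of _ "?t # ts"]) (simp del: hr.simps subst.simps list.map)
  qed
  moreover have "realizable (Ex \<sigma> (?M \<^bold>\<and> A) # \<Gamma>) (BEx \<sigma> t A)"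
  proof (rule realizableI)
    fix s rss assume *: "wts s" "realizer_tys rss (Ex \<sigma> (?M \<^bold>\<and> A) # \<Gamma>)"
    then obtain Z ts rss' where rss: "rss = (Z # ts) # rss'" "Z \<Colon> Star \<sigma>" "ts \<Colon>* hr_tys A"
      by (auto simp: list_all2_Cons2)
    let ?\<Delta> = "hyps s (Ex \<sigma> (?M \<^bold>\<and> A) # \<Gamma>) rss"
    let ?t = "subst_tm s t" and ?H = "hr (subst (under \<sigma> s) A) (map (lift_tm \<sigma>) ts)"
    let ?M' = "Mem \<sigma> (Var \<sigma> 0) (lift_tm \<sigma> ?t)"
    have t: "?t \<Colon> Star \<sigma>" and H: "wff ?H" using assms * rss by (auto intro!: wff_hr)
    have ex: "?\<Delta> \<tturnstile> BEx \<sigma> Z (?M' \<^bold>\<and> ?H)" using rss by (auto intro!: Assm simp: lift_tm_subst_tm)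
    have "(?M' \<^bold>\<and> ?H) # Mem \<sigma> (Var \<sigma> 0) (lift_tm \<sigma> Z) # map (lift \<sigma>) ?\<Delta> \<tturnstile> ?M' \<^bold>\<and> ?H" (is "?\<Delta>' \<tturnstile> _")
      by (simp add: Assm)
    then have "?\<Delta>' \<tturnstile> ?M'" "?\<Delta>' \<tturnstile> ?H" by (blast intro: AndE1 AndE2)+
    then have "?\<Delta>' \<tturnstile> lift \<sigma> (BEx \<sigma> ?t ?H)"
      unfolding lift_quant
      by (intro BExI[of _ _ "Var \<sigma> 0"]) (use t H in auto)
    then have "?\<Delta> \<tturnstile> BEx \<sigma> ?t ?H"
      by (rule BExE[OF ex]) (use t H rss in auto)
    then show "\<exists>ts. ts \<Colon>* hr_tys (BEx \<sigma> t A) \<and> ?\<Delta> \<tturnstile> hr (subst s (BEx \<sigma> t A)) ts"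
      using rss(3) by (intro exI[of _ ts]) (simp del: list.map)
  qed
  ultimately show ?thesis using assms by (intro realizable_AndI realizable_ImpI) auto
qed

text \<open>The first realizer \<open>Z\<close> of the premise has the type \<open>\<phi>\<close> of
  the function sought, and the translated premise at \<open>Z\<close> and \<open>ts\<close> is
  literally the translation at \<open>ts\<close> of the conclusion's body with \<open>Z\<close> for
  the function. What remains is to put \<open>Z\<close> into a singleton.\<close>

lemma realizable_AC:
  assumes "A \<in> AC"
  shows "realizable \<Gamma> A"
  using assms
proof cases
  case (1 A' \<phi> \<rho> \<sigma>)
  let ?A = "subst (under \<sigma> (under \<rho> (shift \<phi>))) A'"
  let ?B = "All \<rho> (BEx \<sigma> (lift_tm \<rho> (Var \<phi> 0) \<cdot> Var \<rho> 0) ?A)"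
  have wfB: "wff ?B" using 1 by (auto intro: has_ty_App)
  have "realizable (All \<rho> (Ex \<sigma> A') # \<Gamma>) (Ex \<phi> ?B)"
  proof (rule realizableI)
    fix s rss assume *: "wts s" "realizer_tys rss (All \<rho> (Ex \<sigma> A') # \<Gamma>)"
    then obtain Z ts rss' where rss: "rss = (Z # ts) # rss'" "Z \<Colon> \<phi>" "ts \<Colon>* map (\<lambda>\<tau>. \<rho> \<rightarrow> \<tau>) (hr_tys A')"
      using 1 by (auto simp: list_all2_Cons2)
    let ?\<Delta> = "hyps s (All \<rho> (Ex \<sigma> A') # \<Gamma>) rss"
    have l: "length ts = length (hr_tys ?B)" using list_all2_lengthD[OF rss(3)] by simp
    have "?\<Delta> \<tturnstile> hr (subst s (All \<rho> (Ex \<sigma> A'))) (Z # ts)"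
      using rss(1) by (simp add: Assm)
    then have "?\<Delta> \<tturnstile> hr (subst (scons \<phi> Z s) ?B) ts"
      by (simp add: subst_subst under_comp comp_def lift_tm_def[of \<rho> Z])
    then have "?\<Delta> \<tturnstile> inst \<phi> Z (hr (subst (under \<phi> s) ?B) (map (lift_tm \<phi>) ts))"
      using l by (simp add: inst_hr comp_def del: hr.simps subst.simps)
    then have "?\<Delta> \<tturnstile> BEx \<phi> (Sing \<phi> \<cdot> Z) (hr (subst (under \<phi> s) ?B) (map (lift_tm \<phi>) ts))"
      using rss wfB *(1)
      by (intro BExI[of _ _ Z] Mem_Sing wff_hr) (auto intro: has_ty_App has_ty_const simp del: hr.simps subst.simps wff.simps)
    then have "?\<Delta> \<tturnstile> hr (subst s (Ex \<phi> ?B)) ((Sing \<phi> \<cdot> Z) # ts)"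
      by simp
    then show "\<exists>ts. ts \<Colon>* hr_tys (Ex \<phi> ?B) \<and> ?\<Delta> \<tturnstile> hr (subst s (Ex \<phi> ?B)) ts"
      using rss by (intro exI[of _ "(Sing \<phi> \<cdot> Z) # ts"])
        (auto intro: has_ty_App has_ty_const simp del: hr.simps subst.simps list.map)
  qed
  then show ?thesis unfolding 1(1) using 1 wfB by (intro realizable_ImpI) auto
qed

text \<open>Since \<open>B\<close> takes no realizers, the candidate set \<open>Z\<close> in the
  realizer of the premise is not a function of anything but already a term of type
  \<open>Star \<sigma>\<close>. The translated premise then coincides with the translation of the
  conclusion's body at \<open>Z\<close>.\<close>

lemma realizable_IP:
  assumes "A \<in> IP"
  shows "realizable \<Gamma> A"
  using assms
proof cases
  case (1 A' B \<sigma>)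
  let ?\<phi> = "Star \<sigma>"
  let ?A = "subst (under \<sigma> (shift ?\<phi>)) A'"
  let ?C = "lift ?\<phi> B \<^bold>\<longrightarrow> BEx \<sigma> (Var ?\<phi> 0) ?A"
  have wfC: "wff ?C" using 1 by auto
  have B: "hr_tys B = []" "hr (subst s B) [] = subst s B" for s
    using hr_ex_free[of B] hr_ex_free[of "subst s B"] 1(4) by auto
  have "realizable ((B \<^bold>\<longrightarrow> Ex \<sigma> A') # \<Gamma>) (Ex ?\<phi> ?C)"
  proof (rule realizableI)
    fix s rss assume *: "wts s" "realizer_tys rss ((B \<^bold>\<longrightarrow> Ex \<sigma> A') # \<Gamma>)"
    then obtain Z ts rss' where rss: "rss = (Z # ts) # rss'" "Z \<Colon> ?\<phi>" "ts \<Colon>* hr_tys A'"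
      using B by (auto simp: list_all2_Cons2)
    let ?\<Delta> = "hyps s ((B \<^bold>\<longrightarrow> Ex \<sigma> A') # \<Gamma>) rss"
    have l: "length ts = length (hr_tys ?C)" using list_all2_lengthD[OF rss(3)] B by simp
    have "?\<Delta> \<tturnstile> hr (subst s (B \<^bold>\<longrightarrow> Ex \<sigma> A')) (Z # ts)"
      using rss(1) by (simp add: Assm)
    then have "?\<Delta> \<tturnstile> hr (subst (scons ?\<phi> Z s) ?C) ts"
      by (simp add: subst_subst under_comp comp_def B)
    then have "?\<Delta> \<tturnstile> inst ?\<phi> Z (hr (subst (under ?\<phi> s) ?C) (map (lift_tm ?\<phi>) ts))"
      using l by (simp add: inst_hr comp_def del: hr.simps subst.simps)
    then have "?\<Delta> \<tturnstile> BEx ?\<phi> (Sing ?\<phi> \<cdot> Z) (hr (subst (under ?\<phi> s) ?C) (map (lift_tm ?\<phi>) ts))"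
      using rss wfC *(1) B
      by (intro BExI[of _ _ Z] Mem_Sing wff_hr) (auto intro: has_ty_App has_ty_const simp del: hr.simps subst.simps wff.simps)
    then have "?\<Delta> \<tturnstile> hr (subst s (Ex ?\<phi> ?C)) ((Sing ?\<phi> \<cdot> Z) # ts)"
      by simp
    then show "\<exists>ts. ts \<Colon>* hr_tys (Ex ?\<phi> ?C) \<and> ?\<Delta> \<tturnstile> hr (subst s (Ex ?\<phi> ?C)) ts"
      using rss B by (intro exI[of _ "(Sing ?\<phi> \<cdot> Z) # ts"])
        (auto intro: has_ty_App has_ty_const simp del: hr.simps subst.simps list.map)
  qed
  then show ?thesis unfolding 1(1) using 1 wfC by (intro realizable_ImpI) auto
qed

text \<open>The premise supplies base realizers \<open>xs\<close> and step functions
  \<open>us\<close>, each taking the number and a whole tuple; since every component of the next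
  tuple depends on all components of the last, the recursion has to be simultaneous. An induction
  inside the theory then verifies the result \<open>Ys\<close>.\<close>

lemma realizable_induction:
  assumes "wff A"
  shows "realizable \<Gamma>
    (inst N Zero A \<^bold>\<and> All N (A \<^bold>\<longrightarrow> subst (Var(N := (Var N)(0 := Succ \<cdot> Var N 0))) A) \<^bold>\<longrightarrow> All N A)"
proof -
  let ?S = "Succ \<cdot> Var N 0" and ?\<tau>s = "hr_tys A"
  let ?AS = "subst (scons N ?S (shift N)) A"
  let ?P = "inst N Zero A \<^bold>\<and> All N (A \<^bold>\<longrightarrow> ?AS)"
  have S: "?S \<Colon> N" by (auto intro: has_ty_App has_ty_const)
  have "realizable (?P # \<Gamma>) (All N A)"
  proof (rule realizableI)
    fix s rss assume *: "wts s" "realizer_tys rss (?P # \<Gamma>)"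
    then obtain vs rss' where rss: "rss = vs # rss'" "vs \<Colon>* hr_tys ?P"
      by (auto simp: list_all2_Cons2)
    define xs us where "xs = take (length ?\<tau>s) vs" and "us = drop (length ?\<tau>s) vs"
    have xs: "xs \<Colon>* ?\<tau>s" and us: "us \<Colon>* map (\<lambda>\<tau>. N \<rightarrow> ?\<tau>s \<rightarrow>* \<tau>) ?\<tau>s"
      using rss(2) by (auto simp: list_all2_append_right xs_def us_def comp_def)
    obtain Ys where Ys: "Ys \<Colon>* map (\<lambda>\<tau>. N \<rightarrow> \<tau>) ?\<tau>s"
      and Y0: "\<And>s i \<Gamma>. wts s \<Longrightarrow> i < length ?\<tau>s \<Longrightarrow> \<Gamma> \<tturnstile> Eq (?\<tau>s ! i) (subst_tm s (Ys ! i) \<cdot> Zero) (subst_tm s (xs ! i))"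
      and YS: "\<And>s i n \<Gamma>. wts s \<Longrightarrow> i < length ?\<tau>s \<Longrightarrow> n \<Colon> N \<Longrightarrow>
        \<Gamma> \<tturnstile> Eq (?\<tau>s ! i) (subst_tm s (Ys ! i) \<cdot> (Succ \<cdot> n)) (subst_tm s (us ! i) \<cdot> n \<cdot>* map (\<lambda>Y. subst_tm s Y \<cdot> n) Ys)"
      using ex_simultaneous_recursor[OF xs us] by blast
    have l: "length Ys = length ?\<tau>s" "length us = length ?\<tau>s" "length xs = length ?\<tau>s"
      using list_all2_lengthD[OF Ys] list_all2_lengthD[OF us] list_all2_lengthD[OF xs] by auto
    have Yn: "map (\<lambda>Y. subst_tm r Y \<cdot> n) Ys \<Colon>* ?\<tau>s" if "wts r" "n \<Colon> N" for r n
      using has_tys_App[of "map (subst_tm r) Ys" N ?\<tau>s n] Ys that by (simp add: comp_def)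
    let ?\<Delta> = "hyps s (?P # \<Gamma>) rss"
    have "?\<Delta> \<tturnstile> hr (subst s ?P) vs" using rss(1) by (simp add: Assm)
    then have and': "?\<Delta> \<tturnstile> hr (subst (scons N Zero s) A) xs \<^bold>\<and> hr (subst s (All N (A \<^bold>\<longrightarrow> ?AS))) us"
      by (simp add: subst_inst xs_def us_def del: hr.simps(6,7) subst.simps(6,7))
    let ?A = "subst (under N s) A"
    let ?Y = "\<lambda>n. map (\<lambda>Y. lift_tm N Y \<cdot> n) Ys"
    let ?H = "hr ?A (?Y (Var N 0))"
    have Y_ty: "?Y (Var N 0) \<Colon>* ?\<tau>s" "?Y ?S \<Colon>* ?\<tau>s"
      using Yn[of "shift N"] S by (auto simp: lift_tm_def)
    have H: "wff ?H" using assms * Y_ty by (auto intro!: wff_hr)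
    have "?\<Delta> \<tturnstile> All N ?H"
    proof (rule induct_deriv[OF _ _ H])
      have "?\<Delta> \<tturnstile> hr (subst (scons N Zero s) A) (map (\<lambda>Y. Y \<cdot> Zero) Ys)"
      proof (rule hr_mono[OF AndE1[OF and']])
        show "?\<Delta> \<tturnstile> le (hr_tys (subst (scons N Zero s) A) ! i) (xs ! i) (map (\<lambda>Y. Y \<cdot> Zero) Ys ! i)"
          if "i < length (hr_tys (subst (scons N Zero s) A))" for i
          using Y0[of Var i ?\<Delta>] nth_has_ty[OF xs, of i] nth_has_ty[OF Yn[of Var Zero], of i] that l
          by (auto intro: Eq_sym_le simp del: list.map)
      qed (use assms * xs Yn[of Var Zero] in auto)
      then show "?\<Delta> \<tturnstile> inst N Zero ?H" using l by (simp add: inst_hr comp_def)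
      let ?\<Delta>' = "?H # map (lift N) ?\<Delta>"
      let ?A' = "subst (scons N ?S (shift N \<odot> s)) A"
      let ?us = "map (\<lambda>u. lift_tm N u \<cdot> Var N 0) us"
      let ?us' = "map (\<lambda>u. u \<cdot>* ?Y (Var N 0)) ?us"
      have us_ty: "?us \<Colon>* map (\<lambda>\<tau>. ?\<tau>s \<rightarrow>* \<tau>) ?\<tau>s"
        using has_tys_App[of "map (lift_tm N) us" N "map (\<lambda>\<tau>. ?\<tau>s \<rightarrow>* \<tau>) ?\<tau>s" "Var N 0"] us by (simp add: comp_def)
      have "map (lift N) ?\<Delta> \<tturnstile> lift N (hr (subst s (All N (A \<^bold>\<longrightarrow> ?AS))) us)"
        by (rule deriv_lift[OF AndE2[OF and']])
      then have "map (lift N) ?\<Delta> \<tturnstile> hr (All N (subst (under N (shift N \<odot> s)) (A \<^bold>\<longrightarrow> ?AS))) (map (lift_tm N) us)"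
        using l by (simp add: lift_hr lift_quant subst_subst under_comp del: hr.simps list.map subst.simps(6))
      moreover have "inst N (Var N 0) (subst (under N (shift N \<odot> s)) (A \<^bold>\<longrightarrow> ?AS)) = ?A \<^bold>\<longrightarrow> ?A'"
        unfolding inst_under by (simp add: under_alt subst_subst)
      ultimately have "map (lift N) ?\<Delta> \<tturnstile> hr (?A \<^bold>\<longrightarrow> ?A') ?us"
        using hr_AllE[of "map (lift N) ?\<Delta>" N "subst (under N (shift N \<odot> s)) (A \<^bold>\<longrightarrow> ?AS)" "map (lift_tm N) us" "Var N 0"] l
        by (simp add: comp_def del: hr.simps list.map subst.simps)
      then have "?\<Delta>' \<tturnstile> hr (?A \<^bold>\<longrightarrow> ?A') ?us"
        by (rule weaken) (simp only: list.set, blast)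
      from hr_ImpE[OF this, of "?Y (Var N 0)"]
      have *: "?\<Delta>' \<tturnstile> hr ?A' ?us'"
        using Y_ty l by (simp add: Assm del: map_map)
      \<comment> \<open>By \<open>YS\<close>, the value of \<open>Ys\<close> at the successor equals
        the step functions applied to the number and the previous tuple; as an inclusion this
        carries the translated step over to \<open>Ys\<close>.\<close>
      have "?\<Delta>' \<tturnstile> hr ?A' (?Y ?S)"
      proof (rule hr_mono[OF *])
        have us'_ty: "?us' \<Colon>* ?\<tau>s" using has_tys_Apps[OF us_ty Y_ty(1)] .
        then show "?us' \<Colon>* hr_tys ?A'" by simp
        show "?\<Delta>' \<tturnstile> le (hr_tys ?A' ! i) (?us' ! i) (?Y ?S ! i)" if "i < length (hr_tys ?A')" for i
        proof -
          have "?\<Delta>' \<tturnstile> Eq (?\<tau>s ! i) (?Y ?S ! i) (?us' ! i)"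
            using YS[of "shift N" i "Var N 0" ?\<Delta>'] that l by (simp add: lift_tm_def[symmetric] del: list.map)
          then show ?thesis
            using nth_has_ty[OF us'_ty, of i] nth_has_ty[OF Y_ty(2), of i] that by (simp add: Eq_sym_le del: list.map nth_map)
        qed
      qed (use assms \<open>wts s\<close> S Y_ty in auto)
      then show "?\<Delta>' \<tturnstile> subst (scons N ?S (shift N)) ?H"
        using l by (simp add: subst_hr subst_subst subst_tm_subst_tm comp_def lift_tm_def[abs_def] del: list.map)
    qed
    then have "?\<Delta> \<tturnstile> hr (subst s (All N A)) Ys" by simp
    with Ys show "\<exists>ts. ts \<Colon>* hr_tys (All N A) \<and> ?\<Delta> \<tturnstile> hr (subst s (All N A)) ts" by auto
  qed
  then show ?thesis unfolding step_sub_eq using assms S by (intro realizable_ImpI) auto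
qed

text \<open>Only the axioms for bounded quantifiers and induction contain arbitrary formulas. All
  others are exists-free and hence their own translations.\<close>

lemma realizable_HA:
  assumes "A \<in> HA"
  shows "realizable \<Gamma> A"
  using assms
proof cases
  case IL
  from \<open>A \<in> IL\<close> show ?thesis
  proof cases
    case (ball t \<sigma> B)
    then show ?thesis by (simp add: realizable_ball)
  next
    case (bex t \<sigma> B)
    then show ?thesis by (simp add: realizable_bex)
  qed (use assms HA_sub in \<open>auto intro!: realizable_ex_free simp: inst_def atomic_ex_free\<close>)
next
  case (induction B)
  then show ?thesis by (simp add: realizable_induction)
qed (use assms HA_sub in \<open>auto intro!: realizable_ex_free\<close>)

end

section \<open>Soundness and extraction of closed terms\<close>

lemma wff_axioms:
  assumes "A \<in> HA \<union> AC \<union> IP"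
  shows "wff A"
proof -
  have "wff A" if "A \<in> IL" for A
    using that by cases (auto intro!: has_ty_App has_ty_const)
  moreover have "wff A" if "A \<in> AC" for A
    using that by cases (auto intro: has_ty_App)
  moreover have "wff A" if "A \<in> IP" for A
    using that by cases auto
  moreover have "wff A" if "A \<in> HA" for A
    using that
  proof cases
    case (induction B)
    have "Succ \<cdot> Var N 0 \<Colon> N" by (auto intro: has_ty_App has_ty_const)
    with induction show ?thesis by (simp add: step_sub_eq)
  qed (use calculation(1) in \<open>auto intro!: has_ty_App has_ty_const\<close>)
  ultimately show ?thesis using assms by blast
qed

lemma soundness:
  assumes T: "\<And>B. B \<in> T \<Longrightarrow> wff B \<and> ex_free B"
    and "deriv (HA \<union> AC \<union> IP \<union> T) \<Gamma> A" "\<And>B. B \<in> set \<Gamma> \<Longrightarrow> wff B"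
  shows "ha_theory.realizable (HA \<union> T) \<Gamma> A"
proof -
  interpret ha_theory "HA \<union> T" by unfold_locales blast
  \<comment> \<open>Some rules, such as \<open>OrE\<close> and \<open>ExE\<close>, do not record
    that the formulas in them are well formed, which the lemmas on realizability ask for.\<close>
  have wf: "wff A" if "deriv (HA \<union> AC \<union> IP \<union> T) \<Gamma> A" "\<And>B. B \<in> set \<Gamma> \<Longrightarrow> wff B" for \<Gamma> A
    using that(1) by (rule deriv_wff) (use T wff_axioms that(2) in blast)+
  show ?thesis
    using assms(2,3)
  proof (induction rule: deriv.induct)
    case (Axiom A \<Gamma>)
    then show ?case
      using T realizable_HA realizable_AC realizable_IP realizable_ex_free by blast
  next
    case (OrE \<Gamma> A B C)
    have w: "wff (A \<^bold>\<or> B)" "wff A" "wff B" using wf[OF OrE.hyps(1) OrE.prems] by auto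
    then have "wff C" using wf[OF OrE.hyps(2)] OrE.prems by auto
    then show ?case using w OrE.prems by (intro realizable_OrE[OF OrE.IH]) auto
  next
    case (ImpI A \<Gamma> B)
    have "wff B" using wf[OF ImpI.hyps(2)] ImpI.hyps(1) ImpI.prems by auto
    then show ?case using ImpI.hyps(1) ImpI.prems by (intro realizable_ImpI[OF ImpI.IH]) auto
  next
    case (AllI \<sigma> \<Gamma> A)
    have "wff A" by (rule wf[OF AllI.hyps]) (use AllI.prems in auto)
    then show ?case using AllI.prems by (intro realizable_AllI[OF AllI.IH]) auto
  next
    case (ExE \<Gamma> \<sigma> A C)
    have "wff A" using wf[OF ExE.hyps(1) ExE.prems] by auto
    moreover have "wff (lift \<sigma> C)" by (rule wf[OF ExE.hyps(2)]) (use ExE.prems calculation in auto)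
    ultimately show ?case using ExE.prems by (intro realizable_ExE[OF ExE.IH]) auto
  qed (auto intro: realizable_Assm realizable_BotE realizable_AndI realizable_AndE realizable_OrI1
      realizable_OrI2 realizable_ImpE realizable_AllE realizable_ExI)
qed

text \<open>The variables are abstracted as names, without renumbering the remaining ones; hence
  \<open>bracket_abstraction\<close> is used and not \<open>lam_ex\<close>. Its exact account of
  free variables shows when the result is closed.\<close>

lemma (in il_theory) abstract_variables:
  assumes "u \<Colon> \<tau>"
  shows "\<exists>c. c \<Colon> map fst as \<rightarrow>* \<tau> \<and> fv_tm c = fv_tm u - set as \<and>
    [] \<tturnstile> Eq \<tau> (c \<cdot>* map (\<lambda>(\<sigma>, n). Var \<sigma> n) as) u"
proof (induction as)
  case Nil
  show ?case using assms Eq_refl by (intro exI[of _ u]) auto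
next
  case (Cons a as)
  obtain \<sigma> n where a: "a = (\<sigma>, n)" by force
  let ?vs = "map (\<lambda>(\<sigma>, n). Var \<sigma> n) as" and ?\<tau> = "map fst as \<rightarrow>* \<tau>"
  from Cons obtain c where c: "c \<Colon> ?\<tau>" "fv_tm c = fv_tm u - set as" "[] \<tturnstile> Eq \<tau> (c \<cdot>* ?vs) u" by blast
  obtain d where d: "d \<Colon> \<sigma> \<rightarrow> ?\<tau>" "fv_tm d = fv_tm c - {(\<sigma>, n)}" "[] \<tturnstile> Eq ?\<tau> (d \<cdot> Var \<sigma> n) c"
    using bracket_abstraction[OF c(1), of \<sigma> n] by blast
  have vs: "?vs \<Colon>* map fst as" by (auto simp: list_all2_map1 list_all2_map2 list_all2_same)
  have dn: "d \<cdot> Var \<sigma> n \<Colon> ?\<tau>" using d(1) by (auto intro: has_ty_App)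
  have "[] \<tturnstile> Eq \<tau> (d \<cdot> Var \<sigma> n \<cdot>* ?vs) (c \<cdot>* ?vs)"
    using d(3) dn c(1) vs nth_has_ty[OF vs] by (intro Eq_Apps) (auto intro: Eq_refl)
  from Eq_trans[OF this c(3)] have "[] \<tturnstile> Eq \<tau> (d \<cdot> Var \<sigma> n \<cdot>* ?vs) u"
    using has_ty_Apps[OF dn vs] has_ty_Apps[OF c(1) vs] assms by blast
  with c d show ?case by (intro exI[of _ d]) (auto simp: a)
qed

lemma fv_subst_tm: "fv_tm (subst_tm s t) = (\<Union>(\<sigma>, n)\<in>fv_tm t. fv_tm (s \<sigma> n))"
  by (induction t) auto

theorem theorem12:
  fixes A :: fm and T :: "fm set" and as :: "(ty \<times> nat) list"
  assumes "wff A"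
    and "distinct as" and "set as = fv A"
    and "\<And>B. B \<in> T \<Longrightarrow> wff B \<and> ex_free B"
    and "HA \<union> AC \<union> IP \<union> T \<turnstile> A"
  shows "\<exists>ts. list_all2 (\<lambda>t \<tau>. closed_tm t \<and> t \<Colon> map fst as \<rightarrow>* \<tau>) ts (hr_tys A) \<and>
    HA \<union> T \<turnstile> hr A (map (\<lambda>t. t \<cdot>* map (\<lambda>(\<sigma>, n). Var \<sigma> n) as) ts)"
proof -
  interpret ha_theory "HA \<union> T" by unfold_locales blast
  let ?\<tau>s = "hr_tys A" and ?vs = "map (\<lambda>(\<sigma>, n). Var \<sigma> n) as"
  have "realizable [] A" using soundness[of T "[]" A] assms(4,5) by auto
  then obtain us where us: "us \<Colon>* ?\<tau>s" "HA \<union> T \<turnstile> hr A us"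
    by (rule realizableD[of _ _ Var "[]"]) auto
  obtain d where d: "d \<sigma> \<Colon> \<sigma>" "fv_tm (d \<sigma>) = {}" for \<sigma> using ex_closed_tm by metis
  \<comment> \<open>The realizers \<open>us\<close> may contain variables that are not free in
    \<open>A\<close>, for instance from formulas eliminated in the derivation. Here \<open>s\<close>
    fills these with closed terms and leaves \<open>A\<close> itself unchanged.\<close>
  define s :: sub where "s \<sigma> n = (if (\<sigma>, n) \<in> fv A then Var \<sigma> n else d \<sigma>)" for \<sigma> n
  have s: "wts s" using d(1) by (auto simp: wts_def s_def)
  have "subst s A = A" using subst_cong[of A s Var] by (simp add: s_def)
  then have *: "HA \<union> T \<turnstile> hr A (map (subst_tm s) us)"
    using provable_subst[OF us(2) s] list_all2_lengthD[OF us(1)] by (simp add: subst_hr)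
  have fv: "fv_tm (subst_tm s u) \<subseteq> set as" for u
    using d(2) by (auto simp: fv_subst_tm s_def assms(3) split: if_splits)
  have "\<exists>c. c \<Colon> map fst as \<rightarrow>* ?\<tau>s ! i \<and> closed_tm c \<and> HA \<union> T \<turnstile> Eq (?\<tau>s ! i) (c \<cdot>* ?vs) (subst_tm s (us ! i))"
    if i: "i < length ?\<tau>s" for i
    using abstract_variables[of "subst_tm s (us ! i)" "?\<tau>s ! i" as] nth_has_ty[OF us(1) i] s fv[of "us ! i"]
    unfolding closed_tm_def by auto
  then obtain ts where ts: "length ts = length ?\<tau>s" "\<forall>i<length ?\<tau>s. ts ! i \<Colon> map fst as \<rightarrow>* ?\<tau>s ! i \<and>
      closed_tm (ts ! i) \<and> HA \<union> T \<turnstile> Eq (?\<tau>s ! i) (ts ! i \<cdot>* ?vs) (subst_tm s (us ! i))"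
    using Skolem_list_nth[of "length ?\<tau>s" "\<lambda>i c. c \<Colon> map fst as \<rightarrow>* ?\<tau>s ! i \<and> closed_tm c \<and>
      HA \<union> T \<turnstile> Eq (?\<tau>s ! i) (c \<cdot>* ?vs) (subst_tm s (us ! i))"] by auto
  have vs: "?vs \<Colon>* map fst as" by (auto simp: list_all2_map1 list_all2_map2 list_all2_same)
  have ty: "map (\<lambda>t. t \<cdot>* ?vs) ts \<Colon>* ?\<tau>s"
    using has_tys_Apps[OF _ vs, of ts ?\<tau>s] ts by (simp add: list_all2_conv_all_nth)
  \<comment> \<open>Applied to the variables, the closed terms are provably equal to the realizers
    in hand but not identical with them, so monotonicity is needed once more.\<close>
  have "HA \<union> T \<turnstile> hr A (map (\<lambda>t. t \<cdot>* ?vs) ts)"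
  proof (rule hr_mono[OF *])
    show "HA \<union> T \<turnstile> le (?\<tau>s ! i) (map (subst_tm s) us ! i) (map (\<lambda>t. t \<cdot>* ?vs) ts ! i)" if i: "i < length ?\<tau>s" for i
      using ts i nth_has_ty[OF ty i] nth_has_ty[OF us(1) i] list_all2_lengthD[OF us(1)] s
      by (auto intro: Eq_sym_le)
  qed (use assms(1) us(1) s ty in auto)
  moreover have "list_all2 (\<lambda>t \<tau>. closed_tm t \<and> t \<Colon> map fst as \<rightarrow>* \<tau>) ts ?\<tau>s"
    using ts by (simp add: list_all2_conv_all_nth)
  ultimately show ?thesis by blast
qed

end
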